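(* Let $\beta\in[0,1)$ and let $U:\mathbb{R}^d\to\mathbb{R}$ satisfy: (i) $U$ is twice continuously differentiable, $\nabla U(0)=0$, and $\sup_x\|\mathrm{D}^2U(x)\|\le\mathtt{L}$ for some $\mathtt{L}\ge0$; (ii) $U$ is three times continuously differentiable and $\sup_x\|\mathrm{D}^3U(x)\|\le\mathtt{M}$ for some $\mathtt{M}\ge0$; (iii) there exist $\mathtt{m}_\beta>0$ and $\mathtt{L}_\beta,\mathtt{K}_\beta\ge0$ such that for all $\|x\|\ge\mathtt{K}_\beta$, $\|y\|=1$, $\frac{\mathtt{L}_\beta}{1+\|x\|^{3\beta/4}}\ge\mathrm{D}^2U(x)[y,y]\ge\frac{\mathtt{m}_\beta}{1+\|x\|^\beta}$. Let $\bar\eta_\beta=\mathtt{m}_\beta/2^5$ and $W_{\bar\eta_\beta}(x)=\exp\{\bar\eta_\beta(1+\|x\|^2)^{1/2}\}$. Then there exist $\bar\Gamma_\beta>0$ and $\bar A_\beta>0$ with $\pi(W_{\bar\eta_\beta})\le\bar A_\beta$ such that for every $\bar\gamma\in(0,\bar\Gamma_\beta]$ there exist $C_{\bar\gamma,\beta}\ge0$, $\rho_{\bar\gamma,\beta}\in[0,1)$ such that for all $x\in\mathbb{R}^d$, $\gamma\in(0,\bar\gamma]$ and $k\in\mathbb{N}$, $$\|\delta_xR_\gamma^k-\pi\|_{W_{\bar\eta_\beta}}\le C_{\bar\gamma,\beta}\rho_{\bar\gamma,\beta}^{\gamma k}\{W_{\bar\eta_\beta}(x)+\pi(W_{\ba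r\eta_\beta})\}.$$
   Context: $\pi$ denotes the probability density proportional to $e^{-U}$ and the associated measure. For $\gamma>0$, $r_\gamma(x,y)=(4\pi\gamma)^{-d/2}\exp(-\|y-x+\gamma\nabla U(x)\|^2/(4\gamma))$, $\alpha_\gamma(x,y)=1\wedge\frac{\pi(y)r_\gamma(y,x)}{\pi(x)r_\gamma(x,y)}$, and the MALA kernel is $R_\gamma(x,A)=\int\mathbb{1}_A(y)\alpha_\gamma(x,y)r_\gamma(x,y)dy+\delta_x(A)\int\{1-\alpha_\gamma(x,y)\}r_\gamma(x,y)dy$. For $V\ge1$ measurable and a finite signed measure $\mu$, $\|\mu\|_V=\sup\{|\int fd\mu|:\sup_x|f(x)|/V(x)\le1\}$. *)

theory Defs
  imports "HOL-Probability.Probability"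
begin

text \<open>Real power with the convention t^0 = 1 (also for t = 0).\<close>
definition rpow :: "real \<Rightarrow> real \<Rightarrow> real" where
  "rpow t a = (if a = 0 then 1 else t powr a)"

definition pi_meas :: "('a::euclidean_space \<Rightarrow> real) \<Rightarrow> 'a measure" where
  "pi_meas U = density lborel
     (\<lambda>x. ennreal (exp (- U x) / (\<integral>z. exp (- U z) \<partial>lborel)))"

text \<open>Proposal density r_gamma(x,y), g is the gradient of U.\<close>
definition prop_dens :: "('a::euclidean_space \<Rightarrow> 'a) \<Rightarrow> real \<Rightarrow> 'a \<Rightarrow> 'a \<Rightarrow> real" where
  "prop_dens g \<gamma> x y = (4 * pi * \<gamma>) powr (- real DIM('a) / 2)
     * exp (- (norm (y - x + \<gamma> *\<^sub>R g x))\<^sup>2 / (4 * \<gamma>))"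

text \<open>Acceptance probability alpha_gamma(x,y); pi(y)/pi(x) = exp(-U y)/exp(-U x).\<close>
definition accept_prob :: "('a::euclidean_space \<Rightarrow> real) \<Rightarrow> ('a \<Rightarrow> 'a) \<Rightarrow> real \<Rightarrow> 'a \<Rightarrow> 'a \<Rightarrow> real" where
  "accept_prob U g \<gamma> x y = min 1
     ((exp (- U y) * prop_dens g \<gamma> y x) / (exp (- U x) * prop_dens g \<gamma> x y))"

definition mala_kernel :: "('a::euclidean_space \<Rightarrow> real) \<Rightarrow> ('a \<Rightarrow> 'a) \<Rightarrow> real \<Rightarrow> 'a \<Rightarrow> 'a measure" where
  "mala_kernel U g \<gamma> x =
     bind (density lborel (\<lambda>y. ennreal (prop_dens g \<gamma> x y)))
       (\<lambda>y. bind (measure_pmf (bernoulli_pmf (accept_prob U g \<gamma> x y)))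
              (\<lambda>b. return borel (if b then y else x)))"

definition mala_iter :: "('a::euclidean_space \<Rightarrow> real) \<Rightarrow> ('a \<Rightarrow> 'a) \<Rightarrow> real \<Rightarrow> nat \<Rightarrow> 'a \<Rightarrow> 'a measure" where
  "mala_iter U g \<gamma> k x = ((\<lambda>\<mu>. bind \<mu> (mala_kernel U g \<gamma>)) ^^ k) (return borel x)"

definition vnorm :: "('a::euclidean_space \<Rightarrow> real) \<Rightarrow> 'a measure \<Rightarrow> 'a measure \<Rightarrow> real" where
  "vnorm V \<mu> \<nu> = (SUP f \<in> {f. f \<in> borel_measurable borel \<and> (\<forall>x. \<bar>f x\<bar> \<le> V x)}.
       \<bar>(\<integral>x. f x \<partial>\<mu>) - (\<integral>x. f x \<partial>\<nu>)\<bar>)"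

definition Wfun :: "real \<Rightarrow> 'a::euclidean_space \<Rightarrow> real" where
  "Wfun \<eta> x = exp (\<eta> * sqrt (1 + (norm x)\<^sup>2))"

end

(* Everything reduces to a Harris theorem whose constants do not depend on the step size.

   Drift. Write w = y - x + gamma g x for the proposal noise. Then - log of the Metropolis ratio equals
   (U y - U x - g y . (y - x)) + w . (g y - g x) / 2 + gamma |g y - g x|^2 / 4.
   The first term is at most - mu |y - x|^2 / 2 where the Hessian is at least mu, and it absorbs the other two
   up to C |w|^2 as soon as the squared upper curvature bound is dominated by the lower one. Hence the
   rejection probability is at most C (gamma + |w|^2) for all x and y. Since W x - W y <= W x, rejections
   cost only C gamma W x, while the gradient step gains a factor 1 - A gamma for arbitrarily large A far away from 0.

   Minorization. pi(x) r(x,y) min pi(y) r(y,x) is bounded below, by the descent lemma, by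
   exp(-(U x + U y)/2) times a symmetric Gaussian kernel exp(-b |x - y|^2 - b' (|x|^2 + |y|^2)), which is a Doob
   transform of an autoregressive Gaussian kernel. Its iterates are explicit, so about 1 / gamma steps
   give a minorization on balls that is uniform in gamma. *)
theory Submission
  imports Defs
begin

section \<open>Iterated Markov kernels\<close>

text \<open>Uniformity in the step size is a matter of scaling. The drift reads
  \<open>(1 - \<gamma>) W + b \<gamma>\<close>, so \<open>k0\<close> steps with
  \<open>\<gamma> k0\<close> in [1, 2] contract \<open>W\<close> by exp(-1) up to the additive
  constant \<open>b\<close>, whatever \<gamma> is, and the minorization is made for the same
  \<open>k0\<close>. Blocks of length about 1 / \<gamma> then contract at a fixed rate, which yields
  powers with exponent \<open>\<gamma> k\<close>. Curvature is controlled only outside a ball, and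
  for \<beta> > 0 its lower bound decays like |x|^(-\<beta>). Since \<beta> < 1, integrating it
  along a ray still makes the radial gradient unbounded; this is the source of the large
  \<open>A\<close>. The term \<gamma>^2 |g x|^2 of the gradient step is a second obstacle: |g x| <=
  L |x| does not suffice, as g x . x may be of lower order than |x|^2. A cocoercivity estimate along
  rays bounds |g x|^2 by a multiple of g x . x instead. In the minorization every step may lose only
  a factor 1 - O(\<gamma>). This dictates the Gaussian parameters: the exponents are dominated
  without any loss, and only the normalizing constants differ.\<close>

definition kiter :: "'a measure \<Rightarrow> ('a \<Rightarrow> 'a measure) \<Rightarrow> nat \<Rightarrow> 'a \<Rightarrow> 'a measure" where
  "kiter M K k x = ((\<lambda>\<mu>. bind \<mu> K) ^^ k) (return M x)"

lemma kiter_0 [simp]: "kiter M K 0 x = return M x"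
  by (simp add: kiter_def)

lemma kiter_Suc: "kiter M K (Suc k) x = kiter M K k x \<bind> K"
  by (simp add: kiter_def)

lemma measurable_kiter [measurable]:
  assumes [measurable]: "K \<in> M \<rightarrow>\<^sub>M prob_algebra M"
  shows "kiter M K k \<in> M \<rightarrow>\<^sub>M prob_algebra M"
proof (induction k)
  case 0
  show ?case by (simp add: kiter_def[abs_def])
next
  case (Suc k)
  note Suc[measurable]
  show ?case unfolding kiter_Suc[abs_def] by measurable
qed

lemma kernel_prob_space:
  assumes "K \<in> M \<rightarrow>\<^sub>M prob_algebra M" "x \<in> space M"
  shows "prob_space (K x)" "sets (K x) = sets M"
  using measurable_space[OF assms] by (auto simp: space_prob_algebra)

text \<open>Chapman-Kolmogorov. \<open>kiter\<close> appends each new step at the end, whereas the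
  Harris argument splits off the first \<open>k0\<close> steps.\<close>

lemma kiter_add:
  assumes [measurable]: "K \<in> M \<rightarrow>\<^sub>M prob_algebra M"
    and x: "x \<in> space M"
  shows "kiter M K (m + n) x = kiter M K m x \<bind> kiter M K n"
proof (induction n)
  case 0
  have "sets (kiter M K m x) = sets M"
    using kernel_prob_space(2)[OF measurable_kiter x] assms by blast
  then show ?case using bind_return''[of "kiter M K m x" M]
    by (simp add: kiter_def[abs_def] eta_contract_eq)
next
  case (Suc n)
  have "sets (kiter M K m x) = sets M"
    using kernel_prob_space(2)[OF measurable_kiter x] assms by blast
  then have "kiter M K n \<in> kiter M K m x \<rightarrow>\<^sub>M subprob_algebra M"
    using measurable_prob_algebraD[OF measurable_kiter[OF assms(1)]]
    by (simp cong: measurable_cong_sets)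
  moreover have "K \<in> M \<rightarrow>\<^sub>M subprob_algebra M"
    by (rule measurable_prob_algebraD) fact
  ultimately show ?case
    using Suc bind_assoc[of "kiter M K n" "kiter M K m x" M K M]
    by (simp add: kiter_Suc[abs_def])
qed

lemma nn_integral_kernel_measurable:
  assumes "K \<in> M \<rightarrow>\<^sub>M prob_algebra M" "f \<in> borel_measurable M"
  shows "(\<lambda>x. \<integral>\<^sup>+y. f y \<partial>K x) \<in> borel_measurable M"
  using nn_integral_measurable_subprob_algebra[OF assms(2)] measurable_prob_algebraD[OF assms(1)]
    measurable_compose by blast

lemma nn_integral_bind_kernel:
  assumes "sets \<mu> = sets M" "K \<in> M \<rightarrow>\<^sub>M prob_algebra M" "f \<in> borel_measurable M"
  shows "(\<integral>\<^sup>+x. f x \<partial>(\<mu> \<bind> K)) = (\<integral>\<^sup>+x. \<integral>\<^sup>+y. f y \<partial>K x \<partial>\<mu>)"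
  using assms measurable_prob_algebraD[OF assms(2)]
  by (intro nn_integral_bind[where B=M]) (auto cong: measurable_cong_sets)

lemma nn_integral_kiter_Suc:
  assumes "K \<in> M \<rightarrow>\<^sub>M prob_algebra M" "x \<in> space M" "f \<in> borel_measurable M"
  shows "(\<integral>\<^sup>+y. f y \<partial>kiter M K (Suc k) x) = (\<integral>\<^sup>+y. \<integral>\<^sup>+z. f z \<partial>K y \<partial>kiter M K k x)"
  unfolding kiter_Suc
  using kernel_prob_space(2)[OF measurable_kiter[OF assms(1)] assms(2)] assms
  by (intro nn_integral_bind_kernel) auto

lemma integrable_of_nn_integral_le:
  fixes V :: "'a \<Rightarrow> real"
  assumes "f \<in> borel_measurable M" "\<And>x. x \<in> space M \<Longrightarrow> \<bar>f x\<bar> \<le> V x"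
    and "(\<integral>\<^sup>+x. ennreal (V x) \<partial>M) < \<infinity>"
  shows "integrable M f"
proof (rule integrableI_bounded)
  have "(\<integral>\<^sup>+x. ennreal (norm (f x)) \<partial>M) \<le> (\<integral>\<^sup>+x. ennreal (V x) \<partial>M)"
    using assms by (intro nn_integral_mono) (auto intro: ennreal_leI)
  then show "(\<integral>\<^sup>+x. ennreal (norm (f x)) \<partial>M) < \<infinity>"
    using assms(3) by (simp add: le_less_trans)
qed fact

text \<open>Unlike \<open>integral_bind\<close>, the integrand may be unbounded.\<close>
lemma integral_bind_kernel:
  fixes f V :: "'a \<Rightarrow> real"
  assumes \<mu>: "sets \<mu> = sets M" and K: "K \<in> M \<rightarrow>\<^sub>M prob_algebra M"
    and f [measurable]: "f \<in> borel_measurable M"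
    and V [measurable]: "V \<in> borel_measurable M"
    and fV: "\<And>x. x \<in> space M \<Longrightarrow> \<bar>f x\<bar> \<le> V x"
    and KV: "\<And>x. x \<in> space M \<Longrightarrow> (\<integral>\<^sup>+y. ennreal (V y) \<partial>K x) < \<infinity>"
    and bV: "(\<integral>\<^sup>+x. ennreal (V x) \<partial>(\<mu> \<bind> K)) < \<infinity>"
  shows "integrable \<mu> (\<lambda>x. \<integral>y. f y \<partial>K x)"
    and "(\<integral>x. f x \<partial>(\<mu> \<bind> K)) = (\<integral>x. (\<integral>y. f y \<partial>K x) \<partial>\<mu>)"
proof -
  have sp: "space \<mu> = space M" using \<mu> by (rule sets_eq_imp_space_eq)
  have sK: "sets (K x) = sets M" if "x \<in> space M" for x
    using kernel_prob_space[OF K that] by auto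
  have spK: "space (K x) = space M" if "x \<in> space M" for x
    using sK[OF that] by (rule sets_eq_imp_space_eq)
  have sb: "sets (\<mu> \<bind> K) = sets M"
  proof (cases "space M = {}")
    case True
    then show ?thesis using sp \<mu> by (simp add: bind_empty space_empty_iff)
  next
    case False
    then show ?thesis using sp sK by (intro sets_bind) auto
  qed
  have pos: "integrable \<mu> (\<lambda>x. \<integral>y. g y \<partial>K x) \<and>
      (\<integral>x. g x \<partial>(\<mu> \<bind> K)) = (\<integral>x. (\<integral>y. g y \<partial>K x) \<partial>\<mu>)"
    if g [measurable]: "g \<in> borel_measurable M" and g0: "\<And>x. 0 \<le> g x"
      and gV: "\<And>x. x \<in> space M \<Longrightarrow> g x \<le> V x" for g :: "'a \<Rightarrow> real"
  proof -
    have intg: "integrable (K x) g" if x: "x \<in> space M" for x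
      by (rule integrable_of_nn_integral_le[OF _ _ KV[OF x]])
        (use x sK spK g0 gV in \<open>auto cong: measurable_cong_sets\<close>)
    then have eq: "(\<integral>\<^sup>+y. ennreal (g y) \<partial>K x) = ennreal (\<integral>y. g y \<partial>K x)" if "x \<in> space M" for x
      using that g0 by (intro nn_integral_eq_integral) auto
    have m: "(\<lambda>x. \<integral>y. g y \<partial>K x) \<in> borel_measurable \<mu>"
      using measurable_compose[OF measurable_prob_algebraD[OF K]
        integral_measurable_subprob_algebra[OF g]] \<mu>
      by (simp cong: measurable_cong_sets)
    have nn: "(\<integral>\<^sup>+x. ennreal (g x) \<partial>(\<mu> \<bind> K)) = (\<integral>\<^sup>+x. ennreal (\<integral>y. g y \<partial>K x) \<partial>\<mu>)"
      using nn_integral_bind_kernel[OF \<mu> K, of "\<lambda>x. ennreal (g x)"]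
        nn_integral_cong[of \<mu> "\<lambda>x. \<integral>\<^sup>+y. ennreal (g y) \<partial>K x" "\<lambda>x. ennreal (\<integral>y. g y \<partial>K x)"] eq sp
      by simp
    have "(\<integral>\<^sup>+x. ennreal (g x) \<partial>(\<mu> \<bind> K)) \<le> (\<integral>\<^sup>+x. ennreal (V x) \<partial>(\<mu> \<bind> K))"
      using gV sets_eq_imp_space_eq[OF sb] by (intro nn_integral_mono) (auto intro: ennreal_leI)
    then have fin: "(\<integral>\<^sup>+x. ennreal (g x) \<partial>(\<mu> \<bind> K)) < \<infinity>"
      using bV by (simp add: le_less_trans)
    have i: "integrable \<mu> (\<lambda>x. \<integral>y. g y \<partial>K x)"
      using m fin nn g0 by (intro integrableI_nonneg) auto
    moreover have "integrable (\<mu> \<bind> K) g"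
      using fin g0 sb by (intro integrableI_nonneg) (auto cong: measurable_cong_sets)
    ultimately have "ennreal (\<integral>x. g x \<partial>(\<mu> \<bind> K)) = ennreal (\<integral>x. (\<integral>y. g y \<partial>K x) \<partial>\<mu>)"
      using nn g0 by (simp add: nn_integral_eq_integral)
    then have "(\<integral>x. g x \<partial>(\<mu> \<bind> K)) = (\<integral>x. (\<integral>y. g y \<partial>K x) \<partial>\<mu>)"
      using g0 by (subst (asm) ennreal_inj) auto
    then show ?thesis using i by simp
  qed
  let ?p = "\<lambda>x. max 0 (f x)" and ?n = "\<lambda>x. max 0 (- f x)"
  have V0: "0 \<le> V x" if "x \<in> space M" for x using fV[OF that] by linarith
  have p: "integrable \<mu> (\<lambda>x. \<integral>y. ?p y \<partial>K x)"
      "(\<integral>x. ?p x \<partial>(\<mu> \<bind> K)) = (\<integral>x. (\<integral>y. ?p y \<partial>K x) \<partial>\<mu>)"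
    using pos[of ?p] V0 fV by (auto simp: abs_le_iff)
  have n: "integrable \<mu> (\<lambda>x. \<integral>y. ?n y \<partial>K x)"
      "(\<integral>x. ?n x \<partial>(\<mu> \<bind> K)) = (\<integral>x. (\<integral>y. ?n y \<partial>K x) \<partial>\<mu>)"
    using pos[of ?n] V0 fV by (auto simp: abs_le_iff)
  have ib: "integrable (\<mu> \<bind> K) ?p" "integrable (\<mu> \<bind> K) ?n"
    by (rule integrable_of_nn_integral_le[OF _ _ bV],
        use sb sets_eq_imp_space_eq[OF sb] V0 fV in \<open>auto cong: measurable_cong_sets simp: abs_le_iff\<close>)+
  have iK: "integrable (K x) ?p" "integrable (K x) ?n" if x: "x \<in> space M" for x
    by (rule integrable_of_nn_integral_le[OF _ _ KV[OF x]],
        use x sK spK V0 fV in \<open>auto cong: measurable_cong_sets simp: abs_le_iff\<close>)+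
  have f_eq: "f = (\<lambda>x. ?p x - ?n x)" by auto
  have K_eq: "(\<integral>y. f y \<partial>K x) = (\<integral>y. ?p y \<partial>K x) - (\<integral>y. ?n y \<partial>K x)" if "x \<in> space M" for x
    by (subst f_eq) (rule Bochner_Integration.integral_diff[OF iK[OF that]])
  have "integrable \<mu> (\<lambda>x. (\<integral>y. ?p y \<partial>K x) - (\<integral>y. ?n y \<partial>K x))"
    using p n by auto
  then show "integrable \<mu> (\<lambda>x. \<integral>y. f y \<partial>K x)"
    using K_eq sp by (subst Bochner_Integration.integrable_cong[OF refl]) auto
  have "(\<integral>x. f x \<partial>(\<mu> \<bind> K)) = (\<integral>x. ?p x \<partial>(\<mu> \<bind> K)) - (\<integral>x. ?n x \<partial>(\<mu> \<bind> K))"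
    by (subst f_eq) (rule Bochner_Integration.integral_diff[OF ib])
  also have "\<dots> = (\<integral>x. (\<integral>y. ?p y \<partial>K x) - (\<integral>y. ?n y \<partial>K x) \<partial>\<mu>)"
    using p n by simp
  also have "\<dots> = (\<integral>x. (\<integral>y. f y \<partial>K x) \<partial>\<mu>)"
    using K_eq sp by (intro Bochner_Integration.integral_cong) auto
  finally show "(\<integral>x. f x \<partial>(\<mu> \<bind> K)) = (\<integral>x. (\<integral>y. f y \<partial>K x) \<partial>\<mu>)" .
qed

section \<open>Harris' theorem\<close>

text \<open>Writing the additive drift constant as \<open>b * \<delta>\<close> makes
  \<open>b\<close> the fixed point of the affine recursion, so the accumulated constant stays
  \<open>b\<close> however small \<delta> is.\<close>

lemma nn_integral_kiter_drift:
  fixes V :: "'a \<Rightarrow> real"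
  assumes K: "K \<in> M \<rightarrow>\<^sub>M prob_algebra M" and V [measurable]: "V \<in> borel_measurable M"
    and V0: "\<And>x. 0 \<le> V x" and \<delta>: "0 < \<delta>" "\<delta> \<le> 1" and b: "0 \<le> b"
    and drift: "\<And>x. x \<in> space M \<Longrightarrow> (\<integral>\<^sup>+y. ennreal (V y) \<partial>K x) \<le> ennreal ((1 - \<delta>) * V x + b * \<delta>)"
    and x: "x \<in> space M"
  shows "(\<integral>\<^sup>+y. ennreal (V y) \<partial>kiter M K k x) \<le> ennreal ((1 - \<delta>) ^ k * V x + b)"
proof (induction k)
  case 0
  show ?case using x b by (simp add: nn_integral_return ennreal_leI)
next
  case (Suc k)
  note ps = kernel_prob_space[OF measurable_kiter[OF K] x, of k]
  interpret prob_space "kiter M K k x" by (rule ps)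
  have [measurable]: "V \<in> borel_measurable (kiter M K k x)"
    using V ps(2) by (simp cong: measurable_cong_sets)
  have "(\<integral>\<^sup>+y. ennreal (V y) \<partial>kiter M K (Suc k) x)
      = (\<integral>\<^sup>+y. \<integral>\<^sup>+z. ennreal (V z) \<partial>K y \<partial>kiter M K k x)"
    using nn_integral_kiter_Suc[OF K x] by simp
  also have "\<dots> \<le> (\<integral>\<^sup>+y. ennreal (1 - \<delta>) * ennreal (V y) + ennreal (b * \<delta>) \<partial>kiter M K k x)"
    using drift sets_eq_imp_space_eq[OF ps(2)] \<delta> b V0
    by (intro nn_integral_mono) (simp flip: ennreal_mult ennreal_plus)
  also have "\<dots> = ennreal (1 - \<delta>) * (\<integral>\<^sup>+y. ennreal (V y) \<partial>kiter M K k x) + ennreal (b * \<delta>)"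
    by (subst nn_integral_add) (auto simp: nn_integral_cmult emeasure_space_1)
  also have "\<dots> \<le> ennreal (1 - \<delta>) * ennreal ((1 - \<delta>) ^ k * V x + b) + ennreal (b * \<delta>)"
    using Suc by (intro add_mono mult_left_mono) auto
  also have "\<dots> = ennreal ((1 - \<delta>) * ((1 - \<delta>) ^ k * V x + b) + b * \<delta>)"
    using \<delta> b V0 by (simp flip: ennreal_mult ennreal_plus)
  also have "(1 - \<delta>) * ((1 - \<delta>) ^ k * V x + b) + b * \<delta> = (1 - \<delta>) ^ Suc k * V x + b"
    by (simp add: algebra_simps)
  finally show ?case .
qed

lemma integral_le_of_nn_integral_le:
  fixes V :: "'a \<Rightarrow> real"
  assumes "V \<in> borel_measurable \<mu>" "\<And>x. 0 \<le> V x" "(\<integral>\<^sup>+x. ennreal (V x) \<partial>\<mu>) \<le> ennreal c" "0 \<le> c"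
  shows "integrable \<mu> V" "(\<integral>x. V x \<partial>\<mu>) \<le> c"
proof -
  have "(\<integral>\<^sup>+x. ennreal (V x) \<partial>\<mu>) < \<infinity>"
    using assms(3) by (simp add: le_less_trans)
  then show i: "integrable \<mu> V"
    using assms by (intro integrableI_nonneg) auto
  then have "ennreal (\<integral>x. V x \<partial>\<mu>) \<le> ennreal c"
    using assms by (simp add: nn_integral_eq_integral)
  then show "(\<integral>x. V x \<partial>\<mu>) \<le> c" using assms(4) by simp
qed

text \<open>An oscillation bound for \<open>\<phi>\<close> becomes a pointwise bound after subtracting a constant \<open>s\<close>;
  then the minorization is applied to the nonnegative functions \<open>c (1 + t V) \<plusminus> (\<phi> - s)\<close>.\<close>
lemma harris_contraction:
  fixes V \<phi> :: "'a \<Rightarrow> real"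
  assumes Q: "Q \<in> M \<rightarrow>\<^sub>M prob_algebra M" and V [measurable]: "V \<in> borel_measurable M"
    and V0: "\<And>x. 0 \<le> V x"
    and drift: "\<And>x. x \<in> space M \<Longrightarrow> (\<integral>\<^sup>+y. ennreal (V y) \<partial>Q x) \<le> ennreal (\<zeta> * V x + b)"
    and \<zeta>: "0 \<le> \<zeta>" and b: "0 \<le> b"
    and \<nu>: "prob_space \<nu>" "sets \<nu> = sets M" and \<epsilon>: "0 < \<epsilon>"
    and minor: "\<And>x h. x \<in> space M \<Longrightarrow> V x \<le> r \<Longrightarrow> h \<in> borel_measurable M \<Longrightarrow>
      ennreal \<epsilon> * (\<integral>\<^sup>+y. h y \<partial>\<nu>) \<le> (\<integral>\<^sup>+y. h y \<partial>Q x)"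
    and t: "0 < t" "2 * t * b \<le> \<epsilon>"
    and a: "1 - \<epsilon> / 2 \<le> a" "\<zeta> \<le> a" "\<And>S. r \<le> S \<Longrightarrow> 2 + t * \<zeta> * S + 2 * t * b \<le> a * (2 + t * S)"
    and \<phi> [measurable]: "\<phi> \<in> borel_measurable M" and c: "0 \<le> c"
    and osc: "\<And>x y. x \<in> space M \<Longrightarrow> y \<in> space M \<Longrightarrow> \<bar>\<phi> x - \<phi> y\<bar> \<le> c * (2 + t * V x + t * V y)"
    and xy: "x \<in> space M" "y \<in> space M"
  shows "\<bar>(\<integral>z. \<phi> z \<partial>Q x) - (\<integral>z. \<phi> z \<partial>Q y)\<bar> \<le> a * c * (2 + t * V x + t * V y)"
proof -
  define H where "H = (\<lambda>z. c * (1 + t * V z))"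
  have H0: "0 \<le> H z" for z using c t V0 by (simp add: H_def)
  have bdd: "bdd_above ((\<lambda>z. \<phi> z - H z) ` space M)"
  proof (rule bdd_aboveI2)
    fix z assume "z \<in> space M"
    then show "\<phi> z - H z \<le> \<phi> x + H x" using osc[of z x] xy by (simp add: H_def algebra_simps abs_le_iff)
  qed
  \<comment> \<open>The oscillation bound says \<open>\<phi> w - H w \<le> \<phi> z + H z\<close>
    for all \<open>w\<close> and \<open>z\<close>, so the supremum of the left sides lies within
    \<open>H z\<close> of \<open>\<phi> z\<close> at every \<open>z\<close>.\<close>
  define s where "s = (SUP z\<in>space M. \<phi> z - H z)"
  have s: "\<bar>\<phi> z - s\<bar> \<le> H z" if z: "z \<in> space M" for z
  proof -
    have "\<phi> z - H z \<le> s" unfolding s_def by (rule cSUP_upper[OF z bdd])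
    moreover have "s \<le> \<phi> z + H z" unfolding s_def
    proof (rule cSUP_least)
      show "space M \<noteq> {}" using z by auto
      fix w assume "w \<in> space M"
      then show "\<phi> w - H w \<le> \<phi> z + H z" using osc[of w z] z by (simp add: H_def algebra_simps abs_le_iff)
    qed
    ultimately show ?thesis by linarith
  qed
  define \<psi> where "\<psi> = (\<lambda>z. \<phi> z - s)"
  have [measurable]: "\<psi> \<in> borel_measurable M" "H \<in> borel_measurable M"
    by (simp_all add: \<psi>_def H_def)
  have \<psi>H: "\<bar>\<psi> z\<bar> \<le> H z" if "z \<in> space M" for z using s[OF that] by (simp add: \<psi>_def)
  have Qx: "prob_space (Q u)" "sets (Q u) = sets M" "space (Q u) = space M" if "u \<in> space M" for u
    using kernel_prob_space[OF Q that] by (auto dest: sets_eq_imp_space_eq)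
  have IV: "integrable (Q u) V" "(\<integral>z. V z \<partial>Q u) \<le> \<zeta> * V u + b" if u: "u \<in> space M" for u
  proof -
    have "V \<in> borel_measurable (Q u)" using V Qx(2)[OF u] by (simp cong: measurable_cong_sets)
    from integral_le_of_nn_integral_le[OF this V0 drift[OF u]]
    show "integrable (Q u) V" "(\<integral>z. V z \<partial>Q u) \<le> \<zeta> * V u + b"
      using \<zeta> b V0[of u] by auto
  qed
  have IH: "integrable (Q u) H" "(\<integral>z. H z \<partial>Q u) \<le> c * (1 + t * (\<zeta> * V u + b))" if u: "u \<in> space M" for u
  proof -
    interpret prob_space "Q u" by (rule Qx[OF u])
    show "integrable (Q u) H" unfolding H_def using IV[OF u] by auto
    have "(\<integral>z. H z \<partial>Q u) = c * (1 + t * (\<integral>z. V z \<partial>Q u))"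
      unfolding H_def using IV[OF u] by (simp add: prob_space)
    then show "(\<integral>z. H z \<partial>Q u) \<le> c * (1 + t * (\<zeta> * V u + b))"
      using IV(2)[OF u] c t by (simp add: mult_left_mono)
  qed
  have I\<psi>: "integrable (Q u) \<psi>" if u: "u \<in> space M" for u
    by (rule Bochner_Integration.integrable_bound[OF IH(1)[OF u]])
      (use Qx[OF u] \<psi>H in \<open>auto intro!: AE_I2 order_trans[OF _ abs_ge_self] cong: measurable_cong_sets\<close>)
  have \<psi>_eq: "(\<integral>z. \<psi> z \<partial>Q u) = (\<integral>z. \<phi> z \<partial>Q u) - s" if u: "u \<in> space M" for u
  proof -
    interpret prob_space "Q u" by (rule Qx[OF u])
    have "integrable (Q u) (\<lambda>z. \<psi> z + s)" using I\<psi>[OF u] by auto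
    then have "integrable (Q u) \<phi>" by (simp add: \<psi>_def)
    then show ?thesis by (simp add: \<psi>_def prob_space)
  qed
  have main: "(\<integral>z. \<psi> z \<partial>Q u) - (\<integral>z. \<psi> z \<partial>Q v) \<le> a * c * (2 + t * V u + t * V v)"
    if u: "u \<in> space M" and v: "v \<in> space M" for u v
  proof -
    define S where "S = V u + V v"
    have S0: "0 \<le> S" using V0 by (simp add: S_def)
    have HH: "(\<integral>z. H z \<partial>Q u) + (\<integral>z. H z \<partial>Q v) \<le> c * (2 + t * \<zeta> * S + 2 * t * b)"
      using IH(2)[OF u] IH(2)[OF v] by (simp add: S_def algebra_simps)
    \<comment> \<open>If \<open>V u + V v\<close> is large, the drift alone contracts. If it is
      small, both points lie in the sublevel set where the minorization applies.\<close>
    show ?thesis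
    proof (cases "r \<le> S")
      case True
      have "(\<integral>z. \<psi> z \<partial>Q u) \<le> (\<integral>z. H z \<partial>Q u)"
        using Qx[OF u] \<psi>H by (intro integral_mono I\<psi> IH u) (auto simp: abs_le_iff)
      moreover have "(\<integral>z. - \<psi> z \<partial>Q v) \<le> (\<integral>z. H z \<partial>Q v)"
        using Qx[OF v] \<psi>H I\<psi>[OF v] by (intro integral_mono IH v) (auto simp: abs_le_iff)
      ultimately have "(\<integral>z. \<psi> z \<partial>Q u) - (\<integral>z. \<psi> z \<partial>Q v) \<le> c * (2 + t * \<zeta> * S + 2 * t * b)"
        using HH by simp
      also have "\<dots> \<le> c * (a * (2 + t * S))"
        using a(3)[OF True] c by (rule mult_left_mono)
      finally show ?thesis by (simp add: S_def algebra_simps)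
    next
      case False
      then have r: "V u \<le> r" "V v \<le> r" using V0[of u] V0[of v] by (auto simp: S_def)
      interpret \<nu>: prob_space \<nu> by (rule \<nu>)
      have sp\<nu>: "space \<nu> = space M" using \<nu>(2) by (rule sets_eq_imp_space_eq)
      have minor': "integrable \<nu> h \<and> \<epsilon> * (\<integral>z. h z \<partial>\<nu>) \<le> (\<integral>z. h z \<partial>Q w)"
        if w: "w \<in> space M" "V w \<le> r" and h [measurable]: "h \<in> borel_measurable M"
          and h0: "\<And>z. z \<in> space M \<Longrightarrow> 0 \<le> h z" and ih: "integrable (Q w) h" for h w
      proof -
        have "ennreal \<epsilon> * (\<integral>\<^sup>+z. ennreal (h z) \<partial>\<nu>) \<le> (\<integral>\<^sup>+z. ennreal (h z) \<partial>Q w)"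
          by (rule minor[OF w]) simp
        also have "\<dots> = ennreal (\<integral>z. h z \<partial>Q w)"
          using h0 Qx[OF w(1)] ih by (intro nn_integral_eq_integral) auto
        finally have le: "ennreal \<epsilon> * (\<integral>\<^sup>+z. ennreal (h z) \<partial>\<nu>) \<le> ennreal (\<integral>z. h z \<partial>Q w)" .
        \<comment> \<open>Integrability under \<nu> is extracted from the minorization: an infinite
          left side would exceed the finite integral under \<open>Q w\<close>.\<close>
        have "(\<integral>\<^sup>+z. ennreal (h z) \<partial>\<nu>) < \<infinity>"
        proof (rule ccontr)
          assume "\<not> (\<integral>\<^sup>+z. ennreal (h z) \<partial>\<nu>) < \<infinity>"
          then have "(\<integral>\<^sup>+z. ennreal (h z) \<partial>\<nu>) = \<infinity>" by (simp add: less_top[symmetric])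
          then show False using le \<epsilon> by (simp add: ennreal_mult_top top_unique)
        qed
        then have i: "integrable \<nu> h"
          using h0 sp\<nu> \<nu>(2) by (intro integrableI_nonneg) (auto cong: measurable_cong_sets)
        have "(\<integral>\<^sup>+z. ennreal (h z) \<partial>\<nu>) = ennreal (\<integral>z. h z \<partial>\<nu>)"
          using i h0 sp\<nu> by (intro nn_integral_eq_integral) auto
        then have "ennreal (\<epsilon> * (\<integral>z. h z \<partial>\<nu>)) \<le> ennreal (\<integral>z. h z \<partial>Q w)"
          using le \<epsilon> by (simp add: ennreal_mult')
        moreover have "0 \<le> (\<integral>z. h z \<partial>Q w)"
          using h0 Qx(3)[OF w(1)] by (intro Bochner_Integration.integral_nonneg) auto
        ultimately show ?thesis using i by simp
      qed
      have 1: "integrable \<nu> (\<lambda>z. H z - \<psi> z) \<and> \<epsilon> * (\<integral>z. H z - \<psi> z \<partial>\<nu>) \<le> (\<integral>z. H z - \<psi> z \<partial>Q u)"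
        using \<psi>H IH(1)[OF u] I\<psi>[OF u] by (intro minor' u r) (auto simp: abs_le_iff)
      have 2: "integrable \<nu> (\<lambda>z. H z + \<psi> z) \<and> \<epsilon> * (\<integral>z. H z + \<psi> z \<partial>\<nu>) \<le> (\<integral>z. H z + \<psi> z \<partial>Q v)"
        using IH(1)[OF v] I\<psi>[OF v] by (intro minor' v r) (auto dest!: \<psi>H simp: abs_le_iff)
      \<comment> \<open>\<open>H\<close> and \<psi> are the half sum and the half difference of the
        two functions just shown to be integrable.\<close>
      have "integrable \<nu> (\<lambda>z. ((H z - \<psi> z) + (H z + \<psi> z)) / 2)"
        by (rule integrable_divide_zero[OF Bochner_Integration.integrable_add]) (use 1 2 in auto)
      also have "(\<lambda>z. ((H z - \<psi> z) + (H z + \<psi> z)) / 2) = H" by auto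
      finally have i\<nu>: "integrable \<nu> H" .
      have "integrable \<nu> (\<lambda>z. ((H z + \<psi> z) - (H z - \<psi> z)) / 2)"
        by (rule integrable_divide_zero[OF Bochner_Integration.integrable_diff]) (use 1 2 in auto)
      also have "(\<lambda>z. ((H z + \<psi> z) - (H z - \<psi> z)) / 2) = \<psi>" by auto
      finally have i\<nu>\<psi>: "integrable \<nu> \<psi>" .
      have "c = (\<integral>z. c \<partial>\<nu>)" by (simp add: \<nu>.prob_space)
      also have "\<dots> \<le> (\<integral>z. H z \<partial>\<nu>)"
        using i\<nu> c t V0 by (intro integral_mono) (auto simp: H_def intro!: mult_left_mono[of 1 _ c, simplified])
      finally have cH: "\<epsilon> * c \<le> \<epsilon> * (\<integral>z. H z \<partial>\<nu>)" using \<epsilon> by simp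
      \<comment> \<open>Adding the two minorization bounds cancels the integrals of \<psi> under
        \<nu> and leaves a gain of twice \<epsilon> times the integral of \<open>H\<close>, at least
        \<open>2 * \<epsilon> * c\<close>. Half of this gain pays for the drift constant
        \<open>2 * t * b\<close>, the other half gives the factor
        \<open>1 - \<epsilon> / 2\<close>.\<close>
      have "(\<integral>z. \<psi> z \<partial>Q u) - (\<integral>z. \<psi> z \<partial>Q v)
          \<le> (\<integral>z. H z \<partial>Q u) + (\<integral>z. H z \<partial>Q v) - 2 * (\<epsilon> * (\<integral>z. H z \<partial>\<nu>))"
        using 1 2 i\<nu> i\<nu>\<psi> IH(1)[OF u] IH(1)[OF v] I\<psi>[OF u] I\<psi>[OF v]
        by (simp add: algebra_simps)
      also have "\<dots> \<le> c * (2 + t * \<zeta> * S + 2 * t * b) - 2 * (\<epsilon> * c)"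
        using HH cH by linarith
      also have "\<dots> \<le> c * (2 + t * \<zeta> * S + \<epsilon>) - 2 * (\<epsilon> * c)"
        using t(2) c by (simp add: mult_left_mono)
      also have "\<dots> = c * (2 * (1 - \<epsilon> / 2) + \<zeta> * (t * S))" by (simp add: algebra_simps)
      also have "\<dots> \<le> c * (2 * a + a * (t * S))"
        using a S0 t c by (intro mult_left_mono add_mono mult_right_mono) auto
      finally show ?thesis by (simp add: S_def algebra_simps)
    qed
  qed
  show ?thesis
    using main[OF xy] main[OF xy(2,1)] \<psi>_eq[OF xy(1)] \<psi>_eq[OF xy(2)] by (simp add: abs_le_iff algebra_simps)
qed

lemma bind_kiter_invariant:
  assumes K: "K \<in> M \<rightarrow>\<^sub>M prob_algebra M" and P: "sets P = sets M" "P \<bind> K = P"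
  shows "P \<bind> kiter M K k = P"
proof (induction k)
  case 0
  then show ?case using bind_return''[OF P(1)] by (simp add: kiter_def[abs_def] eta_contract_eq)
next
  case (Suc k)
  have "kiter M K k \<in> P \<rightarrow>\<^sub>M subprob_algebra M"
    using measurable_prob_algebraD[OF measurable_kiter[OF K]] P(1) by (simp cong: measurable_cong_sets)
  from bind_assoc[OF this measurable_prob_algebraD[OF K]] Suc P(2)
  show ?case by (simp add: kiter_Suc[abs_def])
qed

text \<open>\<open>harris_contraction\<close> is iterated for the \<open>k0\<close>-step kernel.
  Since \<open>\<delta> * k0 \<ge> 1\<close>, the drift factor \<open>(1 - \<delta>) ^ k0\<close> is
  at most exp(-1), so \<open>t\<close>, \<open>a\<close>, \<open>b\<close>,
  \<open>\<epsilon>\<close> and the final constant can be chosen independently of \<delta>.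
  Averaging the oscillation bound over an invariant \<open>P\<close> turns contraction into
  convergence.\<close>

theorem harris_convergence:
  fixes V f :: "'a \<Rightarrow> real"
  assumes K: "K \<in> M \<rightarrow>\<^sub>M prob_algebra M" and V [measurable]: "V \<in> borel_measurable M"
    and V1: "\<And>x. 1 \<le> V x" and \<delta>: "0 < \<delta>" "\<delta> \<le> 1" and b: "0 \<le> b"
    and drift: "\<And>x. x \<in> space M \<Longrightarrow> (\<integral>\<^sup>+y. ennreal (V y) \<partial>K x) \<le> ennreal ((1 - \<delta>) * V x + b * \<delta>)"
    and k0: "1 \<le> \<delta> * real k0" "\<delta> * real k0 \<le> 2"
    and \<nu>: "prob_space \<nu>" "sets \<nu> = sets M" and \<epsilon>: "0 < \<epsilon>"
    and minor: "\<And>x h. x \<in> space M \<Longrightarrow> V x \<le> r \<Longrightarrow> h \<in> borel_measurable M \<Longrightarrow>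
      ennreal \<epsilon> * (\<integral>\<^sup>+y. h y \<partial>\<nu>) \<le> (\<integral>\<^sup>+y. h y \<partial>kiter M K k0 x)"
    and t: "0 < t" "2 * t * b \<le> \<epsilon>"
    and a: "0 < a" "a < 1" "1 - \<epsilon> / 2 \<le> a" "exp (- 1) \<le> a"
      "\<And>S. r \<le> S \<Longrightarrow> 2 + t * exp (- 1) * S + 2 * t * b \<le> a * (2 + t * S)"
    and P: "prob_space P" "sets P = sets M" "P \<bind> K = P"
    and PV: "(\<integral>\<^sup>+x. ennreal (V x) \<partial>P) < \<infinity>"
    and f [measurable]: "f \<in> borel_measurable M" and fV: "\<And>x. x \<in> space M \<Longrightarrow> \<bar>f x\<bar> \<le> V x"
    and x: "x \<in> space M"
  shows "\<bar>(\<integral>y. f y \<partial>kiter M K k x) - (\<integral>y. f y \<partial>P)\<bar>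
    \<le> (1 + b) * (2 / t + 1) / a * (sqrt a powr (\<delta> * real k)) * (V x + (\<integral>y. V y \<partial>P))"
proof -
  interpret P: prob_space P by (rule P)
  have spP: "space P = space M" using P(2) by (rule sets_eq_imp_space_eq)
  have V0: "0 \<le> V x" for x using V1[of x] by linarith
  \<comment> \<open>The argument is dual: the kernel acts on functions, and the oscillation of
    \<open>G j\<close> relative to the weight \<open>2 + t V x + t V y\<close> is
    contracted.\<close>
  define G where "G = (\<lambda>j x. \<integral>y. f y \<partial>kiter M K j x)"
  \<comment> \<open>With this \<open>c\<close> the uniform bound
    \<open>\<bar>G j x\<bar> \<le> (1 + b) V x\<close> becomes an oscillation bound in terms of the
    small weight \<open>t V\<close>.\<close>
  define c where "c = (1 + b) / t"
  have c0: "0 \<le> c" using b t by (simp add: c_def)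
  note psk = kernel_prob_space[OF measurable_kiter[OF K]]
  have dk: "(\<integral>\<^sup>+y. ennreal (V y) \<partial>kiter M K j x) \<le> ennreal ((1 - \<delta>) ^ j * V x + b)" if "x \<in> space M" for j x
    using nn_integral_kiter_drift[OF K V V0 \<delta> b drift that] .
  have pd1: "(1 - \<delta>) ^ j \<le> 1" for j using \<delta> by (simp add: power_le_one)
  have fin: "(\<integral>\<^sup>+y. ennreal (V y) \<partial>kiter M K j x) < \<infinity>" if "x \<in> space M" for j x
    using dk[OF that, of j] by (simp add: le_less_trans)
  have Gm [measurable]: "G j \<in> borel_measurable M" for j
    using measurable_compose[OF measurable_prob_algebraD[OF measurable_kiter[OF K]]
        integral_measurable_subprob_algebra[OF f]] by (simp add: G_def)
  have Gb: "\<bar>G j x\<bar> \<le> (1 + b) * V x" if x: "x \<in> space M" for j x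
  proof -
    have sk: "sets (kiter M K j x) = sets M" using psk(2)[OF x] .
    note spk = sets_eq_imp_space_eq[OF sk]
    have m: "V \<in> borel_measurable (kiter M K j x)" "f \<in> borel_measurable (kiter M K j x)"
      using sk by (auto cong: measurable_cong_sets)
    have 0: "0 \<le> (1 - \<delta>) ^ j * V x + b" using \<delta> V0 b by simp
    note iV = integral_le_of_nn_integral_le[OF m(1) V0 dk[OF x] 0]
    have "integrable (kiter M K j x) f"
      by (rule Bochner_Integration.integrable_bound[OF iV(1) m(2)]) (use spk fV in \<open>auto intro!: AE_I2 order_trans[OF _ abs_ge_self]\<close>)
    then have "\<bar>G j x\<bar> \<le> (\<integral>y. V y \<partial>kiter M K j x)"
      unfolding G_def using iV(1) spk fV by (intro order_trans[OF integral_abs_bound] integral_mono) auto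
    also have "\<dots> \<le> (1 - \<delta>) ^ j * V x + b" by (rule iV(2))
    also have "\<dots> \<le> 1 * V x + b * V x"
      using pd1 V1[of x] b mult_left_mono[of 1 "V x" b] by (intro add_mono mult_right_mono) auto
    finally show ?thesis by (simp add: algebra_simps)
  qed
  have step: "G (m + j) x = (\<integral>y. G j y \<partial>kiter M K m x)" if x: "x \<in> space M" for m j x
  proof -
    have "(\<integral>\<^sup>+y. ennreal (V y) \<partial>(kiter M K m x \<bind> kiter M K j)) < \<infinity>"
      using fin[OF x, of "m + j"] kiter_add[OF K x] by simp
    from integral_bind_kernel(2)[OF psk(2)[OF x] measurable_kiter[OF K] f V fV fin this]
    show ?thesis using kiter_add[OF K x, of m j] by (simp add: G_def)
  qed
  have drift0: "(\<integral>\<^sup>+y. ennreal (V y) \<partial>kiter M K k0 x) \<le> ennreal (exp (- 1) * V x + b)" if x: "x \<in> space M" for x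
  proof -
    have "(1 - \<delta>) ^ k0 \<le> exp (- \<delta>) ^ k0"
      using exp_ge_add_one_self[of "- \<delta>"] \<delta> by (intro power_mono) auto
    also have "\<dots> = exp (- (\<delta> * real k0))" by (simp flip: exp_of_nat_mult add: mult.commute)
    also have "\<dots> \<le> exp (- 1)" using k0 by simp
    finally have "(1 - \<delta>) ^ k0 * V x + b \<le> exp (- 1) * V x + b" using V0[of x] by (simp add: mult_right_mono)
    then show ?thesis using dk[OF x, of k0] by (meson ennreal_leI order_trans)
  qed
  \<comment> \<open>The remainder \<open>j\<close> may be arbitrary because \<open>Gb\<close> bounds
    all \<open>G j\<close> by the same constant; it absorbs the steps left over by division by
    \<open>k0\<close>.\<close>
  have osc: "\<bar>G (n * k0 + j) x - G (n * k0 + j) y\<bar> \<le> a ^ n * c * (2 + t * V x + t * V y)"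
    if "x \<in> space M" "y \<in> space M" for n j x y
    using that
  proof (induction n arbitrary: x y)
    case 0
    have "\<bar>G j x - G j y\<bar> \<le> (1 + b) * V x + (1 + b) * V y"
      using Gb[OF 0(1), of j] Gb[OF 0(2), of j] by linarith
    also have "\<dots> = c * (t * V x + t * V y)" using t by (simp add: c_def field_simps)
    also have "\<dots> \<le> c * (2 + t * V x + t * V y)" using c0 by (intro mult_left_mono) auto
    finally show ?case by simp
  next
    case (Suc n)
    have "0 \<le> a ^ n * c" using a c0 by simp
    then have "\<bar>(\<integral>z. G (n * k0 + j) z \<partial>kiter M K k0 x) - (\<integral>z. G (n * k0 + j) z \<partial>kiter M K k0 y)\<bar>
        \<le> a * (a ^ n * c) * (2 + t * V x + t * V y)"
      by (intro harris_contraction[where Q="kiter M K k0" and V=V and \<phi>="G (n * k0 + j)" and \<zeta>="exp (- 1)"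
            and b=b and \<epsilon>=\<epsilon> and \<nu>=\<nu> and r=r, OF measurable_kiter[OF K] V V0 drift0 _ b \<nu> \<epsilon> minor t a(3,4,5) Gm])
        (use Suc in auto)
    then show ?case
      using step[OF Suc.prems(1), of k0 "n * k0 + j"] step[OF Suc.prems(2), of k0 "n * k0 + j"]
      by (simp add: algebra_simps)
  qed
  have k0pos: "0 < k0" using k0 by (cases k0) auto
  define n where "n = k div k0"
  have osc_k: "\<bar>G k x - G k y\<bar> \<le> a ^ n * c * (2 + t * V x + t * V y)" if "y \<in> space M" for y
    using osc[OF x that, of n "k mod k0"] by (simp add: n_def)
  have PVm: "V \<in> borel_measurable P" using V P(2) by (simp cong: measurable_cong_sets)
  have iPV: "integrable P V"
    using PV V0 PVm by (intro integrableI_nonneg) auto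
  have Pinv: "P \<bind> kiter M K k = P" by (rule bind_kiter_invariant[OF K P(2,3)])
  have PG: "integrable P (G k)" "(\<integral>y. f y \<partial>P) = (\<integral>y. G k y \<partial>P)"
  proof -
    have "(\<integral>\<^sup>+y. ennreal (V y) \<partial>(P \<bind> kiter M K k)) < \<infinity>" using PV Pinv by simp
    from integral_bind_kernel[OF P(2) measurable_kiter[OF K] f V fV fin this] Pinv
    show "integrable P (G k)" "(\<integral>y. f y \<partial>P) = (\<integral>y. G k y \<partial>P)" by (simp_all add: G_def)
  qed
  have "G k x - (\<integral>y. f y \<partial>P) = (\<integral>y. G k x - G k y \<partial>P)"
    using PG by (simp add: P.prob_space)
  also have "\<bar>\<dots>\<bar> \<le> (\<integral>y. a ^ n * c * (2 + t * V x + t * V y) \<partial>P)"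
    using PG(1) iPV osc_k spP
    by (intro order_trans[OF integral_abs_bound] integral_mono) auto
  also have "\<dots> = a ^ n * c * (2 + t * V x + t * (\<integral>y. V y \<partial>P))"
    using iPV by (simp add: P.prob_space)
  also have "\<dots> \<le> (sqrt a powr (\<delta> * real k) / a) * c * ((2 + t) * (V x + (\<integral>y. V y \<partial>P)))"
  proof (intro mult_mono)
    \<comment> \<open>Since \<open>k \<le> (n + 1) * k0\<close> and
      \<open>\<delta> * k0 \<le> 2\<close>, the number \<open>n\<close> of full blocks is at least
      \<open>\<delta> k / 2 - 1\<close>. The half turns \<open>a\<close> into \<open>sqrt a\<close>,
      and the lost block costs the factor \<open>1 / a\<close>.\<close>
    have "real k \<le> (real n + 1) * real k0"
    proof -
      have "k \<le> (n + 1) * k0"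
        using dividend_less_times_div[OF k0pos, of k] by (simp add: n_def algebra_simps)
      then show ?thesis by (metis of_nat_mono of_nat_mult of_nat_add of_nat_1)
    qed
    then have "\<delta> * real k \<le> (real n + 1) * (\<delta> * real k0)"
      using \<delta> by (metis mult.commute mult.left_commute mult_left_mono less_imp_le)
    also have "\<dots> \<le> (real n + 1) * 2" using k0 by (intro mult_left_mono) auto
    finally have le: "\<delta> * real k / 2 - 1 \<le> real n" by simp
    have "a ^ n = a powr real n" using a by (simp add: powr_realpow)
    also have "\<dots> \<le> a powr (\<delta> * real k / 2 - 1)"
      using a le by (intro powr_mono') auto
    also have "\<dots> = sqrt a powr (\<delta> * real k) / a"
      using a by (simp add: powr_diff powr_half_sqrt[symmetric] powr_powr)
    finally show "a ^ n \<le> sqrt a powr (\<delta> * real k) / a" .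
    have "0 \<le> (\<integral>y. V y \<partial>P)" using V0 by simp
    then show "2 + t * V x + t * (\<integral>y. V y \<partial>P) \<le> (2 + t) * (V x + (\<integral>y. V y \<partial>P))"
      using V1[of x] by (simp add: algebra_simps)
    show "0 \<le> 2 + t * V x + t * (\<integral>y. V y \<partial>P)" using V0 t by simp
  qed (use a c0 in auto)
  also have "\<dots> = (1 + b) * (2 / t + 1) / a * (sqrt a powr (\<delta> * real k)) * (V x + (\<integral>y. V y \<partial>P))"
    using t a by (simp add: c_def field_simps)
  finally show ?thesis by (simp add: G_def)
qed

section \<open>Isotropic Gaussian densities\<close>

definition gauss :: "real \<Rightarrow> 'a::euclidean_space \<Rightarrow> 'a \<Rightarrow> real" where
  "gauss v m y = (2 * pi * v) powr (- real DIM('a) / 2) * exp (- (norm (y - m))\<^sup>2 / (2 * v))"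

lemma gauss_nonneg [simp]: "0 \<le> gauss v m y"
  by (simp add: gauss_def)

lemma measurable_gauss [measurable]: "gauss v m \<in> borel_measurable borel"
  unfolding gauss_def by measurable

text \<open>The integrand is a product over the coordinates, which reduces the claim to the
  one-dimensional normal density.\<close>

lemma nn_integral_exp_norm_square:
  fixes m :: "'a::euclidean_space"
  assumes v: "0 < v"
  shows "(\<integral>\<^sup>+y. ennreal (exp (- (norm (y - m))\<^sup>2 / (2 * v))) \<partial>lborel)
    = ennreal ((2 * pi * v) powr (real DIM('a) / 2))"
proof -
  have sq: "(norm z)\<^sup>2 = (\<Sum>b\<in>Basis. (z \<bullet> b)\<^sup>2)" for z :: 'a
    unfolding power2_norm_eq_inner by (subst euclidean_inner) (simp add: power2_eq_square)
  have e: "exp (- (norm (y - m))\<^sup>2 / (2 * v)) = (\<Prod>b\<in>Basis. exp (- (y \<bullet> b - m \<bullet> b)\<^sup>2 / (2 * v)))" for y :: 'a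
    by (simp add: sq exp_sum[symmetric] inner_diff_left sum_divide_distrib sum_negf)
  have one: "(\<integral>\<^sup>+y. ennreal (exp (- (y - \<mu>)\<^sup>2 / (2 * v))) \<partial>lborel) = ennreal (sqrt (2 * pi * v))" for \<mu> :: real
  proof -
    have "(\<integral>\<^sup>+y. ennreal (normal_density \<mu> (sqrt v) y) \<partial>lborel) = 1"
      using v by (subst nn_integral_eq_integral) auto
    moreover have "ennreal (exp (- (y - \<mu>)\<^sup>2 / (2 * v)))
        = ennreal (sqrt (2 * pi * v)) * ennreal (normal_density \<mu> (sqrt v) y)" for y
      using v by (simp add: normal_density_def flip: ennreal_mult)
    ultimately show ?thesis by (simp add: nn_integral_cmult)
  qed
  have "(\<integral>\<^sup>+y. ennreal (exp (- (norm (y - m))\<^sup>2 / (2 * v))) \<partial>lborel)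
      = (\<integral>\<^sup>+y. (\<Prod>b\<in>Basis. ennreal (exp (- (y \<bullet> b - m \<bullet> b)\<^sup>2 / (2 * v)))) \<partial>lborel)"
    by (simp only: e) (simp add: prod_ennreal)
  also have "\<dots> = (\<Prod>b\<in>(Basis :: 'a set). \<integral>\<^sup>+y. ennreal (exp (- (y - m \<bullet> b)\<^sup>2 / (2 * v))) \<partial>lborel)"
    by (rule nn_integral_lborel_prod[where f="\<lambda>b y. ennreal (exp (- (y - m \<bullet> b)\<^sup>2 / (2 * v)))"]) auto
  also have "\<dots> = ennreal (sqrt (2 * pi * v) ^ DIM('a))"
    unfolding one using v by (simp add: ennreal_power)
  also have "sqrt (2 * pi * v) ^ DIM('a) = (2 * pi * v) powr (real DIM('a) / 2)"
    using v by (simp add: powr_half_sqrt[symmetric] powr_powr flip: powr_realpow)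
  finally show ?thesis .
qed

lemma nn_integral_gauss:
  assumes "0 < v"
  shows "(\<integral>\<^sup>+y. ennreal (gauss v (m::'a::euclidean_space) y) \<partial>lborel) = 1"
proof -
  have "(\<integral>\<^sup>+y. ennreal (gauss v m y) \<partial>lborel)
      = ennreal ((2 * pi * v) powr (- real DIM('a) / 2)) * (\<integral>\<^sup>+y. ennreal (exp (- (norm (y - m))\<^sup>2 / (2 * v))) \<partial>lborel)"
    unfolding gauss_def by (subst ennreal_mult, simp, simp, subst nn_integral_cmult) auto
  also have "\<dots> = ennreal ((2 * pi * v) powr (- real DIM('a) / 2) * (2 * pi * v) powr (real DIM('a) / 2))"
    by (simp only: nn_integral_exp_norm_square[OF assms] ennreal_mult' powr_ge_zero)
  also have "\<dots> = 1"
    using assms by (simp only: powr_add[symmetric]) simp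
  finally show ?thesis .
qed

text \<open>Completing the square, with \<open>\<sigma> = s + a\<^sup>2 t\<close>.\<close>
lemma gauss_mult:
  fixes m w y :: "'a::euclidean_space"
    and a :: real
  assumes t: "0 < t" and s: "0 < s"
  defines "\<sigma> \<equiv> a\<^sup>2 * t + s"
  shows "gauss t m w * gauss s (a *\<^sub>R w) y
    = gauss \<sigma> (a *\<^sub>R m) y * gauss (t * s / \<sigma>) (m + (a * t / \<sigma>) *\<^sub>R (y - a *\<^sub>R m)) w"
proof -
  have \<sigma>: "0 < \<sigma>" using t s by (simp add: \<sigma>_def add_nonneg_pos)
  define p q where "p = w - m" and "q = y - a *\<^sub>R m"
  have *: "(norm p)\<^sup>2 / (2 * t) + (norm (q - a *\<^sub>R p))\<^sup>2 / (2 * s)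
      = (norm q)\<^sup>2 / (2 * \<sigma>) + (norm (p - (a * t / \<sigma>) *\<^sub>R q))\<^sup>2 / (2 * (t * s / \<sigma>))"
  proof -
    have 1: "(norm (q - a *\<^sub>R p))\<^sup>2 = q \<bullet> q - 2 * a * (p \<bullet> q) + a\<^sup>2 * (p \<bullet> p)"
      "(norm (p - (a * t / \<sigma>) *\<^sub>R q))\<^sup>2 = p \<bullet> p - 2 * (a * t / \<sigma>) * (p \<bullet> q) + (a * t / \<sigma>)\<^sup>2 * (q \<bullet> q)"
      unfolding power2_norm_eq_inner
      by (simp_all add: inner_diff inner_commute algebra_simps power2_eq_square)
    have "P / (2 * t) + (Q - 2 * a * R + a\<^sup>2 * P) / (2 * s)
      = Q / (2 * \<sigma>) + (P - 2 * (a * t / \<sigma>) * R + (a * t / \<sigma>)\<^sup>2 * Q) / (2 * (t * s / \<sigma>))" for P Q R :: real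
    proof -
      have "P / (2 * t) + a\<^sup>2 * P / (2 * s) = P / (2 * (t * s / \<sigma>))"
        using t s \<sigma> by (simp add: field_simps) (simp add: \<sigma>_def algebra_simps)
      moreover have "2 * a * R / (2 * s) = 2 * (a * t / \<sigma>) * R / (2 * (t * s / \<sigma>))"
        using t s \<sigma> by (simp add: field_simps)
      moreover have "Q / (2 * s) = Q / (2 * \<sigma>) + (a * t / \<sigma>)\<^sup>2 * Q / (2 * (t * s / \<sigma>))"
        using t s \<sigma> by (simp add: field_simps power2_eq_square) (simp add: \<sigma>_def algebra_simps power2_eq_square)
      ultimately show ?thesis by (simp only: add_divide_distrib diff_divide_distrib)
    qed
    then show ?thesis unfolding 1 power2_norm_eq_inner[of p] power2_norm_eq_inner[of q] by blast
  qed
  have "(2 * pi * t) powr (- real DIM('a) / 2) * (2 * pi * s) powr (- real DIM('a) / 2)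
      = ((2 * pi * t) * (2 * pi * s)) powr (- real DIM('a) / 2)"
    by (rule powr_mult[symmetric])
  also have "(2 * pi * t) * (2 * pi * s) = (2 * pi * \<sigma>) * (2 * pi * (t * s / \<sigma>))"
    using \<sigma> by simp
  also have "\<dots> powr (- real DIM('a) / 2)
      = (2 * pi * \<sigma>) powr (- real DIM('a) / 2) * (2 * pi * (t * s / \<sigma>)) powr (- real DIM('a) / 2)"
    by (rule powr_mult)
  finally have c: "(2 * pi * t) powr (- real DIM('a) / 2) * (2 * pi * s) powr (- real DIM('a) / 2) = \<dots>" .
  have w: "w - (m + (a * t / \<sigma>) *\<^sub>R q) = p - (a * t / \<sigma>) *\<^sub>R q"
    "y - a *\<^sub>R w = q - a *\<^sub>R p" "w - m = p" "y - a *\<^sub>R m = q"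
    by (simp_all add: p_def q_def algebra_simps)
  have e: "exp (- (norm p)\<^sup>2 / (2 * t)) * exp (- (norm (q - a *\<^sub>R p))\<^sup>2 / (2 * s))
     = exp (- (norm q)\<^sup>2 / (2 * \<sigma>)) * exp (- (norm (p - (a * t / \<sigma>) *\<^sub>R q))\<^sup>2 / (2 * (t * s / \<sigma>)))"
    unfolding exp_add[symmetric] using * by simp
  have r: "A * E * (B * F) = A' * E' * (B' * F')" if "A * B = A' * B'" "E * F = E' * F'"
    for A B A' B' E F E' F' :: real
  proof -
    have "A * E * (B * F) = (A * B) * (E * F)" by (simp only: mult_ac)
    also have "\<dots> = A' * E' * (B' * F')" unfolding that by (simp only: mult_ac)
    finally show ?thesis .
  qed
  show ?thesis unfolding gauss_def w by (rule r[OF c e])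
qed

text \<open>Chapman-Kolmogorov for the autoregressive chain that maps \<open>w\<close> to
  \<open>a w\<close> plus noise of variance \<open>s\<close>: in the factorization of
  \<open>gauss_mult\<close> the first factor is free of \<open>w\<close> and the second integrates
  to 1.\<close>

lemma nn_integral_gauss_compose:
  fixes m y :: "'a::euclidean_space"
  assumes t: "0 < t" and s: "0 < s"
  shows "(\<integral>\<^sup>+w. ennreal (gauss t m w) * ennreal (gauss s (a *\<^sub>R w) y) \<partial>lborel)
    = ennreal (gauss (a\<^sup>2 * t + s) (a *\<^sub>R m) y)"
proof -
  have "0 < a\<^sup>2 * t + s" using t s by (simp add: add_nonneg_pos)
  then have p: "0 < t * s / (a\<^sup>2 * t + s)" using t s by simp
  show ?thesis
    by (subst ennreal_mult[symmetric], simp, simp)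
      (simp add: gauss_mult[OF t s] ennreal_mult nn_integral_cmult nn_integral_gauss[OF p])
qed

text \<open>The tilt changes the inverse variance to \<open>1 / v - 2 * \<tau>\<close>, that is the
  variance to \<open>u = v / (1 - 2 * v * \<tau>)\<close>, and shifts the mean by
  \<open>u *\<^sub>R l\<close>. It serves the drift of \<open>W\<close> with \<open>l\<close>
  nonzero and, with \<open>l = 0\<close>, a second moment bound.\<close>

lemma nn_integral_gauss_exp:
  fixes m l :: "'a::euclidean_space"
  assumes v: "0 < v" and \<tau>: "2 * v * \<tau> < 1"
  shows "(\<integral>\<^sup>+y. ennreal (gauss v m y * exp (l \<bullet> (y - m) + \<tau> * (norm (y - m))\<^sup>2)) \<partial>lborel)
    = ennreal ((1 - 2 * v * \<tau>) powr (- real DIM('a) / 2) * exp (v * (norm l)\<^sup>2 / (2 * (1 - 2 * v * \<tau>))))"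
proof -
  define D where "D = 1 - 2 * v * \<tau>"
  define u where "u = v / D"
  have D: "0 < D" and u: "0 < u" using v \<tau> by (simp_all add: D_def u_def)
  have *: "gauss v m y * exp (l \<bullet> (y - m) + \<tau> * (norm (y - m))\<^sup>2)
    = D powr (- real DIM('a) / 2) * exp (v * (norm l)\<^sup>2 / (2 * D)) * gauss u (m + u *\<^sub>R l) y" for y
  proof -
    define h where "h = y - m"
    have y: "y - (m + u *\<^sub>R l) = h - u *\<^sub>R l" by (simp add: h_def algebra_simps)
    have \<tau>': "\<tau> = 1 / (2 * v) - 1 / (2 * u)"
      using v D by (simp add: u_def D_def field_simps)
    have n: "(norm (h - u *\<^sub>R l))\<^sup>2 = (norm h)\<^sup>2 - 2 * u * (l \<bullet> h) + u\<^sup>2 * (norm l)\<^sup>2"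
      unfolding power2_norm_eq_inner
      by (simp add: inner_diff inner_commute algebra_simps power2_eq_square)
    have "- (norm h)\<^sup>2 / (2 * v) + (l \<bullet> h + \<tau> * (norm h)\<^sup>2) = u * (norm l)\<^sup>2 / 2 + - (norm (h - u *\<^sub>R l))\<^sup>2 / (2 * u)"
      unfolding n \<tau>' using u v by (simp add: field_simps power2_eq_square)
    then have e: "exp (- (norm h)\<^sup>2 / (2 * v)) * exp (l \<bullet> h + \<tau> * (norm h)\<^sup>2)
        = exp (v * (norm l)\<^sup>2 / (2 * D)) * exp (- (norm (h - u *\<^sub>R l))\<^sup>2 / (2 * u))"
      unfolding exp_add[symmetric] by (simp add: u_def)
    have "2 * pi * v = D * (2 * pi * u)" using D by (simp add: u_def)
    then have c: "(2 * pi * v) powr (- real DIM('a) / 2)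
        = D powr (- real DIM('a) / 2) * (2 * pi * u) powr (- real DIM('a) / 2)"
      using D u by (simp add: powr_mult)
    show ?thesis unfolding gauss_def y h_def[symmetric] c using e by (simp add: mult_ac)
  qed
  show ?thesis
    unfolding * D_def[symmetric]
    by (simp add: ennreal_mult nn_integral_cmult nn_integral_gauss[OF u])
qed

text \<open>The norm dominates the average of the absolute coordinates, so a product of two-sided
  exponentials with rate \<open>c / DIM('a)\<close> dominates the integrand.\<close>

lemma nn_integral_exp_neg_norm_finite:
  assumes c: "0 < c"
  shows "(\<integral>\<^sup>+x. ennreal (exp (- c * norm (x :: 'a::euclidean_space))) \<partial>lborel) < \<infinity>"
proof -
  define d where "d = c / real DIM('a)"
  have d: "0 < d" using c by (simp add: d_def)
  have "(\<integral>\<^sup>+t. ennreal (exp (- d * \<bar>t\<bar>)) \<partial>lborel)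
     \<le> (\<integral>\<^sup>+t. ennreal (1/d) * (ennreal (exponential_density d t) + ennreal (exponential_density d (- t))) \<partial>lborel)"
    using d by (intro nn_integral_mono) (auto simp: exponential_density_def ennreal_mult'[symmetric] abs_if mult.commute simp flip: ennreal_plus intro!: ennreal_leI)
  also have "\<dots> = ennreal (1/d) * ((\<integral>\<^sup>+t. ennreal (exponential_density d t) \<partial>lborel) + (\<integral>\<^sup>+t. ennreal (exponential_density d (- t)) \<partial>lborel))"
    by (subst nn_integral_cmult, simp, subst nn_integral_add) auto
  also have "(\<integral>\<^sup>+t. ennreal (exponential_density d (- t)) \<partial>lborel) = (\<integral>\<^sup>+t. ennreal (exponential_density d t) \<partial>lborel)"
    using nn_integral_real_affine[of "\<lambda>t. ennreal (exponential_density d t)" "-1" 0] by simp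
  also have "(\<integral>\<^sup>+t. ennreal (exponential_density d t) \<partial>lborel) = 1"
    using prob_space.emeasure_space_1[OF prob_space_exponential_density[OF d]]
    by (simp add: emeasure_density)
  finally have one: "(\<integral>\<^sup>+t. ennreal (exp (- d * \<bar>t\<bar>)) \<partial>lborel) < \<infinity>"
    by (rule le_less_trans) (simp add: ennreal_mult_less_top)
  have "(\<integral>\<^sup>+x. ennreal (exp (- c * norm (x :: 'a))) \<partial>lborel) \<le> (\<integral>\<^sup>+x. (\<Prod>b\<in>Basis. ennreal (exp (- d * \<bar>(x::'a) \<bullet> b\<bar>))) \<partial>lborel)"
  proof (rule nn_integral_mono)
    fix x :: 'a
    have "(\<Sum>b\<in>Basis. \<bar>x \<bullet> b\<bar>) \<le> (\<Sum>b\<in>(Basis::'a set). norm x)"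
      by (intro sum_mono Basis_le_norm)
    then have "d * (\<Sum>b\<in>Basis. \<bar>x \<bullet> b\<bar>) \<le> d * (real DIM('a) * norm x)"
      using d by (intro mult_left_mono) auto
    then have "- c * norm x \<le> (\<Sum>b\<in>Basis. - d * \<bar>x \<bullet> b\<bar>)"
      by (simp only: sum_distrib_left[symmetric]) (simp add: d_def)
    then have "exp (- c * norm x) \<le> (\<Prod>b\<in>Basis. exp (- d * \<bar>x \<bullet> b\<bar>))"
      by (simp add: exp_sum[symmetric])
    then show "ennreal (exp (- c * norm x)) \<le> (\<Prod>b\<in>Basis. ennreal (exp (- d * \<bar>x \<bullet> b\<bar>)))"
      by (simp add: prod_ennreal ennreal_leI)
  qed
  also have "\<dots> = (\<Prod>b\<in>(Basis::'a set). \<integral>\<^sup>+t. ennreal (exp (- d * \<bar>t\<bar>)) \<partial>lborel)"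
    by (rule nn_integral_lborel_prod[where f="\<lambda>b t. ennreal (exp (- d * \<bar>t\<bar>))"]) auto
  also have "\<dots> < \<infinity>" using one by (simp add: power_less_top_ennreal)
  finally show ?thesis .
qed

section \<open>Potentials with bounded Hessian\<close>

text \<open>Polarization: \<open>4 * (A v \<bullet> u)\<close> is the form at \<open>u + v\<close>
  minus the form at \<open>u - v\<close>, and semidefiniteness allows dropping the latter. It turns
  curvature bounds, which concern only the quadratic form, into an operator norm bound.\<close>

lemma psd_norm_le:
  fixes A :: "'a::real_inner \<Rightarrow>\<^sub>L 'a"
  assumes sym: "\<And>u v. A u \<bullet> v = A v \<bullet> u"
    and psd: "\<And>h. 0 \<le> A h \<bullet> h" and le: "\<And>h. A h \<bullet> h \<le> \<Lambda> * (norm h)\<^sup>2"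
  shows "norm (A h) \<le> \<Lambda> * norm h"
proof (cases "A h = 0")
  case True
  have "0 \<le> \<Lambda> * norm h * norm h"
    using order_trans[OF psd[of h] le[of h]] by (simp add: power2_eq_square mult.assoc)
  then show ?thesis using True by (cases "h = 0") (auto simp: zero_le_mult_iff)
next
  case False
  then have h: "h \<noteq> 0" by auto
  define u v where "u = A h /\<^sub>R norm (A h)" and "v = h /\<^sub>R norm h"
  have n: "norm u = 1" "norm v = 1" using False h by (simp_all add: u_def v_def)
  have "4 * (A v \<bullet> u) = A (u + v) \<bullet> (u + v) - A (u - v) \<bullet> (u - v)"
    using sym[of u v] by (simp add: blinfun.add_right blinfun.diff_right inner_diff inner_add)
  also have "\<dots> \<le> \<Lambda> * (norm (u + v))\<^sup>2" using le[of "u + v"] psd[of "u - v"] by linarith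
  also have "\<dots> \<le> \<Lambda> * 2\<^sup>2"
  proof (rule mult_left_mono)
    show "(norm (u + v))\<^sup>2 \<le> 2\<^sup>2" using norm_triangle_ineq[of u v] n by (intro power_mono) auto
    show "0 \<le> \<Lambda>" using order_trans[OF psd[of v] le[of v]] n by simp
  qed
  finally have "A v \<bullet> u \<le> \<Lambda>" by simp
  moreover have "A v \<bullet> u = norm (A h) / norm h"
    using False by (simp add: u_def v_def blinfun.scaleR_right power2_norm_eq_inner[symmetric] power2_eq_square divide_simps)
  ultimately show ?thesis using h by (simp add: divide_simps)
qed

locale smooth_potential =
  fixes U :: "'a::euclidean_space \<Rightarrow> real" and g :: "'a \<Rightarrow> 'a" and H :: "'a \<Rightarrow> ('a \<Rightarrow>\<^sub>L 'a)"
    and L :: real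
  assumes grad: "\<And>x. (U has_derivative (\<lambda>h. g x \<bullet> h)) (at x)"
    and hess: "\<And>x. (g has_derivative blinfun_apply (H x)) (at x)"
    and grad0: "g 0 = 0"
    and L_nonneg: "0 \<le> L" and H_le: "\<And>x. norm (H x) \<le> L"
begin

section \<open>Second-order calculus along segments and symmetry of the Hessian\<close>

lemma deriv_line:
  "((\<lambda>t. U (x + t *\<^sub>R h)) has_field_derivative g (x + t *\<^sub>R h) \<bullet> h) (at t)"
proof -
  have "((\<lambda>t. U (x + t *\<^sub>R h)) has_derivative (\<lambda>s. g (x + t *\<^sub>R h) \<bullet> (s *\<^sub>R h))) (at t)"
    by (rule has_derivative_compose[OF _ grad, where f="\<lambda>t. x + t *\<^sub>R h"]) (auto intro!: derivative_eq_intros)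
  then show ?thesis by (rule has_derivative_imp_has_field_derivative) simp
qed

lemma deriv_grad_line:
  "((\<lambda>t. g (x + t *\<^sub>R h) \<bullet> k) has_field_derivative H (x + t *\<^sub>R h) h \<bullet> k) (at t)"
proof -
  have "((\<lambda>t. g (x + t *\<^sub>R h)) has_derivative (\<lambda>s. H (x + t *\<^sub>R h) (s *\<^sub>R h))) (at t)"
    by (rule has_derivative_compose[OF _ hess, where f="\<lambda>t. x + t *\<^sub>R h"]) (auto intro!: derivative_eq_intros)
  then have "((\<lambda>t. g (x + t *\<^sub>R h) \<bullet> k) has_derivative (\<lambda>s. H (x + t *\<^sub>R h) (s *\<^sub>R h) \<bullet> k)) (at t)"
    by (rule has_derivative_inner_left)
  then show ?thesis by (rule has_derivative_imp_has_field_derivative) (simp add: blinfun.scaleR_right)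
qed

text \<open>The Lagrange form puts the Hessian at a point of the segment, so that curvature bounds
  valid only in some region can be applied.\<close>

lemma taylor2:
  obtains \<xi> where "0 < \<xi>" "\<xi> < 1"
    "U y = U x + g x \<bullet> (y - x) + (H (x + \<xi> *\<^sub>R (y - x)) (y - x) \<bullet> (y - x)) / 2"
proof -
  define h where "h = y - x"
  define D where "D = (\<lambda>(m::nat) t. if m = 0 then U (x + t *\<^sub>R h) else if m = 1 then g (x + t *\<^sub>R h) \<bullet> h
    else H (x + t *\<^sub>R h) h \<bullet> h)"
  have "\<exists>t>0. t < 1 \<and> D 0 1 = (\<Sum>m<2. D m 0 / fact m * 1 ^ m) + D 2 t / fact 2 * 1 ^ 2"
  proof (rule Maclaurin)
    show "\<forall>m t. m < 2 \<and> 0 \<le> t \<and> t \<le> 1 \<longrightarrow> DERIV (D m) t :> D (Suc m) t"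
    proof (intro allI impI)
      fix m :: nat and t :: real assume "m < 2 \<and> 0 \<le> t \<and> t \<le> 1"
      then have "m = 0 \<or> m = 1" by auto
      then show "DERIV (D m) t :> D (Suc m) t"
        using deriv_line[of x h t] deriv_grad_line[of x h h t] by (auto simp: D_def[abs_def])
    qed
  qed auto
  then obtain \<xi> where \<xi>: "0 < \<xi>" "\<xi> < 1"
      "D 0 1 = (\<Sum>m<2. D m 0 / fact m * 1 ^ m) + D 2 \<xi> / fact 2 * 1 ^ 2" by blast
  show ?thesis
    by (rule that[OF \<xi>(1,2)]) (use \<xi>(3) in \<open>simp add: D_def h_def numeral_2_eq_2\<close>)
qed

text \<open>Prepares the symmetry of the Hessian from the differentiability of \<open>g\<close> at
  the single point \<open>x\<close>: the second difference of \<open>U\<close>, symmetric in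
  \<open>u\<close> and \<open>v\<close>, equals \<open>s\<^sup>2 * (H x u \<bullet> v)\<close> up to
  o(s^2).\<close>

lemma second_difference:
  assumes \<epsilon>: "0 < \<epsilon>"
  obtains \<delta> where "0 < \<delta>"
    "\<And>s. 0 < s \<Longrightarrow> s < \<delta> \<Longrightarrow>
      \<bar>(U (x + s *\<^sub>R u + s *\<^sub>R v) - U (x + s *\<^sub>R u) - U (x + s *\<^sub>R v) + U x) - s\<^sup>2 * (H x u \<bullet> v)\<bar>
        \<le> s\<^sup>2 * (\<epsilon> * (norm v * (norm u + 2 * norm v)))"
proof -
  obtain d where d: "0 < d" "\<And>z. norm (z - x) < d \<Longrightarrow> norm (g z - g x - H x (z - x)) \<le> \<epsilon> * norm (z - x)"
    using has_derivative_at_alt[of g "blinfun_apply (H x)" x] hess[of x] \<epsilon> by auto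
  define \<delta> where "\<delta> = d / (norm u + norm v + 1)"
  have den: "0 < norm u + norm v + 1" using norm_ge_zero[of u] norm_ge_zero[of v] by linarith
  have \<delta>: "0 < \<delta>" using d(1) den by (simp add: \<delta>_def)
  show ?thesis
  proof (rule that[OF \<delta>])
    fix s :: real assume s: "0 < s" "s < \<delta>"
    have sd: "s * (norm u + norm v + 1) < d" using s den by (simp add: \<delta>_def pos_less_divide_eq)
    \<comment> \<open>The increment in direction \<open>u\<close>, viewed along direction
      \<open>v\<close>: one mean value theorem turns the second difference into a difference of
      gradients at two points near \<open>x\<close>, and both gradients are then linearized at
      \<open>x\<close>.\<close>
    define \<Phi> where "\<Phi> = (\<lambda>t. U (x + s *\<^sub>R u + t *\<^sub>R (s *\<^sub>R v)) - U (x + t *\<^sub>R (s *\<^sub>R v)))"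
    have "\<exists>\<xi>>0. \<xi> < 1 \<and> \<Phi> 1 - \<Phi> 0 = (1 - 0) * (g (x + s *\<^sub>R u + \<xi> *\<^sub>R (s *\<^sub>R v)) \<bullet> (s *\<^sub>R v) - g (x + \<xi> *\<^sub>R (s *\<^sub>R v)) \<bullet> (s *\<^sub>R v))"
      unfolding \<Phi>_def by (rule MVT2, simp) (intro DERIV_diff deriv_line)
    then obtain \<xi> where \<xi>: "0 < \<xi>" "\<xi> < 1"
      and eq': "\<Phi> 1 - \<Phi> 0 = (1 - 0) * (g (x + s *\<^sub>R u + \<xi> *\<^sub>R (s *\<^sub>R v)) \<bullet> (s *\<^sub>R v) - g (x + \<xi> *\<^sub>R (s *\<^sub>R v)) \<bullet> (s *\<^sub>R v))"
      by blast
    have eq: "\<Phi> 1 - \<Phi> 0 = (g (x + s *\<^sub>R u + \<xi> *\<^sub>R (s *\<^sub>R v)) - g (x + \<xi> *\<^sub>R (s *\<^sub>R v))) \<bullet> (s *\<^sub>R v)"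
      unfolding eq' inner_diff_left by simp
    define p q where "p = s *\<^sub>R u + \<xi> *\<^sub>R (s *\<^sub>R v)" and "q = \<xi> *\<^sub>R (s *\<^sub>R v)"
    have np: "norm p \<le> s * (norm u + norm v)"
    proof -
      have "norm p \<le> s * norm u + \<xi> * (s * norm v)"
        unfolding p_def using norm_triangle_ineq[of "s *\<^sub>R u" "\<xi> *\<^sub>R (s *\<^sub>R v)"] s \<xi> by simp
      also have "\<xi> * (s * norm v) \<le> 1 * (s * norm v)" using \<xi> s by (intro mult_right_mono) auto
      finally show ?thesis by (simp add: algebra_simps)
    qed
    have nq: "norm q \<le> s * norm v"
      using \<xi> s mult_right_mono[of \<xi> 1 "s * norm v"] by (simp add: q_def)
    have "0 \<le> s * norm u" using s by simp
    then have "norm p < d" "norm q < d"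
      using np nq sd s(1) unfolding distrib_left by linarith+
    then have bp: "norm (g (x + p) - g x - H x p) \<le> \<epsilon> * norm p"
      and bq: "norm (g (x + q) - g x - H x q) \<le> \<epsilon> * norm q"
      using d(2)[of "x + p"] d(2)[of "x + q"] by auto
    have "norm ((g (x + p) - g (x + q)) - s *\<^sub>R H x u) \<le> \<epsilon> * norm p + \<epsilon> * norm q"
    proof -
      have "H x p - H x q = s *\<^sub>R H x u"
        by (simp add: p_def q_def blinfun.add_right blinfun.scaleR_right)
      then have eq2: "(g (x + p) - g (x + q)) - s *\<^sub>R H x u = (g (x + p) - g x - H x p) - (g (x + q) - g x - H x q)"
        by (simp add: algebra_simps)
      show ?thesis unfolding eq2
        using norm_triangle_ineq4[of "g (x + p) - g x - H x p" "g (x + q) - g x - H x q"] bp bq by linarith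
    qed
    also have "\<dots> \<le> \<epsilon> * (s * (norm u + norm v)) + \<epsilon> * (s * norm v)"
      using np nq \<epsilon> by (intro add_mono mult_left_mono) auto
    finally have b: "norm ((g (x + p) - g (x + q)) - s *\<^sub>R H x u) \<le> \<epsilon> * s * (norm u + 2 * norm v)"
      by (simp add: algebra_simps)
    have "\<Phi> 1 - \<Phi> 0 - s\<^sup>2 * (H x u \<bullet> v) = ((g (x + p) - g (x + q)) - s *\<^sub>R H x u) \<bullet> (s *\<^sub>R v)"
      by (simp add: eq p_def q_def inner_diff_left power2_eq_square add.assoc algebra_simps)
    also have "\<bar>\<dots>\<bar> \<le> (\<epsilon> * s * (norm u + 2 * norm v)) * (s * norm v)"
      using s b Cauchy_Schwarz_ineq2[of "(g (x + p) - g (x + q)) - s *\<^sub>R H x u" "s *\<^sub>R v"]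
      by (elim order_trans) (simp add: mult_right_mono)
    finally have "\<bar>\<Phi> 1 - \<Phi> 0 - s\<^sup>2 * (H x u \<bullet> v)\<bar> \<le> s\<^sup>2 * (\<epsilon> * (norm v * (norm u + 2 * norm v)))"
      by (simp add: power2_eq_square mult_ac)
    moreover have "\<Phi> 1 - \<Phi> 0 = U (x + s *\<^sub>R u + s *\<^sub>R v) - U (x + s *\<^sub>R u) - U (x + s *\<^sub>R v) + U x"
      by (simp add: \<Phi>_def)
    ultimately show "\<bar>(U (x + s *\<^sub>R u + s *\<^sub>R v) - U (x + s *\<^sub>R u) - U (x + s *\<^sub>R v) + U x) - s\<^sup>2 * (H x u \<bullet> v)\<bar>
        \<le> s\<^sup>2 * (\<epsilon> * (norm v * (norm u + 2 * norm v)))" by simp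
  qed
qed

text \<open>Exchanging \<open>u\<close> and \<open>v\<close> leaves the second difference of
  \<open>U\<close> unchanged, so its two expansions must have the same leading coefficient.\<close>

lemma hessian_sym: "H x u \<bullet> v = H x v \<bullet> u"
proof -
  define N where "N = norm v * (norm u + 2 * norm v) + norm u * (norm v + 2 * norm u)"
  have "\<bar>H x u \<bullet> v - H x v \<bullet> u\<bar> \<le> e * N" if e: "0 < e" for e
  proof -
    obtain d1 where d1: "0 < d1" "\<And>s. 0 < s \<Longrightarrow> s < d1 \<Longrightarrow>
      \<bar>(U (x + s *\<^sub>R u + s *\<^sub>R v) - U (x + s *\<^sub>R u) - U (x + s *\<^sub>R v) + U x) - s\<^sup>2 * (H x u \<bullet> v)\<bar>
        \<le> s\<^sup>2 * (e * (norm v * (norm u + 2 * norm v)))"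
      using second_difference[OF e, of x u v] by blast
    obtain d2 where d2: "0 < d2" "\<And>s. 0 < s \<Longrightarrow> s < d2 \<Longrightarrow>
      \<bar>(U (x + s *\<^sub>R v + s *\<^sub>R u) - U (x + s *\<^sub>R v) - U (x + s *\<^sub>R u) + U x) - s\<^sup>2 * (H x v \<bullet> u)\<bar>
        \<le> s\<^sup>2 * (e * (norm u * (norm v + 2 * norm u)))"
      using second_difference[OF e, of x v u] by blast
    define s where "s = min d1 d2 / 2"
    have s: "0 < s" "s < d1" "s < d2" using d1(1) d2(1) by (auto simp: s_def min_def)
    have "x + s *\<^sub>R v + s *\<^sub>R u = x + s *\<^sub>R u + s *\<^sub>R v" by (simp add: algebra_simps)
    with d1(2)[OF s(1,2)] d2(2)[OF s(1,3)]
    have "\<bar>s\<^sup>2 * (H x u \<bullet> v) - s\<^sup>2 * (H x v \<bullet> u)\<bar> \<le> s\<^sup>2 * (e * (norm v * (norm u + 2 * norm v))) + s\<^sup>2 * (e * (norm u * (norm v + 2 * norm u)))"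
      by (simp only: abs_le_iff) linarith
    also have "\<dots> = s\<^sup>2 * (e * N)" by (simp add: N_def algebra_simps)
    finally have "s\<^sup>2 * \<bar>H x u \<bullet> v - H x v \<bullet> u\<bar> \<le> s\<^sup>2 * (e * N)"
      by (simp add: right_diff_distrib[symmetric] abs_mult)
    then show ?thesis using s by simp
  qed
  note * = this
  have N: "0 \<le> N" by (simp add: N_def)
  show ?thesis
  proof (rule ccontr)
    assume "H x u \<bullet> v \<noteq> H x v \<bullet> u"
    then have "0 < \<bar>H x u \<bullet> v - H x v \<bullet> u\<bar>" (is "0 < ?a") by simp
    then have "?a \<le> ?a / (2 * (N + 1)) * N" using N by (intro *) simp
    also have "\<dots> < ?a" using \<open>0 < ?a\<close> N by (simp add: divide_simps)
    finally show False by simp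
  qed
qed

lemma grad_diff_le:
  assumes "\<And>z. z \<in> closed_segment x y \<Longrightarrow> norm (H z) \<le> \<Lambda>"
  shows "norm (g y - g x) \<le> \<Lambda> * norm (y - x)"
  by (rule differentiable_bound[of "closed_segment x y" g "\<lambda>z. blinfun_apply (H z)"])
    (use assms hess in \<open>auto intro: has_derivative_at_withinI simp: norm_blinfun.rep_eq[symmetric]\<close>)

lemma grad_lipschitz: "norm (g y - g x) \<le> L * norm (y - x)"
  by (rule grad_diff_le) (rule H_le)

lemma norm_grad_le: "norm (g x) \<le> L * norm x"
  using grad_lipschitz[of x 0] by (simp add: grad0)

lemma hessian_form_le: "\<bar>H x h \<bullet> h\<bar> \<le> L * (norm h)\<^sup>2"
proof -
  have "\<bar>H x h \<bullet> h\<bar> \<le> norm (H x h) * norm h" by (rule Cauchy_Schwarz_ineq2)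
  also have "\<dots> \<le> (L * norm h) * norm h"
    by (intro mult_right_mono order_trans[OF norm_blinfun]) (auto simp: H_le)
  finally show ?thesis by (simp add: power2_eq_square mult.assoc)
qed

lemma descent: "\<bar>U y - U x - g x \<bullet> (y - x)\<bar> \<le> L / 2 * (norm (y - x))\<^sup>2"
  by (rule taylor2[where x=x and y=y]) (use hessian_form_le[where h="y - x"] in auto)

lemma continuous_U: "continuous_on A U"
  using has_derivative_continuous[OF grad] by (simp add: continuous_at_imp_continuous_on)

lemma continuous_g: "continuous_on A g"
  using has_derivative_continuous[OF hess] by (simp add: continuous_at_imp_continuous_on)

end

section \<open>Growth of the potential at infinity\<close>

locale mala_potential = smooth_potential +
  fixes \<beta> m Lb K :: real
  assumes \<beta>: "0 \<le> \<beta>" "\<beta> < 1" and m: "0 < m" and Lb: "0 \<le> Lb" and K: "0 \<le> K"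
    and hess_bounds: "\<And>x y. K \<le> norm x \<Longrightarrow> norm y = 1 \<Longrightarrow>
          Lb / (1 + rpow (norm x) (3 * \<beta> / 4)) \<ge> H x y \<bullet> y
        \<and> H x y \<bullet> y \<ge> m / (1 + rpow (norm x) \<beta>)"
begin

text \<open>Away from the origin \<open>rpow\<close> agrees with \<open>powr\<close>, and
  homogeneity extends the bounds from unit vectors to all \<open>h\<close>.\<close>

lemma hess_form_bounds:
  assumes x: "K \<le> norm x" "0 < norm x"
  shows "H x h \<bullet> h \<le> Lb / (1 + norm x powr (3 * \<beta> / 4)) * (norm h)\<^sup>2"
    and "m / (1 + norm x powr \<beta>) * (norm h)\<^sup>2 \<le> H x h \<bullet> h"
proof -
  have rp: "rpow (norm x) a = norm x powr a" for a using x by (auto simp: rpow_def)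
  have "H x h \<bullet> h \<le> Lb / (1 + norm x powr (3 * \<beta> / 4)) * (norm h)\<^sup>2 \<and>
    m / (1 + norm x powr \<beta>) * (norm h)\<^sup>2 \<le> H x h \<bullet> h"
  proof (cases "h = 0")
    case False
    define y where "y = h /\<^sub>R norm h"
    have y: "norm y = 1" and h: "h = norm h *\<^sub>R y" using False by (simp_all add: y_def)
    have eq: "H x h \<bullet> h = (H x y \<bullet> y) * (norm h)\<^sup>2"
      by (subst (1 2) h) (simp add: blinfun.scaleR_right power2_eq_square)
    show ?thesis unfolding eq
      using hess_bounds[OF x(1) y] unfolding rp by (intro conjI mult_right_mono) auto
  qed simp
  then show "H x h \<bullet> h \<le> Lb / (1 + norm x powr (3 * \<beta> / 4)) * (norm h)\<^sup>2"
    "m / (1 + norm x powr \<beta>) * (norm h)\<^sup>2 \<le> H x h \<bullet> h" by auto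
qed

lemma hess_psd:
  assumes "K \<le> norm x" "0 < norm x"
  shows "0 \<le> H x h \<bullet> h"
proof -
  have "0 \<le> m / (1 + norm x powr \<beta>) * (norm h)\<^sup>2" using m by (simp add: add_nonneg_nonneg)
  then show ?thesis using hess_form_bounds(2)[OF assms] by (rule order_trans)
qed

lemma radial_grad_mono:
  assumes e: "norm e = 1" and s: "K \<le> s" "0 < s" "s \<le> t"
  shows "g (s *\<^sub>R e) \<bullet> e \<le> g (t *\<^sub>R e) \<bullet> e"
proof (rule DERIV_nonneg_imp_nondecreasing[OF s(3)])
  fix r assume r: "s \<le> r" "r \<le> t"
  have "0 \<le> H (r *\<^sub>R e) e \<bullet> e" by (rule hess_psd) (use r s e in auto)
  then show "\<exists>y. ((\<lambda>t. g (t *\<^sub>R e) \<bullet> e) has_real_derivative y) (at r) \<and> 0 \<le> y"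
    using deriv_grad_line[of 0 e e r] by auto
qed

text \<open>On the outer half of the ray to radius \<open>r\<close> the curvature is at least
  \<open>m / (2 r powr \<beta>)\<close>, so the radial gradient gains
  \<open>m / 4 * r powr (1 - \<beta>)\<close>, which is unbounded as \<beta> < 1. Its value at
  \<open>r / 2\<close> is bounded below by monotonicity from radius \<open>K + 1\<close>.\<close>

lemma radial_grad_at_top:
  obtains R where "0 < R" "\<And>x. R \<le> norm x \<Longrightarrow> A * norm x \<le> g x \<bullet> x"
proof -
  \<comment> \<open>\<open>R0\<close> solves \<open>R0 powr (1 - \<beta>) = X\<close>; from this
    radius on, the gain covers both the target \<open>A\<close> and the possible deficit
    \<open>L * (K + 1)\<close> at radius \<open>K + 1\<close>.\<close>
  define X where "X = max 1 (4 * (A + L * (K + 1)) / m)"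
  define R0 where "R0 = X powr (1 / (1 - \<beta>))"
  have R0: "A + L * (K + 1) \<le> m / 4 * r powr (1 - \<beta>)" if "R0 \<le> r" for r
  proof -
    have "X = R0 powr (1 - \<beta>)" using \<beta> by (simp add: R0_def powr_powr X_def)
    also have "\<dots> \<le> r powr (1 - \<beta>)" using that \<beta> by (intro powr_mono2) (auto simp: R0_def)
    finally have "m / 4 * X \<le> m / 4 * r powr (1 - \<beta>)" using m by (intro mult_left_mono) auto
    moreover have "m / 4 * (4 * (A + L * (K + 1)) / m) \<le> m / 4 * X"
      using m by (intro mult_left_mono) (auto simp: X_def)
    moreover have "m / 4 * (4 * (A + L * (K + 1)) / m) = A + L * (K + 1)" using m by simp
    ultimately show ?thesis by linarith
  qed
define R where "R = max R0 (2 * (K + 1))"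
  have "0 < R" using K by (simp add: R_def)
  moreover have "A * norm x \<le> g x \<bullet> x" if x: "R \<le> norm x" for x
  proof -
    define r where "r = norm x"
    define e where "e = x /\<^sub>R r"
    have r: "R0 \<le> r" "2 * (K + 1) \<le> r" using x by (auto simp: R_def r_def)
    then have r1: "2 \<le> r" "0 < r" using K by auto
    have e: "norm e = 1" and xe: "x = r *\<^sub>R e" using r1 by (simp_all add: e_def r_def)
    have "\<exists>\<xi>. r / 2 < \<xi> \<and> \<xi> < r \<and> g (r *\<^sub>R e) \<bullet> e - g ((r / 2) *\<^sub>R e) \<bullet> e = (r - r / 2) * (H (\<xi> *\<^sub>R e) e \<bullet> e)"
      using MVT2[of "r / 2" r "\<lambda>t. g (t *\<^sub>R e) \<bullet> e" "\<lambda>t. H (t *\<^sub>R e) e \<bullet> e"] deriv_grad_line[of 0 e e] r1 by auto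
    then obtain \<xi> where \<xi>: "r / 2 < \<xi>" "\<xi> < r"
      and eq: "g (r *\<^sub>R e) \<bullet> e - g ((r / 2) *\<^sub>R e) \<bullet> e = (r / 2) * (H (\<xi> *\<^sub>R e) e \<bullet> e)" by auto
    have \<xi>': "K + 1 < \<xi>" "0 < \<xi>" using \<xi> r K by auto
    have "m / (2 * r powr \<beta>) \<le> m / (1 + \<xi> powr \<beta>)"
    proof (rule divide_left_mono)
      have "1 \<le> r powr \<beta>" using r1 \<beta> by (intro ge_one_powr_ge_zero) auto
      moreover have "\<xi> powr \<beta> \<le> r powr \<beta>" using \<xi> \<xi>' \<beta> by (intro powr_mono2) auto
      ultimately show "1 + \<xi> powr \<beta> \<le> 2 * r powr \<beta>" by simp
    qed (use m r1 in \<open>auto intro!: mult_pos_pos add_pos_nonneg\<close>)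
    also have "\<dots> \<le> H (\<xi> *\<^sub>R e) e \<bullet> e"
      using hess_form_bounds(2)[of "\<xi> *\<^sub>R e" e] \<xi>' e by simp
    finally have "(r / 2) * (m / (2 * r powr \<beta>)) \<le> (r / 2) * (H (\<xi> *\<^sub>R e) e \<bullet> e)"
      using r1 by (intro mult_left_mono) auto
    moreover have "(r / 2) * (m / (2 * r powr \<beta>)) = m / 4 * r powr (1 - \<beta>)"
      using r1 by (simp add: powr_diff)
    moreover have "- (L * (K + 1)) \<le> g ((r / 2) *\<^sub>R e) \<bullet> e"
    proof -
      have "- (L * (K + 1)) \<le> - norm (g ((K + 1) *\<^sub>R e))"
        using norm_grad_le[of "(K + 1) *\<^sub>R e"] e K by simp
      also have "\<dots> \<le> g ((K + 1) *\<^sub>R e) \<bullet> e"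
        using Cauchy_Schwarz_ineq2[of "g ((K + 1) *\<^sub>R e)" e] e by simp
      also have "\<dots> \<le> g ((r / 2) *\<^sub>R e) \<bullet> e" using K r e by (intro radial_grad_mono) auto
      finally show ?thesis .
    qed
    ultimately have "A \<le> g (r *\<^sub>R e) \<bullet> e" using R0[OF r(1)] eq by linarith
    then have "A * r \<le> (g (r *\<^sub>R e) \<bullet> e) * r" using r1 by (intro mult_right_mono) auto
    also have "\<dots> = g x \<bullet> x" unfolding xe by simp
    finally show ?thesis by (simp add: r_def)
  qed
  ultimately show ?thesis by (rule that)
qed

text \<open>Outside a ball the radial derivative of \<open>U\<close> is at least \<open>A\<close>,
  and on the ball \<open>U\<close> is bounded. Growth faster than any linear function is what makes
  each \<open>Wfun \<eta>\<close> integrable under the target.\<close>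

lemma potential_growth:
  assumes A: "0 \<le> A"
  obtains B where "\<And>x. A * norm x - B \<le> U x"
proof -
  obtain R where R: "0 < R" "\<And>x. R \<le> norm x \<Longrightarrow> A * norm x \<le> g x \<bullet> x"
    using radial_grad_at_top[of A] by blast
  have "bounded (U ` cball 0 R)"
    by (intro compact_imp_bounded compact_continuous_image continuous_U compact_cball)
  then obtain B0 where "\<And>u. u \<in> U ` cball 0 R \<Longrightarrow> norm u \<le> B0"
    unfolding bounded_iff by blast
  then have "\<bar>U x\<bar> \<le> B0" if "norm x \<le> R" for x using that by simp
  then have B0: "- B0 \<le> U x" if "norm x \<le> R" for x using that by (metis abs_le_iff minus_le_iff)
  have "A * norm x - (A * R + B0) \<le> U x" for x
  proof (cases "norm x \<le> R")
    case True
    then show ?thesis using B0[OF True] mult_left_mono[OF True A] by linarith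
  next
    case False
    define e where "e = x /\<^sub>R norm x"
    have "x \<noteq> 0" using False R(1) by auto
    then have e: "norm e = 1" and xe: "x = norm x *\<^sub>R e" by (simp_all add: e_def)
    obtain \<xi> where \<xi>: "R < \<xi>" "\<xi> < norm x"
      and eq: "U (norm x *\<^sub>R e) - U (R *\<^sub>R e) = (norm x - R) * (g (\<xi> *\<^sub>R e) \<bullet> e)"
      using MVT2[of R "norm x" "\<lambda>t. U (t *\<^sub>R e)" "\<lambda>t. g (t *\<^sub>R e) \<bullet> e"] deriv_line[of 0 e] False by auto
    have "A * \<xi> \<le> (g (\<xi> *\<^sub>R e) \<bullet> e) * \<xi>"
      using R(2)[of "\<xi> *\<^sub>R e"] \<xi> R(1) e by (simp add: mult.commute)
    then have "A \<le> g (\<xi> *\<^sub>R e) \<bullet> e" using \<xi> R(1) by simp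
    then have "(norm x - R) * A \<le> U (norm x *\<^sub>R e) - U (R *\<^sub>R e)"
      unfolding eq using False by (intro mult_left_mono) auto
    then show ?thesis using B0[of "R *\<^sub>R e"] e R(1) xe by (simp add: algebra_simps)
  qed
  then show ?thesis by (rule that)
qed

text \<open>For a symmetric positive semidefinite \<open>H\<close> one has \<open>2 p \<bullet> H e \<le> p \<bullet> H p + e \<bullet> H e\<close>; integrating this
  along the ray through \<open>e\<close> with \<open>p\<close> proportional to the gradient increment gives a cocoercivity
  estimate that needs no convexity inside the ball of radius \<open>K\<close>.\<close>
lemma radial_cocoercive:
  assumes e: "norm e = 1" and s: "K \<le> s" "0 < s" "s \<le> r"
  defines "v \<equiv> g (r *\<^sub>R e) - g (s *\<^sub>R e)"
  shows "(norm v)\<^sup>2 \<le> (L + 1) * r * (v \<bullet> e)"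
proof -
  \<comment> \<open>This scaling makes \<open>(L + 1) * (norm p)\<^sup>2 * r\<close> equal to
    \<open>v \<bullet> p\<close>, so the inequality below collapses to
    \<open>v \<bullet> p \<le> v \<bullet> e\<close>. Taking \<open>L + 1\<close> for
    \<open>L\<close> avoids division by zero.\<close>
  define p where "p = v /\<^sub>R ((L + 1) * r)"
  \<comment> \<open>The derivative of \<open>k\<close> at \<open>t\<close> dominates the form of the
    Hessian at \<open>p - e\<close>, which is nonnegative on the part of the ray outside radius
    \<open>K\<close>.\<close>
  define k where "k = (\<lambda>t. (L + 1) * (norm p)\<^sup>2 * t + g (0 + t *\<^sub>R e) \<bullet> e - 2 * (g (0 + t *\<^sub>R e) \<bullet> p))"
  have Lr: "0 < (L + 1) * r" using L_nonneg s by simp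
  have "k s \<le> k r"
  proof (rule DERIV_nonneg_imp_nondecreasing[OF s(3)])
    fix t assume t: "s \<le> t" "t \<le> r"
    let ?H = "H (0 + t *\<^sub>R e)"
    have "(k has_field_derivative (L + 1) * (norm p)\<^sup>2 * 1 + ?H e \<bullet> e - 2 * (?H e \<bullet> p)) (at t)"
      unfolding k_def by (intro DERIV_add DERIV_diff DERIV_cmult deriv_grad_line DERIV_ident)
    moreover have "0 \<le> ?H (p - e) \<bullet> (p - e)" by (rule hess_psd) (use t s e in auto)
    then have "2 * (?H e \<bullet> p) \<le> ?H p \<bullet> p + ?H e \<bullet> e"
      using hessian_sym[of "0 + t *\<^sub>R e" p e] by (simp add: blinfun.diff_right inner_diff)
    moreover have "?H p \<bullet> p \<le> (L + 1) * (norm p)\<^sup>2"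
      using hessian_form_le[of "0 + t *\<^sub>R e" p] zero_le_power2[of "norm p"]
      by (simp only: abs_le_iff distrib_right mult_1) linarith
    ultimately show "\<exists>y. (k has_real_derivative y) (at t) \<and> 0 \<le> y"
      by (intro exI[of _ "(L + 1) * (norm p)\<^sup>2 * 1 + ?H e \<bullet> e - 2 * (?H e \<bullet> p)"]) auto
  qed
  then have "0 \<le> (L + 1) * (norm p)\<^sup>2 * (r - s) + v \<bullet> e - 2 * (v \<bullet> p)"
    by (simp add: k_def v_def inner_diff_left algebra_simps)
  also have "(L + 1) * (norm p)\<^sup>2 * (r - s) \<le> (L + 1) * (norm p)\<^sup>2 * r"
    using s L_nonneg by (intro mult_left_mono) auto
  also have "(L + 1) * (norm p)\<^sup>2 * r = (norm v)\<^sup>2 / ((L + 1) * r)"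
    using Lr L_nonneg s by (simp add: p_def power_mult_distrib power_inverse divide_simps) (simp add: power2_eq_square)
  also have "v \<bullet> p = (norm v)\<^sup>2 / ((L + 1) * r)"
    by (simp add: p_def power2_norm_eq_inner divide_simps)
  finally have "(norm v)\<^sup>2 / ((L + 1) * r) \<le> v \<bullet> e" by linarith
  then show ?thesis using Lr by (simp add: pos_divide_le_eq mult.commute)
qed

text \<open>Cocoercivity gives \<open>\<gamma> * (norm (g x))\<^sup>2 \<le> g x \<bullet> x\<close>,
  so the squared norm decreases by at least \<open>\<gamma> * (g x \<bullet> x)\<close>, a multiple
  of \<open>\<gamma> * norm x\<close> with a factor as large as desired. The admissible step size
  depends only on \<open>L\<close>; only the radius \<open>R\<close> depends on
  \<open>A\<close>.\<close>

lemma drift_step_contracts: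
  obtains R where "1 \<le> R"
    "\<And>x \<gamma>. R \<le> norm x \<Longrightarrow> 0 < \<gamma> \<Longrightarrow> 8 * (L + 1) * \<gamma> \<le> 1 \<Longrightarrow>
      sqrt (1 + (norm (x - \<gamma> *\<^sub>R g x))\<^sup>2) \<le> sqrt (1 + (norm x)\<^sup>2) - A * \<gamma>"
proof -
  \<comment> \<open>\<open>4 * \<bar>A\<bar>\<close> yields the decrease \<open>A * \<gamma>\<close>
    after the square root, and \<open>(L + 1) * (K + 1)\<close> dominates the gradient at radius
    \<open>K + 1\<close>, where cocoercivity starts.\<close>
  define B where "B = 4 * \<bar>A\<bar> + (L + 1) * (K + 1)"
  obtain R0 where R0: "0 < R0" "\<And>x. R0 \<le> norm x \<Longrightarrow> B * norm x \<le> g x \<bullet> x"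
    using radial_grad_at_top[of B] by blast
  define R where "R = max R0 (K + 1)"
  have "1 \<le> R" using K by (simp add: R_def)
  moreover have "sqrt (1 + (norm (x - \<gamma> *\<^sub>R g x))\<^sup>2) \<le> sqrt (1 + (norm x)\<^sup>2) - A * \<gamma>"
    if x: "R \<le> norm x" and \<gamma>: "0 < \<gamma>" "8 * (L + 1) * \<gamma> \<le> 1" for x \<gamma>
  proof -
    define r where "r = norm x"
    define e where "e = x /\<^sub>R r"
    have r: "R0 \<le> r" "K + 1 \<le> r" using x by (auto simp: R_def r_def)
    then have r1: "1 \<le> r" "0 < r" using K by auto
    have e: "norm e = 1" and xe: "x = r *\<^sub>R e" using r1 by (auto simp: e_def r_def)
    have Bx: "B * r \<le> g x \<bullet> x" using R0(2)[of x] r by (simp add: r_def)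
    define v where "v = g (r *\<^sub>R e) - g ((K + 1) *\<^sub>R e)"
    define w where "w = g ((K + 1) *\<^sub>R e)"
    have gx: "g x = v + w" by (simp add: v_def w_def xe)
    have nw: "norm w \<le> L * (K + 1)" using norm_grad_le[of "(K + 1) *\<^sub>R e"] e K by (simp add: w_def)
    define q where "q = L * (K + 1)"
    have q0: "0 \<le> q" using L_nonneg K by (simp add: q_def)
    have gx0: "0 \<le> g x \<bullet> x"
    proof -
      have "0 \<le> B * r" using L_nonneg K r1 by (simp add: B_def)
      then show ?thesis using Bx by simp
    qed
    have qB: "q * r \<le> B * r" unfolding q_def B_def using r1 K L_nonneg by (intro mult_right_mono) (auto simp: algebra_simps)
    have "(norm v)\<^sup>2 \<le> (L + 1) * r * (v \<bullet> e)"
      unfolding v_def using e K r by (intro radial_cocoercive) auto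
    also have "g x \<bullet> (r *\<^sub>R e) = r * (g x \<bullet> e)" by simp
    then have "r * (v \<bullet> e) = g x \<bullet> x - r * (w \<bullet> e)"
      unfolding xe[symmetric] by (simp add: gx algebra_simps inner_add_left)
    then have "(L + 1) * r * (v \<bullet> e) = (L + 1) * (g x \<bullet> x - r * (w \<bullet> e))" by (simp only: mult.assoc)
    also have "\<dots> \<le> (L + 1) * (g x \<bullet> x + r * q)"
    proof (intro mult_left_mono)
      have "- (w \<bullet> e) \<le> q" using Cauchy_Schwarz_ineq2[of w e] nw e by (simp add: q_def)
      then have "r * - (w \<bullet> e) \<le> r * q" using r1 by (intro mult_left_mono) auto
      then show "g x \<bullet> x - r * (w \<bullet> e) \<le> g x \<bullet> x + r * q" by simp
    qed (use L_nonneg in auto)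
    finally have nv: "(norm v)\<^sup>2 \<le> (L + 1) * (g x \<bullet> x + r * q)" .
    have "(norm (g x))\<^sup>2 \<le> 2 * (norm v)\<^sup>2 + 2 * (norm w)\<^sup>2"
    proof -
      have "(norm (g x))\<^sup>2 \<le> (norm v + norm w)\<^sup>2"
        unfolding gx by (intro power_mono norm_triangle_ineq) auto
      also have "\<dots> \<le> 2 * (norm v)\<^sup>2 + 2 * (norm w)\<^sup>2"
        using zero_le_power2[of "norm v - norm w"] by (simp add: power2_eq_square algebra_simps)
      finally show ?thesis .
    qed
    also have "(norm w)\<^sup>2 \<le> (L + 1) * (r * q)"
    proof -
      have "(norm w)\<^sup>2 \<le> q\<^sup>2" using nw by (intro power_mono) (auto simp: q_def)
      also have "\<dots> = L * ((K + 1) * q)" by (simp add: q_def power2_eq_square)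
      also have "\<dots> \<le> (L + 1) * (r * q)" using L_nonneg q0 r K by (intro mult_mono) auto
      finally show ?thesis .
    qed
    finally have "(norm (g x))\<^sup>2 \<le> 2 * (L + 1) * (g x \<bullet> x + 2 * (r * q))" using nv by (simp add: algebra_simps)
    also have "\<dots> \<le> 2 * (L + 1) * (3 * (g x \<bullet> x))"
      using qB Bx L_nonneg by (intro mult_left_mono) (auto simp: mult.commute)
    finally have "\<gamma> * (norm (g x))\<^sup>2 \<le> \<gamma> * (2 * (L + 1) * (3 * (g x \<bullet> x)))"
      using \<gamma> by (intro mult_left_mono) auto
    also have "\<dots> = (8 * (L + 1) * \<gamma>) * (3 / 4 * (g x \<bullet> x))" by simp
    also have "\<dots> \<le> 1 * (3 / 4 * (g x \<bullet> x))"
      using \<gamma> gx0 by (intro mult_right_mono) auto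
    also have "\<dots> \<le> g x \<bullet> x" using gx0 by simp
    finally have gg: "\<gamma> * (norm (g x))\<^sup>2 \<le> g x \<bullet> x" .
    define \<psi> where "\<psi> = sqrt (1 + r\<^sup>2)"
    define \<psi>' where "\<psi>' = sqrt (1 + (norm (x - \<gamma> *\<^sub>R g x))\<^sup>2)"
    have \<psi>: "0 < \<psi>" "\<psi>\<^sup>2 = 1 + r\<^sup>2" "\<psi>'\<^sup>2 = 1 + (norm (x - \<gamma> *\<^sub>R g x))\<^sup>2"
      by (auto simp: \<psi>_def \<psi>'_def add_pos_nonneg)
    have \<psi>r: "\<psi> \<le> 2 * r"
      unfolding \<psi>_def using r1 mult_mono[of 1 r 1 r] by (intro real_le_lsqrt) (auto simp: power2_eq_square)
    have "(norm (x - \<gamma> *\<^sub>R g x))\<^sup>2 = r\<^sup>2 - 2 * \<gamma> * (g x \<bullet> x) + \<gamma> * (\<gamma> * (norm (g x))\<^sup>2)"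
      unfolding r_def power2_norm_eq_inner
      by (simp add: inner_diff inner_commute algebra_simps power2_eq_square)
    also have "\<dots> \<le> r\<^sup>2 - 2 * \<gamma> * (g x \<bullet> x) + \<gamma> * (g x \<bullet> x)"
      using gg \<gamma> by (intro add_left_mono mult_left_mono) auto
    finally have "\<psi>'\<^sup>2 \<le> \<psi>\<^sup>2 - \<gamma> * (g x \<bullet> x)" by (simp add: \<psi>)
    also have "\<dots> \<le> \<psi>\<^sup>2 - \<gamma> * (2 * \<bar>A\<bar> * \<psi>)"
    proof -
      have "2 * \<bar>A\<bar> * \<psi> \<le> 4 * \<bar>A\<bar> * r" using \<psi>r mult_left_mono[OF \<psi>r, of "2 * \<bar>A\<bar>"] by simp
      also have "\<dots> \<le> B * r" unfolding B_def using r1 K L_nonneg by (intro mult_right_mono) auto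
      finally have "2 * \<bar>A\<bar> * \<psi> \<le> g x \<bullet> x" using Bx by simp
      then show ?thesis using \<gamma> by simp
    qed
    finally have le: "\<psi>'\<^sup>2 \<le> \<psi>\<^sup>2 - 2 * \<psi> * (\<bar>A\<bar> * \<gamma>)" by (simp add: mult_ac)
    \<comment> \<open>AM-GM linearizes the square root: a decrease of \<open>\<psi>'\<^sup>2\<close>
      by \<open>2 * \<psi> * (\<bar>A\<bar> * \<gamma>)\<close> lowers \<open>\<psi>'\<close> by
      \<open>\<bar>A\<bar> * \<gamma>\<close>.\<close>
    have "2 * \<psi> * \<psi>' \<le> \<psi>\<^sup>2 + \<psi>'\<^sup>2"
      using zero_le_power2[of "\<psi> - \<psi>'"] by (simp add: power2_diff)
    then have "2 * \<psi> * \<psi>' \<le> 2 * \<psi> * (\<psi> - \<bar>A\<bar> * \<gamma>)" using le by (simp add: algebra_simps power2_eq_square)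
    then have "\<psi>' \<le> \<psi> - \<bar>A\<bar> * \<gamma>" using \<psi>(1) by simp
    also have "\<dots> \<le> \<psi> - A * \<gamma>" using \<gamma> by (simp add: mult_right_mono)
    finally show ?thesis by (simp add: \<psi>_def \<psi>'_def r_def)
  qed
  ultimately show ?thesis by (rule that)
qed

end

section \<open>The rejection probability\<close>

context smooth_potential
begin

lemma accept_prob_eq:
  assumes \<gamma>: "0 < \<gamma>"
  defines "w x y \<equiv> y - x + \<gamma> *\<^sub>R g x"
  shows "accept_prob U g \<gamma> x y = min 1 (exp (- (U y - U x - g y \<bullet> (y - x)
    + (w x y \<bullet> (g y - g x)) / 2 + \<gamma> / 4 * (norm (g y - g x))\<^sup>2)))"
proof -
  define T where "T = U y - U x - g y \<bullet> (y - x) + (w x y \<bullet> (g y - g x)) / 2 + \<gamma> / 4 * (norm (g y - g x))\<^sup>2"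
  have "(exp (- U y) * prop_dens g \<gamma> y x) / (exp (- U x) * prop_dens g \<gamma> x y)
      = exp (- U y) * exp (- (norm (w y x))\<^sup>2 / (4 * \<gamma>)) / (exp (- U x) * exp (- (norm (w x y))\<^sup>2 / (4 * \<gamma>)))"
    using \<gamma> by (simp add: prop_dens_def w_def)
  also have "\<dots> = exp (- U y + - (norm (w y x))\<^sup>2 / (4 * \<gamma>) - (- U x + - (norm (w x y))\<^sup>2 / (4 * \<gamma>)))"
    by (simp only: exp_add exp_diff)
  also have "- U y + - (norm (w y x))\<^sup>2 / (4 * \<gamma>) - (- U x + - (norm (w x y))\<^sup>2 / (4 * \<gamma>)) = - T"
  proof -
    \<comment> \<open>The forward noise is \<open>h + \<gamma> *\<^sub>R g x\<close> and the
      backward noise \<open>\<gamma> *\<^sub>R g y - h\<close>, so the singular term |h|^2 / (4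
      \<gamma>) cancels in the ratio.\<close>
    define h where "h = y - x"
    have "(norm (w y x))\<^sup>2 - (norm (w x y))\<^sup>2
        = \<gamma>\<^sup>2 * (g y \<bullet> g y - g x \<bullet> g x) - 2 * \<gamma> * (h \<bullet> g y + h \<bullet> g x)"
    proof -
      have eqs: "w y x = \<gamma> *\<^sub>R g y - h" "w x y = h + \<gamma> *\<^sub>R g x" by (simp_all add: w_def h_def)
      show ?thesis unfolding power2_norm_eq_inner eqs
        by (simp add: inner_diff inner_add inner_commute algebra_simps power2_eq_square)
    qed
    then have "((norm (w y x))\<^sup>2 - (norm (w x y))\<^sup>2) / (4 * \<gamma>)
        = \<gamma> / 4 * (g y \<bullet> g y - g x \<bullet> g x) - (h \<bullet> g y + h \<bullet> g x) / 2"
      using \<gamma> by (simp add: field_simps power2_eq_square)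
    moreover have "(w x y \<bullet> (g y - g x)) / 2 + \<gamma> / 4 * (norm (g y - g x))\<^sup>2
        = (h \<bullet> g y - h \<bullet> g x) / 2 + \<gamma> / 4 * (g y \<bullet> g y - g x \<bullet> g x)"
    proof -
      have "w x y = h + \<gamma> *\<^sub>R g x" by (simp add: w_def h_def)
      then show ?thesis unfolding power2_norm_eq_inner
        by (simp add: inner_diff inner_add inner_commute) (simp add: field_simps)
    qed
    ultimately show ?thesis
      by (simp add: T_def diff_divide_distrib h_def inner_commute) (simp add: field_simps)
  qed
  finally show ?thesis by (simp add: accept_prob_def T_def)
qed

lemma rejection_le_log_ratio:
  assumes \<gamma>: "0 < \<gamma>"
    and le: "U y - U x - g y \<bullet> (y - x) + ((y - x + \<gamma> *\<^sub>R g x) \<bullet> (g y - g x)) / 2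
      + \<gamma> / 4 * (norm (g y - g x))\<^sup>2 \<le> c" and c: "0 \<le> c"
  shows "1 - accept_prob U g \<gamma> x y \<le> c"
proof -
  let ?T = "U y - U x - g y \<bullet> (y - x) + ((y - x + \<gamma> *\<^sub>R g x) \<bullet> (g y - g x)) / 2
      + \<gamma> / 4 * (norm (g y - g x))\<^sup>2"
  have "1 + - c \<le> 1 + - ?T" using le by simp
  also have "\<dots> \<le> exp (- ?T)" by (rule exp_ge_add_one_self)
  finally show ?thesis unfolding accept_prob_eq[OF \<gamma>] using c by (simp add: min_def)
qed

lemma accept_prob_bounds: "0 \<le> accept_prob U g \<gamma> x y" "accept_prob U g \<gamma> x y \<le> 1"
  by (auto simp: accept_prob_def prop_dens_def)

end

context mala_potential
begin

text \<open>Both curvature bounds decrease in the radius, so on the annulus the upper one is worst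
  at \<open>r / 2\<close> and the lower one at \<open>3 * r / 2\<close>.\<close>

lemma far_curvature:
  assumes r: "2 * K \<le> r" "2 \<le> r" and z: "r / 2 \<le> norm z" "norm z \<le> 3 * r / 2"
  defines "\<Lambda> \<equiv> Lb / (1 + (r / 2) powr (3 * \<beta> / 4))" and "\<mu> \<equiv> m / (1 + (3 * r / 2) powr \<beta>)"
  shows "norm (H z) \<le> \<Lambda>" and "\<mu> * (norm h)\<^sup>2 \<le> H z h \<bullet> h"
proof -
  have z': "K \<le> norm z" "0 < norm z" using r z by auto
  have \<Lambda>: "0 \<le> \<Lambda>" using Lb by (simp add: \<Lambda>_def add_nonneg_nonneg)
  have up: "H z h \<bullet> h \<le> \<Lambda> * (norm h)\<^sup>2" for h
  proof -
    have "H z h \<bullet> h \<le> Lb / (1 + norm z powr (3 * \<beta> / 4)) * (norm h)\<^sup>2"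
      by (rule hess_form_bounds(1)[OF z'])
    also have "\<dots> \<le> \<Lambda> * (norm h)\<^sup>2"
      unfolding \<Lambda>_def using Lb r z \<beta>
      by (intro mult_right_mono divide_left_mono add_left_mono powr_mono2) (auto intro!: mult_pos_pos add_pos_nonneg)
    finally show ?thesis .
  qed
  show "norm (H z) \<le> \<Lambda>"
    by (rule norm_blinfun_bound[OF \<Lambda>]) (rule psd_norm_le[OF hessian_sym hess_psd[OF z'] up])
  have "\<mu> * (norm h)\<^sup>2 \<le> m / (1 + norm z powr \<beta>) * (norm h)\<^sup>2"
    unfolding \<mu>_def using m r z \<beta>
    by (intro mult_right_mono divide_left_mono add_left_mono powr_mono2) (auto intro!: mult_pos_pos add_pos_nonneg)
  also have "\<dots> \<le> H z h \<bullet> h" by (rule hess_form_bounds(2)[OF z'])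
  finally show "\<mu> * (norm h)\<^sup>2 \<le> H z h \<bullet> h" .
qed

text \<open>This is where the exponent \<open>3 \<beta> / 4\<close> of the upper curvature bound is used.\<close>
lemma far_curvature_ratio:
  assumes r: "2 \<le> r"
  shows "(Lb / (1 + (r / 2) powr (3 * \<beta> / 4)))\<^sup>2 \<le> (4 * Lb\<^sup>2 / m) * (m / (1 + (3 * r / 2) powr \<beta>))"
proof -
  define t where "t = r / 2"
  have t: "1 \<le> t" using r by (simp add: t_def)
  define s where "s = t powr (3 * \<beta> / 4)"
  have s: "0 < s" using t by (simp add: s_def)
  have tb: "1 \<le> t powr \<beta>" using t \<beta> by (intro ge_one_powr_ge_zero) auto
  have "(3 * t) powr \<beta> = 3 powr \<beta> * t powr \<beta>" by (rule powr_mult)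
  also have "\<dots> \<le> 3 powr 1 * t powr \<beta>" using \<beta> by (intro mult_right_mono powr_mono) auto
  finally have "1 + (3 * t) powr \<beta> \<le> 4 * t powr \<beta>" using tb by simp
  \<comment> \<open>Squaring the upper bound doubles the exponent to \<open>3 * \<beta> / 2\<close>,
    which dominates \<beta>.\<close>
  also have "t powr \<beta> \<le> t powr (3 * \<beta> / 4 + 3 * \<beta> / 4)" using t \<beta> by (intro powr_mono) auto
  also have "\<dots> = s\<^sup>2" unfolding powr_add by (simp add: s_def power2_eq_square)
  also have "\<dots> \<le> (1 + s)\<^sup>2" using s by (intro power_mono) auto
  finally have le: "1 + (3 * t) powr \<beta> \<le> 4 * (1 + s)\<^sup>2" by simp
  have p: "0 < 1 + (3 * t) powr \<beta>" by (simp add: add_pos_nonneg)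
  have "Lb\<^sup>2 / (1 + s)\<^sup>2 = 4 * Lb\<^sup>2 / (4 * (1 + s)\<^sup>2)" by simp
  also have "\<dots> \<le> 4 * Lb\<^sup>2 / (1 + (3 * t) powr \<beta>)"
    using le p s by (intro divide_left_mono) auto
  finally show ?thesis using m by (simp add: power_divide s_def t_def)
qed

text \<open>Far out and for short moves, curvature along the segment makes the first term of the log
  ratio negative enough to absorb all terms in \<open>y - x\<close>. Otherwise |y - x|^2 is itself
  of order \<gamma> + |w|^2 and the global Lipschitz bounds suffice.\<close>

lemma rejection_bound:
  obtains C \<Gamma> where "0 \<le> C" "0 < \<Gamma>"
    "\<And>x y \<gamma>. 0 < \<gamma> \<Longrightarrow> \<gamma> \<le> \<Gamma> \<Longrightarrow>
      1 - accept_prob U g \<gamma> x y \<le> C * (\<gamma> + (norm (y - x + \<gamma> *\<^sub>R g x))\<^sup>2)"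
proof -
  define c where "c = 4 * Lb\<^sup>2 / m"
  have c: "0 \<le> c" using m by (simp add: c_def)
  define R where "R = max (2 * K) 2"
  \<comment> \<open>\<open>c\<close> is the constant of the far case;
    \<open>2 * L\<^sup>2 * R\<^sup>2\<close> and \<open>5 * L\<close> cover the coefficients of
    \<gamma> and |w|^2 in the remaining case.\<close>
  define C where "C = c + 2 * L\<^sup>2 * R\<^sup>2 + 5 * L"
  define \<Gamma> where "\<Gamma> = min (1 / (c + 1)) (1 / (4 * (L + 1)))"
  have C: "0 \<le> C" using c L_nonneg by (simp add: C_def)
  have \<Gamma>: "0 < \<Gamma>" using c L_nonneg by (simp add: \<Gamma>_def)
  show ?thesis
  proof (rule that[OF C \<Gamma>])
    fix x y :: 'a and \<gamma> :: real
    assume \<gamma>: "0 < \<gamma>" "\<gamma> \<le> \<Gamma>"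
    have \<gamma>c: "\<gamma> * c \<le> 1"
    proof -
      have "\<gamma> \<le> 1 / (c + 1)" using \<gamma> by (simp add: \<Gamma>_def)
      then have "\<gamma> * (c + 1) \<le> 1" using c by (simp add: field_simps)
      then show ?thesis using \<gamma> by (simp add: algebra_simps)
    qed
    have \<gamma>L: "\<gamma> * L \<le> 1 / 4"
    proof -
      have "\<gamma> \<le> 1 / (4 * (L + 1))" using \<gamma> by (simp add: \<Gamma>_def)
      then have "\<gamma> * (4 * (L + 1)) \<le> 1" using L_nonneg by (simp add: field_simps)
      then show ?thesis using \<gamma> by (simp add: algebra_simps)
    qed
    define h where "h = y - x"
    define w where "w = y - x + \<gamma> *\<^sub>R g x"
    define \<Delta> where "\<Delta> = g y - g x"
    define T where "T = U y - U x - g y \<bullet> h + (w \<bullet> \<Delta>) / 2 + \<gamma> / 4 * (norm \<Delta>)\<^sup>2"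
    have "T \<le> C * (\<gamma> + (norm w)\<^sup>2)"
    proof (cases "R \<le> norm x \<and> norm h \<le> norm x / 2")
      case True
      define r where "r = norm x"
      define \<Lambda> where "\<Lambda> = Lb / (1 + (r / 2) powr (3 * \<beta> / 4))"
      define \<mu> where "\<mu> = m / (1 + (3 * r / 2) powr \<beta>)"
      have r: "2 * K \<le> r" "2 \<le> r" using True by (auto simp: r_def R_def)
      have \<Lambda>0: "0 \<le> \<Lambda>" using Lb by (simp add: \<Lambda>_def add_nonneg_nonneg)
      have \<mu>0: "0 < \<mu>" using m by (simp add: \<mu>_def add_pos_nonneg)
      have ratio: "\<Lambda>\<^sup>2 \<le> c * \<mu>" using far_curvature_ratio[OF r(2)] by (simp add: \<Lambda>_def \<mu>_def c_def)
      have seg: "r / 2 \<le> norm (x + t *\<^sub>R h)" "norm (x + t *\<^sub>R h) \<le> 3 * r / 2" if "0 \<le> t" "t \<le> 1" for t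
      proof -
        have "norm (t *\<^sub>R h) \<le> r / 2"
          using that True mult_mono[of t 1 "norm h" "r / 2"] by (simp add: r_def)
        then show "r / 2 \<le> norm (x + t *\<^sub>R h)" "norm (x + t *\<^sub>R h) \<le> 3 * r / 2"
          using norm_triangle_ineq[of x "t *\<^sub>R h"] norm_diff_ineq[of x "t *\<^sub>R h"] by (auto simp: r_def)
      qed
      have \<Delta>: "norm \<Delta> \<le> \<Lambda> * norm h"
        unfolding \<Delta>_def h_def
      proof (rule grad_diff_le)
        fix z assume "z \<in> closed_segment x y"
        then obtain t where "0 \<le> t" "t \<le> 1" "z = x + t *\<^sub>R h"
          by (auto simp: in_segment h_def algebra_simps)
        then show "norm (H z) \<le> \<Lambda>" using far_curvature(1)[OF r seg] by (simp add: \<Lambda>_def)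
      qed
      \<comment> \<open>The expansion is around \<open>y\<close>, since the log ratio contains the
        gradient there; convexity then enters with the favourable sign.\<close>
      obtain \<xi> where \<xi>: "0 < \<xi>" "\<xi> < 1"
        and tay: "U x = U y + g y \<bullet> (x - y) + (H (y + \<xi> *\<^sub>R (x - y)) (x - y) \<bullet> (x - y)) / 2"
        by (rule taylor2)
      have "y + \<xi> *\<^sub>R (x - y) = x + (1 - \<xi>) *\<^sub>R h" by (simp add: h_def algebra_simps)
      moreover have "0 \<le> 1 - \<xi>" "1 - \<xi> \<le> 1" using \<xi> by auto
      ultimately have "\<mu> * (norm (x - y))\<^sup>2 \<le> H (y + \<xi> *\<^sub>R (x - y)) (x - y) \<bullet> (x - y)"
        using far_curvature(2)[OF r seg, of "1 - \<xi>" "x - y"] by (simp add: \<mu>_def)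
      then have U: "U y - U x - g y \<bullet> h \<le> - (\<mu> / 2 * (norm h)\<^sup>2)"
        using tay by (simp add: h_def norm_minus_commute inner_diff_right)
      have "w \<bullet> \<Delta> \<le> norm w * (\<Lambda> * norm h)"
        using Cauchy_Schwarz_ineq2[of w \<Delta>] mult_left_mono[OF \<Delta>, of "norm w"] by simp
      also have "\<dots> \<le> c * (norm w)\<^sup>2 / 2 + \<mu> * (norm h)\<^sup>2 / 2"
      proof -
        \<comment> \<open>Young's inequality after multiplication by \<open>2 * \<mu>\<close>: \<mu>
          tends to zero at infinity if \<beta> > 0, and only
          \<open>\<Lambda>\<^sup>2 \<le> c * \<mu>\<close> keeps the coefficient of |w|^2
          bounded.\<close>
        have "2 * \<mu> * (norm w * (\<Lambda> * norm h)) = 2 * (\<Lambda> * norm w) * (\<mu> * norm h)" by simp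
        also have "\<dots> \<le> (\<Lambda> * norm w)\<^sup>2 + (\<mu> * norm h)\<^sup>2"
          using zero_le_power2[of "\<Lambda> * norm w - \<mu> * norm h"] by (simp add: power2_diff)
        also have "\<dots> = \<Lambda>\<^sup>2 * (norm w)\<^sup>2 + \<mu>\<^sup>2 * (norm h)\<^sup>2" by (simp add: power_mult_distrib)
        also have "\<dots> \<le> (c * \<mu>) * (norm w)\<^sup>2 + \<mu>\<^sup>2 * (norm h)\<^sup>2"
          using ratio by (intro add_right_mono mult_right_mono) auto
        also have "\<dots> = 2 * \<mu> * (c * (norm w)\<^sup>2 / 2 + \<mu> * (norm h)\<^sup>2 / 2)"
          by (simp add: algebra_simps power2_eq_square)
        finally show ?thesis using \<mu>0 by simp
      qed
      finally have W: "w \<bullet> \<Delta> \<le> c * (norm w)\<^sup>2 / 2 + \<mu> * (norm h)\<^sup>2 / 2" .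
      have "(norm \<Delta>)\<^sup>2 \<le> (\<Lambda> * norm h)\<^sup>2" using \<Delta> by (intro power_mono) auto
      also have "\<dots> \<le> c * \<mu> * (norm h)\<^sup>2"
        unfolding power_mult_distrib using ratio by (intro mult_right_mono) auto
      finally have "\<gamma> * (norm \<Delta>)\<^sup>2 \<le> \<gamma> * (c * \<mu> * (norm h)\<^sup>2)" using \<gamma> by (intro mult_left_mono) auto
      also have "\<dots> = (\<gamma> * c) * (\<mu> * (norm h)\<^sup>2)" by simp
      also have "\<dots> \<le> 1 * (\<mu> * (norm h)\<^sup>2)" using \<gamma>c \<mu>0 by (intro mult_right_mono) auto
      finally have D: "\<gamma> * (norm \<Delta>)\<^sup>2 \<le> \<mu> * (norm h)\<^sup>2" by simp
      have "0 \<le> c * (norm w)\<^sup>2" using c by simp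
      \<comment> \<open>The contributions \<open>- 1/2\<close>, \<open>1/4\<close> and
        \<open>1/4\<close> of \<open>\<mu> * (norm h)\<^sup>2\<close> from \<open>U\<close>,
        \<open>W\<close> and \<open>D\<close> cancel.\<close>
      then have "T \<le> c * (norm w)\<^sup>2" using U W D unfolding T_def by linarith
      also have "\<dots> \<le> C * (\<gamma> + (norm w)\<^sup>2)"
        using c \<gamma> L_nonneg by (intro mult_mono) (auto simp: C_def)
      finally show ?thesis .
    next
      case False
      have \<gamma>g: "norm (\<gamma> *\<^sub>R g x) \<le> \<gamma> * L * norm x"
        using norm_grad_le[of x] \<gamma> by (simp add: mult.assoc mult_left_mono)
      have hw: "h = w - \<gamma> *\<^sub>R g x" by (simp add: h_def w_def)
      have hle: "norm h \<le> norm w + \<gamma> * L * norm x"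
        unfolding hw using norm_triangle_ineq4[of w "\<gamma> *\<^sub>R g x"] \<gamma>g by simp
      have hn: "(norm h)\<^sup>2 \<le> 2 * \<gamma> * L * R\<^sup>2 + 4 * (norm w)\<^sup>2"
      proof (cases "norm x \<le> R")
        case True
        then have "\<gamma> * L * norm x \<le> \<gamma> * L * R" using \<gamma> L_nonneg by (intro mult_left_mono) auto
        then have "norm h \<le> norm w + \<gamma> * L * R" using hle by linarith
        then have "(norm h)\<^sup>2 \<le> (norm w + \<gamma> * L * R)\<^sup>2" by (intro power_mono) auto
        also have "\<dots> \<le> 2 * (norm w)\<^sup>2 + 2 * (\<gamma> * L * R)\<^sup>2"
          using zero_le_power2[of "norm w - \<gamma> * L * R"] by (simp add: power2_eq_square algebra_simps)
        also have "(\<gamma> * L * R)\<^sup>2 = (\<gamma> * L) * ((\<gamma> * L) * R\<^sup>2)" by (simp add: power2_eq_square)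
        also have "\<dots> \<le> 1 * ((\<gamma> * L) * R\<^sup>2)" using \<gamma>L \<gamma> L_nonneg by (intro mult_right_mono) auto
        finally show ?thesis by (simp add: mult_ac) (smt (verit) zero_le_power2)
      next
        case F: False
        \<comment> \<open>Here \<open>norm h\<close> exceeds \<open>norm x / 2\<close> while the
          gradient drift is at most \<open>norm x / 4\<close>, so at least half of the move is
          noise.\<close>
        have "\<gamma> * L * norm x \<le> 1 / 4 * norm x" using \<gamma>L by (intro mult_right_mono) auto
        with False F hle have "norm h \<le> 2 * norm w" by auto
        then have "(norm h)\<^sup>2 \<le> (2 * norm w)\<^sup>2" by (intro power_mono) auto
        then show ?thesis using \<gamma> L_nonneg by (simp add: power_mult_distrib add_increasing)
      qed
      have \<Delta>: "norm \<Delta> \<le> L * norm h" unfolding \<Delta>_def h_def by (rule grad_lipschitz)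
      have U: "U y - U x - g y \<bullet> h \<le> L / 2 * (norm h)\<^sup>2"
      proof -
        have "U y - U x - g y \<bullet> h = - (U x - U y - g y \<bullet> (x - y))" by (simp add: h_def inner_diff_right)
        also have "\<dots> \<le> \<bar>U x - U y - g y \<bullet> (x - y)\<bar>" by linarith
        also have "\<dots> \<le> L / 2 * (norm h)\<^sup>2"
          using descent[of x y] by (simp only: h_def norm_minus_commute)
        finally show ?thesis .
      qed
      have "w \<bullet> \<Delta> \<le> norm w * (L * norm h)"
        using Cauchy_Schwarz_ineq2[of w \<Delta>] mult_left_mono[OF \<Delta>, of "norm w"] by simp
      also have "\<dots> \<le> L * ((norm w)\<^sup>2 + (norm h)\<^sup>2) / 2"
        using mult_left_mono[OF zero_le_power2[of "norm w - norm h"] L_nonneg] by (simp add: power2_eq_square algebra_simps)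
      finally have W: "w \<bullet> \<Delta> \<le> L * ((norm w)\<^sup>2 + (norm h)\<^sup>2) / 2" .
      have "(norm \<Delta>)\<^sup>2 \<le> (L * norm h)\<^sup>2" using \<Delta> by (intro power_mono) auto
      then have "\<gamma> * (norm \<Delta>)\<^sup>2 \<le> \<gamma> * (L * norm h)\<^sup>2" using \<gamma> by (intro mult_left_mono) auto
      also have "\<dots> = (\<gamma> * L) * (L * (norm h)\<^sup>2)" by (simp add: power2_eq_square)
      also have "\<dots> \<le> 1 * (L * (norm h)\<^sup>2)" using \<gamma>L L_nonneg by (intro mult_right_mono) auto
      finally have D: "\<gamma> * (norm \<Delta>)\<^sup>2 \<le> L * (norm h)\<^sup>2" by simp
      have "T \<le> L * (norm w)\<^sup>2 / 4 + L * (norm h)\<^sup>2"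
        using U W D by (simp add: T_def algebra_simps)
      also have "\<dots> \<le> L * (norm w)\<^sup>2 / 4 + L * (2 * \<gamma> * L * R\<^sup>2 + 4 * (norm w)\<^sup>2)"
        using hn L_nonneg by (intro add_left_mono mult_left_mono) auto
      also have "\<dots> = (2 * L\<^sup>2 * R\<^sup>2) * \<gamma> + (17 / 4 * L) * (norm w)\<^sup>2"
        by (simp add: algebra_simps power2_eq_square)
      also have "\<dots> \<le> C * \<gamma> + C * (norm w)\<^sup>2"
        using c \<gamma> L_nonneg by (intro add_mono mult_right_mono) (auto simp: C_def)
      finally show ?thesis by (simp add: algebra_simps)
    qed
    then show "1 - accept_prob U g \<gamma> x y \<le> C * (\<gamma> + (norm (y - x + \<gamma> *\<^sub>R g x))\<^sup>2)"
      using C \<gamma> by (intro rejection_le_log_ratio) (auto simp: T_def h_def w_def \<Delta>_def)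
  qed
qed

end

section \<open>The MALA kernel\<close>

lemma prop_dens_eq_gauss: "prop_dens g \<gamma> x y = gauss (2 * \<gamma>) (x - \<gamma> *\<^sub>R g x) y"
  by (simp add: prop_dens_def gauss_def algebra_simps)

lemma prop_dens_nonneg [simp]: "0 \<le> prop_dens g \<gamma> x y"
  by (simp add: prop_dens_def)

lemma nn_integral_prop_dens:
  "0 < \<gamma> \<Longrightarrow> (\<integral>\<^sup>+y. ennreal (prop_dens g \<gamma> x y) \<partial>lborel) = 1"
  by (simp add: prop_dens_eq_gauss nn_integral_gauss)

context smooth_potential
begin

lemma measurable_U [measurable]: "U \<in> borel_measurable borel"
  by (rule borel_measurable_continuous_onI[OF continuous_U])

lemma measurable_g [measurable]: "g \<in> borel_measurable borel"
  by (rule borel_measurable_continuous_onI[OF continuous_g])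

lemma measurable_prop_dens [measurable]:
  "(\<lambda>p. prop_dens g \<gamma> (fst p) (snd p)) \<in> borel_measurable (borel \<Otimes>\<^sub>M borel)"
  "prop_dens g \<gamma> x \<in> borel_measurable borel"
  unfolding prop_dens_def by measurable

lemma measurable_prop_dens_swap [measurable]:
  "(\<lambda>p. prop_dens g \<gamma> (snd p) (fst p)) \<in> borel_measurable (borel \<Otimes>\<^sub>M borel)"
  "(\<lambda>x. prop_dens g \<gamma> x y) \<in> borel_measurable borel"
  unfolding prop_dens_def by measurable

lemma measurable_accept_prob [measurable]:
  "(\<lambda>p. accept_prob U g \<gamma> (fst p) (snd p)) \<in> borel_measurable (borel \<Otimes>\<^sub>M borel)"
  "accept_prob U g \<gamma> x \<in> borel_measurable borel"
  unfolding accept_prob_def by measurable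

definition accept_step :: "real \<Rightarrow> 'a \<Rightarrow> 'a \<Rightarrow> 'a measure" where
  "accept_step \<gamma> x y = measure_pmf (bernoulli_pmf (accept_prob U g \<gamma> x y))
     \<bind> (\<lambda>b. return borel (if b then y else x))"

lemma nn_integral_accept_step:
  assumes [measurable]: "f \<in> borel_measurable borel"
  shows "(\<integral>\<^sup>+z. f z \<partial>accept_step \<gamma> x y)
    = f y * ennreal (accept_prob U g \<gamma> x y) + f x * ennreal (1 - accept_prob U g \<gamma> x y)"
proof -
  have "(\<integral>\<^sup>+z. f z \<partial>accept_step \<gamma> x y)
      = (\<integral>\<^sup>+b. \<integral>\<^sup>+z. f z \<partial>return borel (if b then y else x) \<partial>measure_pmf (bernoulli_pmf (accept_prob U g \<gamma> x y)))"
    unfolding accept_step_def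
    by (rule nn_integral_bind[where B=borel]) (auto intro: measurable_space[OF return_measurable])
  then show ?thesis
    by (simp add: nn_integral_return nn_integral_bernoulli_pmf accept_prob_bounds)
qed

lemma sets_accept_step [simp]: "sets (accept_step \<gamma> x y) = sets borel"
  unfolding accept_step_def by (rule sets_bind) auto

lemma prob_space_accept_step: "prob_space (accept_step \<gamma> x y)"
proof
  have sp: "space (accept_step \<gamma> x y) = UNIV"
    using sets_eq_imp_space_eq[OF sets_accept_step] by simp
  have "emeasure (accept_step \<gamma> x y) UNIV = (\<integral>\<^sup>+z. indicator UNIV z \<partial>accept_step \<gamma> x y)"
    by (rule nn_integral_indicator[symmetric]) simp
  also have "\<dots> = ennreal (accept_prob U g \<gamma> x y) + ennreal (1 - accept_prob U g \<gamma> x y)"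
    by (subst nn_integral_accept_step) auto
  also have "\<dots> = 1" by (simp add: accept_prob_bounds flip: ennreal_plus)
  finally show "emeasure (accept_step \<gamma> x y) (space (accept_step \<gamma> x y)) = 1" by (simp add: sp)
qed

lemma measurable_accept_step: "accept_step \<gamma> x \<in> borel \<rightarrow>\<^sub>M subprob_algebra borel"
proof (rule measurable_subprob_algebra)
  fix A :: "'a set" assume [measurable]: "A \<in> sets borel"
  have "emeasure (accept_step \<gamma> x y) A = indicator A y * ennreal (accept_prob U g \<gamma> x y)
      + indicator A x * ennreal (1 - accept_prob U g \<gamma> x y)" for y
    using nn_integral_accept_step[of "indicator A" \<gamma> x y] by simp
  then show "(\<lambda>y. emeasure (accept_step \<gamma> x y) A) \<in> borel_measurable borel" by simp
qed (auto intro: prob_space_imp_subprob_space prob_space_accept_step)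

lemma mala_kernel_eq:
  "mala_kernel U g \<gamma> x = density lborel (\<lambda>y. ennreal (prop_dens g \<gamma> x y)) \<bind> accept_step \<gamma> x"
  by (simp add: mala_kernel_def accept_step_def[abs_def])

text \<open>Identifies the \<open>bind\<close> encoding with the textbook kernel. Total mass,
  measurability, invariance, drift and minorization are read off from this formula.\<close>

lemma nn_integral_mala_kernel:
  assumes [measurable]: "f \<in> borel_measurable borel"
  shows "(\<integral>\<^sup>+z. f z \<partial>mala_kernel U g \<gamma> x) = (\<integral>\<^sup>+y. ennreal (prop_dens g \<gamma> x y) *
    (f y * ennreal (accept_prob U g \<gamma> x y) + f x * ennreal (1 - accept_prob U g \<gamma> x y)) \<partial>lborel)"
proof -
  have "(\<integral>\<^sup>+z. f z \<partial>mala_kernel U g \<gamma> x) = (\<integral>\<^sup>+y. \<integral>\<^sup>+z. f z \<partial>accept_step \<gamma> x y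
      \<partial>density lborel (\<lambda>y. ennreal (prop_dens g \<gamma> x y)))"
    unfolding mala_kernel_eq
    by (rule nn_integral_bind[where B=borel]) (use measurable_accept_step in \<open>auto cong: measurable_cong_sets\<close>)
  also have "\<dots> = (\<integral>\<^sup>+y. ennreal (prop_dens g \<gamma> x y) * (\<integral>\<^sup>+z. f z \<partial>accept_step \<gamma> x y) \<partial>lborel)"
    by (rule nn_integral_density) (auto simp: nn_integral_accept_step)
  finally show ?thesis by (simp add: nn_integral_accept_step)
qed

lemma sets_mala_kernel [simp]: "sets (mala_kernel U g \<gamma> x) = sets borel"
  unfolding mala_kernel_eq by (rule sets_bind) auto

lemma prob_space_mala_kernel:
  assumes \<gamma>: "0 < \<gamma>"
  shows "prob_space (mala_kernel U g \<gamma> x)"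
proof
  have sp: "space (mala_kernel U g \<gamma> x) = UNIV"
    using sets_eq_imp_space_eq[OF sets_mala_kernel] by simp
  have "emeasure (mala_kernel U g \<gamma> x) UNIV = (\<integral>\<^sup>+z. indicator UNIV z \<partial>mala_kernel U g \<gamma> x)"
    by (rule nn_integral_indicator[symmetric]) simp
  also have "\<dots> = (\<integral>\<^sup>+y. ennreal (prop_dens g \<gamma> x y) \<partial>lborel)"
    by (subst nn_integral_mala_kernel) (auto simp: accept_prob_bounds simp flip: ennreal_plus)
  also have "\<dots> = 1" by (rule nn_integral_prop_dens[OF \<gamma>])
  finally show "emeasure (mala_kernel U g \<gamma> x) (space (mala_kernel U g \<gamma> x)) = 1" by (simp add: sp)
qed

lemma measurable_mala_kernel [measurable]:
  assumes \<gamma>: "0 < \<gamma>"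
  shows "mala_kernel U g \<gamma> \<in> borel \<rightarrow>\<^sub>M prob_algebra borel"
proof (rule measurable_prob_algebraI)
  show "mala_kernel U g \<gamma> \<in> borel \<rightarrow>\<^sub>M subprob_algebra borel"
  proof (rule measurable_subprob_algebra)
    fix A :: "'a set" assume A [measurable]: "A \<in> sets borel"
    have "emeasure (mala_kernel U g \<gamma> x) A = (\<integral>\<^sup>+y. ennreal (prop_dens g \<gamma> x y) *
      (indicator A y * ennreal (accept_prob U g \<gamma> x y) + indicator A x * ennreal (1 - accept_prob U g \<gamma> x y)) \<partial>lborel)" for x
      using nn_integral_mala_kernel[of "indicator A" \<gamma> x] by simp
    then show "(\<lambda>x. emeasure (mala_kernel U g \<gamma> x) A) \<in> borel_measurable borel"
      by (simp only:) measurable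
  qed (auto intro: prob_space_imp_subprob_space prob_space_mala_kernel[OF \<gamma>])
qed (rule prob_space_mala_kernel[OF \<gamma>])

lemma mala_iter_eq_kiter: "mala_iter U g \<gamma> k x = kiter borel (mala_kernel U g \<gamma>) k x"
  by (simp add: mala_iter_def kiter_def)

text \<open>The right side is symmetric in \<open>x\<close> and \<open>y\<close>, which is
  reversibility. The minimum is also what lets a symmetric lower bound pass to the accepted
  density.\<close>

lemma detailed_balance:
  assumes \<gamma>: "0 < \<gamma>"
  shows "exp (- U x) * prop_dens g \<gamma> x y * accept_prob U g \<gamma> x y
    = min (exp (- U x) * prop_dens g \<gamma> x y) (exp (- U y) * prop_dens g \<gamma> y x)"
proof -
  have "0 < exp (- U x) * prop_dens g \<gamma> x y" using \<gamma> by (simp add: prop_dens_def)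
  then show ?thesis by (auto simp: accept_prob_def min_def field_simps)
qed

text \<open>The accepted flow \<open>s\<close> is symmetric, so Fubini moves \<open>f\<close> from
  \<open>y\<close> to \<open>x\<close>; there it recombines with the rejected flow \<open>t\<close>,
  and \<open>s + t\<close> integrates to \<open>exp (- U x)\<close>.\<close>

lemma nn_integral_mala_invariant:
  assumes \<gamma>: "0 < \<gamma>" and f [measurable]: "f \<in> borel_measurable borel"
  shows "(\<integral>\<^sup>+x. ennreal (exp (- U x)) * (\<integral>\<^sup>+y. f y \<partial>mala_kernel U g \<gamma> x) \<partial>lborel)
    = (\<integral>\<^sup>+x. ennreal (exp (- U x)) * f x \<partial>lborel)"
proof -
  define s where "s = (\<lambda>x y. ennreal (min (exp (- U x) * prop_dens g \<gamma> x y) (exp (- U y) * prop_dens g \<gamma> y x)))"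
  define t where "t = (\<lambda>x y. ennreal (exp (- U x) * prop_dens g \<gamma> x y * (1 - accept_prob U g \<gamma> x y)))"
  have [measurable]: "(\<lambda>p. s (fst p) (snd p)) \<in> borel_measurable (borel \<Otimes>\<^sub>M borel)"
    "(\<lambda>p. t (fst p) (snd p)) \<in> borel_measurable (borel \<Otimes>\<^sub>M borel)"
    unfolding s_def t_def by measurable
  have [measurable]: "(\<lambda>p. s (snd p) (fst p)) \<in> borel_measurable (borel \<Otimes>\<^sub>M borel)"
    unfolding s_def by measurable
  have [measurable]: "f \<in> borel_measurable lborel" using f by simp
  have [measurable]: "s x \<in> borel_measurable borel" "t x \<in> borel_measurable borel"
    "(\<lambda>x. s x y) \<in> borel_measurable borel" for x y
    unfolding s_def t_def by measurable
  have s_sym: "s x y = s y x" for x y by (simp add: s_def min.commute)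
  have s_eq: "s x y = ennreal (exp (- U x) * prop_dens g \<gamma> x y * accept_prob U g \<gamma> x y)" for x y
    by (simp only: s_def detailed_balance[OF \<gamma>])
  have st: "s x y + t x y = ennreal (exp (- U x)) * ennreal (prop_dens g \<gamma> x y)" for x y
    unfolding s_eq t_def ennreal_mult[OF exp_ge_zero prop_dens_nonneg, symmetric]
    by (subst ennreal_plus[symmetric]) (auto simp: accept_prob_bounds algebra_simps intro!: mult_left_le)
  have "(\<integral>\<^sup>+x. ennreal (exp (- U x)) * (\<integral>\<^sup>+y. f y \<partial>mala_kernel U g \<gamma> x) \<partial>lborel)
      = (\<integral>\<^sup>+x. (\<integral>\<^sup>+y. s x y * f y \<partial>lborel) + (\<integral>\<^sup>+y. t x y * f x \<partial>lborel) \<partial>lborel)"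
  proof (rule nn_integral_cong)
    fix x
    have "ennreal (exp (- U x)) * (\<integral>\<^sup>+y. f y \<partial>mala_kernel U g \<gamma> x)
      = (\<integral>\<^sup>+y. ennreal (exp (- U x)) * (ennreal (prop_dens g \<gamma> x y) *
          (f y * ennreal (accept_prob U g \<gamma> x y) + f x * ennreal (1 - accept_prob U g \<gamma> x y))) \<partial>lborel)"
      by (subst nn_integral_cmult) (simp_all add: nn_integral_mala_kernel)
    also have "\<dots> = (\<integral>\<^sup>+y. s x y * f y + t x y * f x \<partial>lborel)"
      unfolding s_eq t_def
      by (intro nn_integral_cong) (simp add: ennreal_mult accept_prob_bounds distrib_left mult_ac)
    also have "\<dots> = (\<integral>\<^sup>+y. s x y * f y \<partial>lborel) + (\<integral>\<^sup>+y. t x y * f x \<partial>lborel)"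
      by (rule nn_integral_add) auto
    finally show "ennreal (exp (- U x)) * (\<integral>\<^sup>+y. f y \<partial>mala_kernel U g \<gamma> x) = \<dots>" .
  qed
  also have "\<dots> = (\<integral>\<^sup>+x. \<integral>\<^sup>+y. s x y * f y \<partial>lborel \<partial>lborel) + (\<integral>\<^sup>+x. \<integral>\<^sup>+y. t x y * f x \<partial>lborel \<partial>lborel)"
    by (rule nn_integral_add) measurable
  also have "(\<integral>\<^sup>+x. \<integral>\<^sup>+y. s x y * f y \<partial>lborel \<partial>lborel) = (\<integral>\<^sup>+y. \<integral>\<^sup>+x. s x y * f y \<partial>lborel \<partial>lborel)"
    by (rule lborel_pair.Fubini') measurable
  also have "\<dots> = (\<integral>\<^sup>+x. \<integral>\<^sup>+y. s x y * f x \<partial>lborel \<partial>lborel)"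
    by (subst s_sym) simp
  also have "\<dots> + (\<integral>\<^sup>+x. \<integral>\<^sup>+y. t x y * f x \<partial>lborel \<partial>lborel)
      = (\<integral>\<^sup>+x. (\<integral>\<^sup>+y. s x y * f x \<partial>lborel) + (\<integral>\<^sup>+y. t x y * f x \<partial>lborel) \<partial>lborel)"
    by (rule nn_integral_add[symmetric]) measurable
  also have "\<dots> = (\<integral>\<^sup>+x. ennreal (exp (- U x)) * f x \<partial>lborel)"
  proof (rule nn_integral_cong)
    fix x
    have "(\<integral>\<^sup>+y. s x y * f x \<partial>lborel) + (\<integral>\<^sup>+y. t x y * f x \<partial>lborel) = (\<integral>\<^sup>+y. s x y * f x + t x y * f x \<partial>lborel)"
      by (rule nn_integral_add[symmetric]) auto
    also have "\<dots> = (\<integral>\<^sup>+y. (ennreal (exp (- U x)) * f x) * ennreal (prop_dens g \<gamma> x y) \<partial>lborel)"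
      by (simp only: distrib_right[symmetric] st) (simp only: mult_ac)
    also have "\<dots> = ennreal (exp (- U x)) * f x"
      by (simp add: nn_integral_cmult nn_integral_prop_dens[OF \<gamma>])
    finally show "(\<integral>\<^sup>+y. s x y * f x \<partial>lborel) + (\<integral>\<^sup>+y. t x y * f x \<partial>lborel) = ennreal (exp (- U x)) * f x" .
  qed
  finally show ?thesis .
qed

end

section \<open>Gaussian minorization of the MALA kernel\<close>

text \<open>Used to bound powers of \<open>1 - c \<gamma>\<close> from below by exponentials that
  stay bounded while \<open>\<gamma> k\<close> does.\<close>

lemma one_minus_ge_exp:
  fixes u :: real
  assumes "0 \<le> u" "u \<le> 1 / 2"
  shows "exp (- 2 * u) \<le> 1 - u"
proof -
  have "1 \<le> (1 + 2 * u) * (1 - u)" using assms mult_left_mono[OF assms(2,1)] by (simp add: algebra_simps)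
  also have "\<dots> \<le> exp (2 * u) * (1 - u)"
    using exp_ge_add_one_self[of "2 * u"] assms by (intro mult_right_mono) auto
  finally have "exp (- 2 * u) * 1 \<le> exp (- 2 * u) * (exp (2 * u) * (1 - u))" by (intro mult_left_mono) auto
  also have "\<dots> = 1 - u" by (simp add: mult.assoc[symmetric] exp_add[symmetric])
  finally show ?thesis by simp
qed

text \<open>The Ornstein--Uhlenbeck type chain with one-step law \<open>gauss s (a x)\<close> that bounds the MALA kernel
  from below, up to the factor \<open>\<theta> powr (d / 2)\<close> and a Doob transform by \<open>weight\<close>.\<close>
locale mala_minorization = smooth_potential +
  fixes \<gamma> :: real
  assumes \<gamma>: "0 < \<gamma>" and small: "2 * (L + 1) * \<gamma> \<le> 1 / 8"
begin

text \<open>\<open>c\<close> must dominate \<open>L\<close> in both parts of the symmetric exponent: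
  in the coefficient of |y - x|^2 and, through \<open>(1 - a)\<^sup>2\<close>, in that of |x|^2 +
  |y|^2.\<close>

definition c :: real where "c = 2 * (L + 1)"
definition a :: real where "a = 1 - c * \<gamma>"
text \<open>Determined by \<open>a / s = 1 / (2 * \<gamma>) + c / 2\<close>, with variance
  \<open>s\<close> slightly below the proposal variance \<open>2 * \<gamma>\<close>; \<theta> is
  their ratio.\<close>

definition \<theta> :: real where "\<theta> = (1 - c * \<gamma>) / (1 + c * \<gamma>)"
definition s :: real where "s = 2 * \<gamma> * \<theta>"
text \<open>With this value the factor
  \<open>exp (\<kappa> * ((norm y)\<^sup>2 - (norm x)\<^sup>2) / 2)\<close> makes the autoregressive
  kernel symmetric in \<open>x\<close> and \<open>y\<close>.\<close>

definition \<kappa> :: real where "\<kappa> = (1 - a\<^sup>2) / (2 * s)"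
text \<open>Ratio of the normalizing constants for the variances \<open>2 * \<gamma>\<close> and
  \<open>s\<close>: the loss per step.\<close>

definition q :: real where "q = \<theta> powr (real DIM('a) / 2)"
text \<open>Variance of the autoregressive chain after \<open>k\<close> steps.\<close>

definition var :: "nat \<Rightarrow> real" where "var k = s * (\<Sum>j<k. (a\<^sup>2) ^ j)"
text \<open>The Doob function: \<open>exp (U x / 2)\<close> converts between the target and the
  symmetric kernel, and the quadratic part undoes the symmetrization by \<kappa>.\<close>

definition weight :: "'a \<Rightarrow> real" where "weight x = exp (U x / 2 - \<kappa> * (norm x)\<^sup>2 / 2)"

lemma c_pos: "0 < c" "L \<le> c" "2 \<le> c"
  using L_nonneg by (auto simp: c_def)

lemma c\<gamma>: "0 < c * \<gamma>" "c * \<gamma> \<le> 1 / 8"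
  using \<gamma> small c_pos by (auto simp: c_def)

text \<open>The first bound keeps \<open>q ^ k\<close> away from zero while
  \<open>\<gamma> k\<close> is bounded.\<close>

lemma \<theta>_bounds: "exp (- 4 * (c * \<gamma>)) \<le> \<theta>" "1 / 2 \<le> \<theta>" "\<theta> \<le> 1"
proof -
  have p: "0 < 1 + c * \<gamma>" using c\<gamma> by simp
  have "exp (- 2 * (c * \<gamma>)) * exp (- 2 * (c * \<gamma>)) \<le> (1 - c * \<gamma>) * (1 - c * \<gamma>)"
    using one_minus_ge_exp[of "c * \<gamma>"] c\<gamma> by (intro mult_mono) auto
  also have "\<dots> \<le> \<theta>"
  proof -
    have "(1 - c * \<gamma>) * (1 - c * \<gamma>) * (1 + c * \<gamma>) = (1 - c * \<gamma>) * (1 - (c * \<gamma>)\<^sup>2)"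
      by (simp add: algebra_simps power2_eq_square)
    also have "\<dots> \<le> (1 - c * \<gamma>) * 1" using c\<gamma> by (intro mult_left_mono) auto
    finally show ?thesis unfolding \<theta>_def using p by (simp add: pos_le_divide_eq)
  qed
  also have "exp (- 2 * u) * exp (- 2 * u) = exp (- 4 * u)" for u :: real by (simp flip: exp_add)
  finally show "exp (- 4 * (c * \<gamma>)) \<le> \<theta>" .
  have "1 / 2 \<le> (1 - u) / (1 + u)" "(1 - u) / (1 + u) \<le> 1" if "0 < u" "u \<le> 1 / 8" for u :: real
    using that by (simp_all add: divide_simps)
  then show "1 / 2 \<le> \<theta>" "\<theta> \<le> 1" unfolding \<theta>_def using c\<gamma> by blast+
qed

lemma s_bounds: "\<gamma> \<le> s" "s \<le> 2 * \<gamma>" "0 < s"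
  using \<theta>_bounds \<gamma> mult_left_mono[of "1/2" \<theta> "2 * \<gamma>"] mult_left_mono[of \<theta> 1 "2 * \<gamma>"] by (auto simp: s_def)

lemma a_bounds: "0 < a" "a < 1"
  using c\<gamma> by (auto simp: a_def)

text \<open>\<open>1 - a\<^sup>2\<close> and \<open>s\<close> are both of order \<gamma>, so
  \<kappa> and with it the ratio of weights on a ball stay bounded as \<gamma> tends to
  zero.\<close>

lemma \<kappa>_bounds: "0 \<le> \<kappa>" "\<kappa> \<le> c"
proof -
  have "1 - a\<^sup>2 = 2 * (c * \<gamma>) - (c * \<gamma>)\<^sup>2" by (simp add: a_def power2_eq_square algebra_simps)
  moreover have "(c * \<gamma>)\<^sup>2 \<le> c * \<gamma>"
    unfolding power2_eq_square using c\<gamma> by (intro mult_left_le) auto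
  ultimately have 1: "0 \<le> 1 - a\<^sup>2" "1 - a\<^sup>2 \<le> 2 * (c * \<gamma>)" using c\<gamma> by auto
  then show "0 \<le> \<kappa>" using s_bounds by (simp add: \<kappa>_def)
  have "1 - a\<^sup>2 \<le> c * (2 * s)" using 1(2) mult_left_mono[OF s_bounds(1), of c] c_pos(1) by linarith
  then show "\<kappa> \<le> c" using s_bounds by (simp add: \<kappa>_def pos_divide_le_eq)
qed

lemma q_pos: "0 < q"
  using \<theta>_bounds by (simp add: q_def)

lemma measurable_weight [measurable]: "weight \<in> borel_measurable borel"
  unfolding weight_def by measurable

lemma weight_pos: "0 < weight x"
  by (simp add: weight_def)

text \<open>The exponent on the left equals -(a / s) / 2 |y - x|^2 - (1 - a)^2 / (4 s) (|x|^2 +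
  |y|^2), and each coefficient dominates its counterpart on the right. The common factor in
  \<open>U\<close> is kept for chaining with \<open>prop_dens_ge\<close>.\<close>

lemma target_prop_dens_ge:
  "exp (- (U x + U y) / 2) * (q * (exp (\<kappa> * ((norm y)\<^sup>2 - (norm x)\<^sup>2) / 2) * gauss s (a *\<^sub>R x) y))
    \<le> exp (- (U x + U y) / 2) * ((4 * pi * \<gamma>) powr (- real DIM('a) / 2) *
       exp (- (1 / (4 * \<gamma>) + L / 4) * (norm (y - x))\<^sup>2 - \<gamma> * L\<^sup>2 / 4 * ((norm x)\<^sup>2 + (norm y)\<^sup>2)))"
    (is "_ * (q * (exp ?k * _)) \<le> _ * (?D * exp ?e)")
proof (intro mult_left_mono)
  have pos: "0 < 1 + c * \<gamma>" "0 < \<theta>" using c\<gamma> \<theta>_bounds by auto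
  have b: "a / s = 1 / (2 * \<gamma>) + c / 2"
  proof -
    have "a / s = (1 + c * \<gamma>) / (2 * \<gamma>)"
      using c\<gamma> \<gamma> pos by (simp add: s_def a_def \<theta>_def)
    then show ?thesis using \<gamma> by (simp add: field_simps)
  qed
  have "(4 * pi * \<gamma>) = (2 * pi * s) / \<theta>" using pos by (simp add: s_def)
  then have D: "?D = q * (2 * pi * s) powr (- real DIM('a) / 2)"
    using pos s_bounds by (simp add: powr_divide q_def powr_minus_divide)
  define X Y P where "X = (norm x)\<^sup>2" and "Y = (norm y)\<^sup>2" and "P = x \<bullet> y"
  have yx: "(norm (y - x))\<^sup>2 = X + Y - 2 * P"
    "(norm (y - a *\<^sub>R x))\<^sup>2 = a\<^sup>2 * X + Y - 2 * a * P"
    unfolding X_def Y_def P_def power2_norm_eq_inner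
    by (simp_all add: inner_diff inner_commute algebra_simps power2_eq_square)
  have XY: "0 \<le> X + Y" by (simp add: X_def Y_def)
  have XYP: "0 \<le> X + Y - 2 * P" using zero_le_power2[of "norm (y - x)"] unfolding yx .
  have "?k + - (norm (y - a *\<^sub>R x))\<^sup>2 / (2 * s)
      = - ((a / s) / 2 * (X + Y - 2 * P)) - (1 - a)\<^sup>2 / (4 * s) * (X + Y)"
    unfolding yx X_def[symmetric] Y_def[symmetric] \<kappa>_def using s_bounds
    by (simp add: field_simps power2_eq_square)
  also have "\<dots> \<le> - (1 / (4 * \<gamma>) + L / 4) * (X + Y - 2 * P) - \<gamma> * L\<^sup>2 / 4 * (X + Y)"
  proof -
    have "(1 / (4 * \<gamma>) + L / 4) * (X + Y - 2 * P) \<le> ((a / s) / 2) * (X + Y - 2 * P)"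
      unfolding b using XYP c_pos by (intro mult_right_mono) auto
    moreover have "\<gamma> * L\<^sup>2 / 4 * (X + Y) \<le> (1 - a)\<^sup>2 / (4 * s) * (X + Y)"
    proof (rule mult_right_mono[OF _ XY])
      have "s * L\<^sup>2 \<le> (2 * \<gamma>) * (c / 2)\<^sup>2"
        using s_bounds L_nonneg by (intro mult_mono power_mono) (auto simp: c_def)
      also have "\<dots> \<le> \<gamma> * c\<^sup>2" using \<gamma> by (simp add: power_divide)
      finally have "\<gamma> * (s * L\<^sup>2) \<le> \<gamma> * (\<gamma> * c\<^sup>2)" using \<gamma> by (intro mult_left_mono) auto
      also have "\<dots> = (1 - a)\<^sup>2" by (simp add: a_def power2_eq_square)
      finally show "\<gamma> * L\<^sup>2 / 4 \<le> (1 - a)\<^sup>2 / (4 * s)" using s_bounds by (simp add: pos_le_divide_eq mult_ac)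
    qed
    ultimately show ?thesis unfolding minus_mult_left[symmetric] by linarith
  qed
  also have "\<dots> = ?e" by (simp only: yx X_def Y_def)
  finally have "exp (?k + - (norm (y - a *\<^sub>R x))\<^sup>2 / (2 * s)) \<le> exp ?e" by simp
  then have e: "exp ?k * exp (- (norm (y - a *\<^sub>R x))\<^sup>2 / (2 * s)) \<le> exp ?e" by (simp only: exp_add)
  have "q * (exp ?k * gauss s (a *\<^sub>R x) y) = ?D * (exp ?k * exp (- (norm (y - a *\<^sub>R x))\<^sup>2 / (2 * s)))"
    unfolding gauss_def D by (simp only: mult_ac)
  also have "\<dots> \<le> ?D * exp ?e" by (rule mult_left_mono[OF e]) simp
  finally show "q * (exp ?k * gauss s (a *\<^sub>R x) y) \<le> ?D * exp ?e" .
qed simp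

text \<open>By the descent inequality \<open>- g x \<bullet> (y - x) / 2\<close> is \<open>(U x - U y) / 2\<close> up to \<open>L / 4 * norm (y - x) ^ 2\<close>,
  so the lower bound for \<open>exp (- U x) * prop_dens g \<gamma> x y\<close> is symmetric in \<open>x\<close> and \<open>y\<close> and survives the minimum
  in the Metropolis ratio.\<close>
lemma prop_dens_ge:
  "exp (- (U x + U y) / 2) * ((4 * pi * \<gamma>) powr (- real DIM('a) / 2) *
       exp (- (1 / (4 * \<gamma>) + L / 4) * (norm (y - x))\<^sup>2 - \<gamma> * L\<^sup>2 / 4 * ((norm x)\<^sup>2 + (norm y)\<^sup>2)))
    \<le> exp (- U x) * prop_dens g \<gamma> x y"
proof -
  define h where "h = y - x"
  have "(norm (h + \<gamma> *\<^sub>R g x))\<^sup>2 = (norm h)\<^sup>2 + 2 * \<gamma> * (g x \<bullet> h) + \<gamma>\<^sup>2 * (norm (g x))\<^sup>2"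
    unfolding power2_norm_eq_inner
    by (simp add: inner_add inner_commute algebra_simps power2_eq_square)
  then have "- U x + - (norm (h + \<gamma> *\<^sub>R g x))\<^sup>2 / (4 * \<gamma>)
      = - U x - (norm h)\<^sup>2 / (4 * \<gamma>) - (g x \<bullet> h) / 2 - \<gamma> / 4 * (norm (g x))\<^sup>2"
    using \<gamma> by (simp add: field_simps power2_eq_square)
  moreover have "- (U y - U x) / 2 - L / 4 * (norm h)\<^sup>2 \<le> - (g x \<bullet> h) / 2"
  proof -
    have "- (U y - U x - g x \<bullet> h) \<le> L / 2 * (norm h)\<^sup>2"
      using descent[of y x] unfolding h_def[symmetric] by (rule abs_le_D2)
    then show ?thesis by (simp add: field_simps)
  qed
  moreover have "\<gamma> / 4 * (norm (g x))\<^sup>2 \<le> \<gamma> * L\<^sup>2 / 4 * ((norm x)\<^sup>2 + (norm y)\<^sup>2)"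
  proof -
    have "(norm (g x))\<^sup>2 \<le> L\<^sup>2 * (norm x)\<^sup>2"
      using power_mono[OF norm_grad_le[of x] norm_ge_zero, of 2] by (simp add: power_mult_distrib)
    also have "\<dots> \<le> L\<^sup>2 * ((norm x)\<^sup>2 + (norm y)\<^sup>2)" by (intro mult_left_mono) auto
    finally have "\<gamma> / 4 * (norm (g x))\<^sup>2 \<le> \<gamma> / 4 * (L\<^sup>2 * ((norm x)\<^sup>2 + (norm y)\<^sup>2))"
      using \<gamma> by (intro mult_left_mono) auto
    then show ?thesis by simp
  qed
  ultimately have "- (U x + U y) / 2 + (- (1 / (4 * \<gamma>) + L / 4) * (norm h)\<^sup>2 - \<gamma> * L\<^sup>2 / 4 * ((norm x)\<^sup>2 + (norm y)\<^sup>2))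
      \<le> - U x + - (norm (h + \<gamma> *\<^sub>R g x))\<^sup>2 / (4 * \<gamma>)"
    by (simp add: algebra_simps add_divide_distrib diff_divide_distrib)
  then have e: "exp (- (U x + U y) / 2) * exp (- (1 / (4 * \<gamma>) + L / 4) * (norm h)\<^sup>2 - \<gamma> * L\<^sup>2 / 4 * ((norm x)\<^sup>2 + (norm y)\<^sup>2))
      \<le> exp (- U x) * exp (- (norm (h + \<gamma> *\<^sub>R g x))\<^sup>2 / (4 * \<gamma>))"
    unfolding exp_add[symmetric] by simp
  show ?thesis
    using mult_left_mono[OF e, of "(4 * pi * \<gamma>) powr (- real DIM('a) / 2)"]
    by (simp add: prop_dens_def h_def mult_ac)
qed

text \<open>By \<open>detailed_balance\<close> a bound symmetric in \<open>x\<close> and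
  \<open>y\<close> survives the acceptance step. The factors in \<open>U\<close> and \<kappa> are
  collected as \<open>weight x / weight y\<close> because this form telescopes under
  iteration.\<close>

lemma accept_dens_ge:
  "q * weight x * (gauss s (a *\<^sub>R x) y / weight y) \<le> prop_dens g \<gamma> x y * accept_prob U g \<gamma> x y"
proof -
  define m where "m = exp (- (U x + U y) / 2) * ((4 * pi * \<gamma>) powr (- real DIM('a) / 2) *
       exp (- (1 / (4 * \<gamma>) + L / 4) * (norm (y - x))\<^sup>2 - \<gamma> * L\<^sup>2 / 4 * ((norm x)\<^sup>2 + (norm y)\<^sup>2)))"
  have "m \<le> exp (- U y) * prop_dens g \<gamma> y x"
    using prop_dens_ge[of y x] by (simp add: m_def norm_minus_commute[of x y] add.commute)
  moreover have "m \<le> exp (- U x) * prop_dens g \<gamma> x y"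
    using prop_dens_ge[of x y] by (simp add: m_def)
  ultimately have "m \<le> exp (- U x) * prop_dens g \<gamma> x y * accept_prob U g \<gamma> x y"
    unfolding detailed_balance[OF \<gamma>] by simp
  moreover have "exp (- (U x + U y) / 2) * (q * (exp (\<kappa> * ((norm y)\<^sup>2 - (norm x)\<^sup>2) / 2) * gauss s (a *\<^sub>R x) y)) \<le> m"
    unfolding m_def by (rule target_prop_dens_ge)
  ultimately have "exp (- (U x + U y) / 2) * (q * (exp (\<kappa> * ((norm y)\<^sup>2 - (norm x)\<^sup>2) / 2) * gauss s (a *\<^sub>R x) y))
      \<le> exp (- U x) * prop_dens g \<gamma> x y * accept_prob U g \<gamma> x y" by (rule order_trans[rotated])
  then have "exp (U x) * (exp (- (U x + U y) / 2) * (q * (exp (\<kappa> * ((norm y)\<^sup>2 - (norm x)\<^sup>2) / 2) * gauss s (a *\<^sub>R x) y)))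
      \<le> exp (U x) * (exp (- U x) * prop_dens g \<gamma> x y * accept_prob U g \<gamma> x y)"
    by (rule mult_left_mono) simp
  also have "\<dots> = prop_dens g \<gamma> x y * accept_prob U g \<gamma> x y"
    by (simp add: mult.assoc[symmetric] exp_add[symmetric])
  also have "exp (U x) * (exp (- (U x + U y) / 2) * (q * (exp (\<kappa> * ((norm y)\<^sup>2 - (norm x)\<^sup>2) / 2) * gauss s (a *\<^sub>R x) y)))
      = q * (exp (U x) * exp (- (U x + U y) / 2) * exp (\<kappa> * ((norm y)\<^sup>2 - (norm x)\<^sup>2) / 2)) * gauss s (a *\<^sub>R x) y"
    by (simp only: mult_ac)
  also have "exp (U x) * exp (- (U x + U y) / 2) * exp (\<kappa> * ((norm y)\<^sup>2 - (norm x)\<^sup>2) / 2) = weight x / weight y"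
    unfolding weight_def exp_add[symmetric] exp_diff[symmetric]
    by (rule arg_cong[of _ _ exp]) (simp add: field_simps)
  finally show ?thesis by (simp add: mult_ac)
qed

lemma var_Suc: "var (Suc k) = a\<^sup>2 * var k + s"
  unfolding var_def by (subst sum.lessThan_Suc_shift) (simp add: sum_distrib_left algebra_simps)

lemma var_pos: "0 < var (Suc k)"
proof (induction k)
  case 0
  then show ?case using s_bounds by (simp add: var_def)
next
  case (Suc k)
  then show ?case using s_bounds unfolding var_Suc[of "Suc k"] by (intro add_nonneg_pos) auto
qed

lemma var_le: "var k \<le> real k * s"
proof -
  have "(\<Sum>j<k. (a\<^sup>2) ^ j) \<le> (\<Sum>j<k. 1)"
    using a_bounds by (intro sum_mono) (auto intro!: power_le_one)
  then show ?thesis using s_bounds mult_left_mono[of _ "real k" s] by (simp add: var_def mult.commute)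
qed

lemma var_ge: "real k * s * (a\<^sup>2) ^ k \<le> var k"
proof -
  have "(\<Sum>j<k. (a\<^sup>2) ^ k) \<le> (\<Sum>j<k. (a\<^sup>2) ^ j)"
    using a_bounds by (intro sum_mono power_decreasing) (auto intro!: power_le_one)
  then show ?thesis using s_bounds mult_left_mono[of _ _ s] by (simp add: var_def mult_ac)
qed

text \<open>Rejected moves are simply discarded; they only add mass.\<close>

lemma mala_kernel_ge:
  assumes [measurable]: "f \<in> borel_measurable borel"
  shows "ennreal (q * weight x) * (\<integral>\<^sup>+y. f y * ennreal (1 / weight y) * ennreal (gauss s (a *\<^sub>R x) y) \<partial>lborel)
    \<le> (\<integral>\<^sup>+y. f y \<partial>mala_kernel U g \<gamma> x)"
proof -
  have "ennreal (q * weight x) * (\<integral>\<^sup>+y. f y * ennreal (1 / weight y) * ennreal (gauss s (a *\<^sub>R x) y) \<partial>lborel)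
     = (\<integral>\<^sup>+y. f y * ennreal (q * weight x * (gauss s (a *\<^sub>R x) y / weight y)) \<partial>lborel)"
    using q_pos weight_pos less_imp_le[OF weight_pos]
    by (subst nn_integral_cmult[symmetric]) (auto intro!: nn_integral_cong simp: ennreal_mult[symmetric] mult_ac simp flip: ennreal_mult'')
  also have "\<dots> \<le> (\<integral>\<^sup>+y. f y * ennreal (prop_dens g \<gamma> x y * accept_prob U g \<gamma> x y) \<partial>lborel)"
    by (intro nn_integral_mono mult_left_mono ennreal_leI accept_dens_ge) auto
  also have "\<dots> \<le> (\<integral>\<^sup>+y. f y \<partial>mala_kernel U g \<gamma> x)"
    by (subst nn_integral_mala_kernel)
      (auto intro!: nn_integral_mono simp: ennreal_mult accept_prob_bounds distrib_left mult_ac)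
  finally show ?thesis .
qed

text \<open>The weights at intermediate points cancel and the Gaussians compose, so \<open>k\<close>
  steps cost exactly \<open>q ^ k\<close>. The induction starts at one step because
  \<open>var 0 = 0\<close> is degenerate.\<close>

lemma mala_kiter_ge:
  assumes "f \<in> borel_measurable borel"
  shows "ennreal (q ^ Suc k * weight x) *
      (\<integral>\<^sup>+y. f y * ennreal (1 / weight y) * ennreal (gauss (var (Suc k)) (a ^ Suc k *\<^sub>R x) y) \<partial>lborel)
    \<le> (\<integral>\<^sup>+y. f y \<partial>kiter borel (mala_kernel U g \<gamma>) (Suc k) x)"
  using assms
proof (induction k arbitrary: f)
  case 0
  note [measurable] = 0
  have "(\<integral>\<^sup>+y. f y \<partial>kiter borel (mala_kernel U g \<gamma>) (Suc 0) x) = (\<integral>\<^sup>+y. f y \<partial>mala_kernel U g \<gamma> x)"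
    by (subst nn_integral_kiter_Suc[OF measurable_mala_kernel[OF \<gamma>] _ 0])
      (simp_all add: nn_integral_return nn_integral_kernel_measurable[OF measurable_mala_kernel[OF \<gamma>]] 0)
  then show ?case using mala_kernel_ge[OF 0, of x] by (simp add: var_def)
next
  case (Suc k)
  note [measurable] = Suc.prems
  define I where "I = (\<lambda>w. \<integral>\<^sup>+y. f y * ennreal (1 / weight y) * ennreal (gauss s (a *\<^sub>R w) y) \<partial>lborel)"
  have gm [measurable]: "(\<lambda>p. gauss s (a *\<^sub>R fst p) (snd p :: 'a)) \<in> borel_measurable (borel \<Otimes>\<^sub>M borel)"
    unfolding gauss_def by measurable
  have [measurable]: "(\<lambda>p. gauss s (a *\<^sub>R snd p) (fst p :: 'a)) \<in> borel_measurable (borel \<Otimes>\<^sub>M borel)"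
    unfolding gauss_def by measurable
  have [measurable]: "(\<lambda>w. gauss s (a *\<^sub>R w) (y :: 'a)) \<in> borel_measurable borel" for y
    unfolding gauss_def by measurable
  have Im [measurable]: "I \<in> borel_measurable borel" unfolding I_def by measurable
  let ?g = "\<lambda>w. ennreal (gauss (var (Suc k)) (a ^ Suc k *\<^sub>R x) w)"
  have "(\<integral>\<^sup>+y. f y * ennreal (1 / weight y) * ennreal (gauss (var (Suc (Suc k))) (a ^ Suc (Suc k) *\<^sub>R x) y) \<partial>lborel)
     = (\<integral>\<^sup>+y. f y * ennreal (1 / weight y) * (\<integral>\<^sup>+w. ?g w * ennreal (gauss s (a *\<^sub>R w) y) \<partial>lborel) \<partial>lborel)"
    by (simp add: nn_integral_gauss_compose[OF var_pos s_bounds(3)] var_Suc[of "Suc k"])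
  also have "\<dots> = (\<integral>\<^sup>+y. \<integral>\<^sup>+w. f y * ennreal (1 / weight y) * (?g w * ennreal (gauss s (a *\<^sub>R w) y)) \<partial>lborel \<partial>lborel)"
    by (subst nn_integral_cmult) auto
  also have "\<dots> = (\<integral>\<^sup>+w. \<integral>\<^sup>+y. f y * ennreal (1 / weight y) * (?g w * ennreal (gauss s (a *\<^sub>R w) y)) \<partial>lborel \<partial>lborel)"
    by (rule lborel_pair.Fubini'[symmetric]) measurable
  also have "\<dots> = (\<integral>\<^sup>+w. I w * ?g w \<partial>lborel)"
    unfolding I_def by (subst nn_integral_multc[symmetric]) (auto simp: mult_ac)
  finally have conv: "(\<integral>\<^sup>+y. f y * ennreal (1 / weight y) * ennreal (gauss (var (Suc (Suc k))) (a ^ Suc (Suc k) *\<^sub>R x) y) \<partial>lborel)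
     = (\<integral>\<^sup>+w. I w * ?g w \<partial>lborel)" .
  \<comment> \<open>The induction hypothesis is applied to the lower bound for the last step as a
    function of its starting point \<open>w\<close>; its factor \<open>weight w\<close> meets
    \<open>1 / weight w\<close>.\<close>
  have "ennreal (q ^ Suc (Suc k) * weight x) * (\<integral>\<^sup>+w. I w * ?g w \<partial>lborel)
      = ennreal (q ^ Suc k * weight x) * (\<integral>\<^sup>+w. (ennreal (q * weight w) * I w) * ennreal (1 / weight w) * ?g w \<partial>lborel)"
  proof -
    have "(ennreal (q * weight w) * I w) * ennreal (1 / weight w) * ?g w = ennreal q * (I w * ?g w)" for w
    proof -
      have "ennreal (q * weight w) * ennreal (1 / weight w) = ennreal q"
        using q_pos weight_pos[of w] by (subst ennreal_mult[symmetric]) auto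
      then show ?thesis by (metis mult.assoc mult.left_commute)
    qed
    then have "(\<integral>\<^sup>+w. (ennreal (q * weight w) * I w) * ennreal (1 / weight w) * ?g w \<partial>lborel)
        = ennreal q * (\<integral>\<^sup>+w. I w * ?g w \<partial>lborel)"
      by (simp add: nn_integral_cmult)
    moreover have "ennreal (q ^ Suc (Suc k) * weight x) = ennreal (q ^ Suc k * weight x) * ennreal q"
      using q_pos weight_pos[of x] by (subst ennreal_mult[symmetric]) (auto simp: mult_ac)
    ultimately show ?thesis by (simp add: mult.assoc)
  qed
  also have "\<dots> \<le> (\<integral>\<^sup>+w. ennreal (q * weight w) * I w \<partial>kiter borel (mala_kernel U g \<gamma>) (Suc k) x)"
    by (rule Suc.IH) measurable
  also have "\<dots> \<le> (\<integral>\<^sup>+w. \<integral>\<^sup>+y. f y \<partial>mala_kernel U g \<gamma> w \<partial>kiter borel (mala_kernel U g \<gamma>) (Suc k) x)"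
    unfolding I_def by (intro nn_integral_mono mala_kernel_ge) auto
  also have "\<dots> = (\<integral>\<^sup>+y. f y \<partial>kiter borel (mala_kernel U g \<gamma>) (Suc (Suc k)) x)"
    by (rule nn_integral_kiter_Suc[OF measurable_mala_kernel[OF \<gamma>], symmetric]) (auto simp: Suc.prems)
  finally show ?case by (simp only: conv)
qed

end

section \<open>The drift condition\<close>

lemma sqrt_one_plus_square_lipschitz:
  fixes x y :: "'a::real_normed_vector"
  shows "sqrt (1 + (norm y)\<^sup>2) \<le> sqrt (1 + (norm x)\<^sup>2) + norm (y - x)"
proof (rule real_le_lsqrt)
  define b where "b = norm (y - x)"
  have "norm x \<le> sqrt (1 + (norm x)\<^sup>2)" by (rule real_le_rsqrt) simp
  then have "norm x * b \<le> sqrt (1 + (norm x)\<^sup>2) * b" by (intro mult_right_mono) (auto simp: b_def)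
  moreover have "(norm y)\<^sup>2 \<le> (norm x + b)\<^sup>2"
    using norm_triangle_sub[of y x] by (intro power_mono) (auto simp: b_def)
  ultimately show "1 + (norm y)\<^sup>2 \<le> (sqrt (1 + (norm x)\<^sup>2) + norm (y - x))\<^sup>2"
    unfolding b_def[symmetric] by (simp add: power2_sum)
qed (auto intro!: add_nonneg_nonneg)

lemma measurable_Wfun [measurable]: "Wfun \<eta> \<in> borel_measurable borel"
  unfolding Wfun_def by measurable

lemma Wfun_ge_1: "0 \<le> \<eta> \<Longrightarrow> 1 \<le> Wfun \<eta> x"
  by (simp add: Wfun_def)

lemma Wfun_pos: "0 < Wfun \<eta> x"
  by (simp add: Wfun_def)

text \<open>AM--GM in the form \<open>\<psi> y \<le> (\<psi> y ^ 2 + \<psi> x ^ 2) / (2 * \<psi> x)\<close> for \<open>\<psi> x = sqrt (1 + norm x ^ 2)\<close>.\<close>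
lemma Wfun_le:
  assumes \<eta>: "0 \<le> \<eta>"
  defines "\<psi> x \<equiv> sqrt (1 + (norm x)\<^sup>2)"
  shows "Wfun \<eta> y \<le> Wfun \<eta> x * exp (((\<eta> / \<psi> x) *\<^sub>R x) \<bullet> (y - x) + \<eta> / 2 * (norm (y - x))\<^sup>2)"
proof -
  have \<psi>: "1 \<le> \<psi> x" "\<psi> x * \<psi> x = 1 + (norm x)\<^sup>2" "\<psi> y * \<psi> y = 1 + (norm y)\<^sup>2"
    by (simp_all add: \<psi>_def add_nonneg_nonneg)
  have "2 * (\<psi> x * \<psi> y) \<le> \<psi> x * \<psi> x + \<psi> y * \<psi> y"
    using zero_le_power2[of "\<psi> x - \<psi> y"] by (simp add: power2_eq_square algebra_simps)
  also have "\<dots> = 2 * (\<psi> x * \<psi> x) + 2 * (x \<bullet> (y - x)) + (norm (y - x))\<^sup>2"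
    unfolding \<psi> power2_norm_eq_inner by (simp add: inner_diff inner_commute algebra_simps)
  also have "\<dots> \<le> 2 * (\<psi> x * \<psi> x) + 2 * (x \<bullet> (y - x)) + \<psi> x * (norm (y - x))\<^sup>2"
    using \<psi>(1) mult_right_mono[of 1 "\<psi> x" "(norm (y - x))\<^sup>2"] by simp
  also have "\<dots> = 2 * (\<psi> x * (\<psi> x + (x \<bullet> (y - x)) / \<psi> x + (norm (y - x))\<^sup>2 / 2))"
    using \<psi>(1) by (simp add: field_simps)
  finally have "\<psi> y \<le> \<psi> x + (x \<bullet> (y - x)) / \<psi> x + (norm (y - x))\<^sup>2 / 2" using \<psi>(1) by simp
  then have "\<eta> * \<psi> y \<le> \<eta> * (\<psi> x + (x \<bullet> (y - x)) / \<psi> x + (norm (y - x))\<^sup>2 / 2)" using \<eta> by (rule mult_left_mono)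
  also have "\<dots> = \<eta> * \<psi> x + (((\<eta> / \<psi> x) *\<^sub>R x) \<bullet> (y - x) + \<eta> / 2 * (norm (y - x))\<^sup>2)"
    by (simp add: distrib_left)
  finally show ?thesis unfolding Wfun_def \<psi>_def[symmetric] exp_add[symmetric] by simp
qed

lemma exp_le_one_plus:
  fixes s :: real
  assumes "0 \<le> s"
  shows "exp s \<le> 1 + s * exp s"
proof -
  have "exp s * (1 - s) \<le> exp s * exp (- s)"
    using exp_ge_add_one_self[of "- s"] by (intro mult_left_mono) auto
  then show ?thesis by (simp add: algebra_simps flip: exp_add)
qed

lemma exp_neg_le:
  fixes v :: real
  assumes "0 \<le> v" "v \<le> 1"
  shows "exp (- v) \<le> 1 - v / 2"
proof -
  have "1 \<le> (1 + v) * (1 - v / 2)" using assms mult_left_mono[OF assms(2,1)] by (simp add: algebra_simps)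
  also have "\<dots> \<le> exp v * (1 - v / 2)" using exp_ge_add_one_self[of v] assms by (intro mult_right_mono) auto
  finally have "exp (- v) * 1 \<le> exp (- v) * (exp v * (1 - v / 2))" by (intro mult_left_mono) auto
  also have "\<dots> = 1 - v / 2" by (simp add: mult.assoc[symmetric] exp_add[symmetric])
  finally show ?thesis by simp
qed

context smooth_potential
begin

text \<open>By \<open>Wfun_le\<close> around the proposal mean, \<open>W\<close> is at most an
  exponential of a quadratic whose linear part has norm at most \<eta>. The tilted Gaussian integral
  exceeds 1 only by a factor exp(O(\<gamma>)), as
  \<open>u = 2 * \<eta> * \<gamma> \<le> 1 / 2\<close>.\<close>

lemma proposal_drift:
  assumes \<eta>: "0 < \<eta>" and \<gamma>: "0 < \<gamma>" "4 * \<eta> * \<gamma> \<le> 1"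
  shows "(\<integral>\<^sup>+y. ennreal (prop_dens g \<gamma> x y * Wfun \<eta> y) \<partial>lborel)
    \<le> ennreal (exp (2 * \<eta> * (real DIM('a) + \<eta>) * \<gamma>) * Wfun \<eta> (x - \<gamma> *\<^sub>R g x))"
proof -
  define p where "p = x - \<gamma> *\<^sub>R g x"
  define l where "l = (\<eta> / sqrt (1 + (norm p)\<^sup>2)) *\<^sub>R p"
  define u where "u = 2 * \<eta> * \<gamma>"
  have u: "0 < u" "u \<le> 1 / 2" using \<eta> \<gamma> by (auto simp: u_def)
  have nl: "norm l \<le> \<eta>"
  proof -
    have 1: "norm p \<le> sqrt (1 + (norm p)\<^sup>2)" by (rule real_le_rsqrt) simp
    have "0 < sqrt (1 + (norm p)\<^sup>2)" by (simp add: add_pos_nonneg)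
    then show ?thesis using \<eta> mult_left_mono[OF 1, of \<eta>] by (simp add: l_def pos_divide_le_eq)
  qed
  have "(\<integral>\<^sup>+y. ennreal (prop_dens g \<gamma> x y * Wfun \<eta> y) \<partial>lborel)
      \<le> (\<integral>\<^sup>+y. ennreal (Wfun \<eta> p) * ennreal (gauss (2 * \<gamma>) p y * exp (l \<bullet> (y - p) + \<eta> / 2 * (norm (y - p))\<^sup>2)) \<partial>lborel)"
  proof (rule nn_integral_mono)
    fix y
    have "gauss (2 * \<gamma>) p y * Wfun \<eta> y \<le> gauss (2 * \<gamma>) p y * (Wfun \<eta> p * exp (l \<bullet> (y - p) + \<eta> / 2 * (norm (y - p))\<^sup>2))"
      unfolding l_def using \<eta> by (intro mult_left_mono Wfun_le) auto
    then show "ennreal (prop_dens g \<gamma> x y * Wfun \<eta> y) \<le> ennreal (Wfun \<eta> p) * ennreal (gauss (2 * \<gamma>) p y * exp (l \<bullet> (y - p) + \<eta> / 2 * (norm (y - p))\<^sup>2))"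
      by (subst ennreal_mult[symmetric]) (auto simp: prop_dens_eq_gauss p_def[symmetric] less_imp_le[OF Wfun_pos] mult_ac intro!: ennreal_leI)
  qed
  also have "\<dots> = ennreal (Wfun \<eta> p) * ennreal ((1 - u) powr (- real DIM('a) / 2) * exp (2 * \<gamma> * (norm l)\<^sup>2 / (2 * (1 - u))))"
  proof -
    have "1 - 2 * (2 * \<gamma>) * (\<eta> / 2) = 1 - u" "2 * (2 * \<gamma>) * (\<eta> / 2) < 1" using u by (auto simp: u_def)
    then show ?thesis
      using nn_integral_gauss_exp[of "2 * \<gamma>" "\<eta> / 2" p l] \<gamma>(1) by (subst nn_integral_cmult) auto
  qed
  also have "\<dots> \<le> ennreal (Wfun \<eta> p) * ennreal (exp (u * real DIM('a)) * exp (2 * \<gamma> * \<eta>\<^sup>2))"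
  proof (intro mult_left_mono ennreal_leI mult_mono)
    have "(1 - u) powr (- real DIM('a) / 2) \<le> exp (- 2 * u) powr (- real DIM('a) / 2)"
      using one_minus_ge_exp[of u] u by (intro powr_mono2') auto
    also have "\<dots> = exp (u * real DIM('a))" by (simp add: powr_def)
    finally show "(1 - u) powr (- real DIM('a) / 2) \<le> exp (u * real DIM('a))" .
    have "2 * \<gamma> * (norm l)\<^sup>2 / (2 * (1 - u)) \<le> 2 * \<gamma> * (norm l)\<^sup>2 / 1"
      using u \<gamma> by (intro divide_left_mono) auto
    also have "\<dots> \<le> 2 * \<gamma> * \<eta>\<^sup>2" using nl \<gamma> by (auto intro!: mult_left_mono power_mono)
    finally show "exp (2 * \<gamma> * (norm l)\<^sup>2 / (2 * (1 - u))) \<le> exp (2 * \<gamma> * \<eta>\<^sup>2)" by simp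
  qed auto
  also have "exp (u * real DIM('a)) * exp (2 * \<gamma> * \<eta>\<^sup>2) = exp (2 * \<eta> * (real DIM('a) + \<eta>) * \<gamma>)"
    unfolding exp_add[symmetric] by (simp add: u_def algebra_simps power2_eq_square)
  finally show ?thesis
    by (simp add: p_def ennreal_mult[symmetric] less_imp_le[OF Wfun_pos] mult.commute)
qed

lemma rejection_integral:
  assumes \<gamma>: "0 < \<gamma>" and C: "0 \<le> C"
    and rej: "\<And>y. 1 - accept_prob U g \<gamma> x y \<le> C * (\<gamma> + (norm (y - x + \<gamma> *\<^sub>R g x))\<^sup>2)"
  shows "(\<integral>\<^sup>+y. ennreal (prop_dens g \<gamma> x y * (1 - accept_prob U g \<gamma> x y)) \<partial>lborel)
    \<le> ennreal (C * (1 + 8 * 2 powr (real DIM('a) / 2)) * \<gamma>)"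
proof -
  define p where "p = x - \<gamma> *\<^sub>R g x"
  \<comment> \<open>The second moment is bounded through
    \<open>N \<le> 8 * \<gamma> * exp (N / (8 * \<gamma>))\<close>. This tilt halves the inverse
    variance of the proposal, hence the factor \<open>2 powr (d / 2)\<close> with d the
    dimension.\<close>
  let ?e = "\<lambda>y. gauss (2 * \<gamma>) p y * exp (0 \<bullet> (y - p) + 1 / (8 * \<gamma>) * (norm (y - p))\<^sup>2)"
  have "(\<integral>\<^sup>+y. ennreal (prop_dens g \<gamma> x y * (1 - accept_prob U g \<gamma> x y)) \<partial>lborel)
     \<le> (\<integral>\<^sup>+y. ennreal (C * \<gamma>) * ennreal (gauss (2 * \<gamma>) p y) + ennreal (8 * C * \<gamma>) * ennreal (?e y) \<partial>lborel)"
  proof (rule nn_integral_mono)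
    fix y
    have y: "y - x + \<gamma> *\<^sub>R g x = y - p" by (simp add: p_def)
    define N where "N = (norm (y - p))\<^sup>2"
    have "N = 8 * \<gamma> * (1 / (8 * \<gamma>) * N)" using \<gamma> by simp
    also have "1 / (8 * \<gamma>) * N \<le> exp (1 / (8 * \<gamma>) * N)"
      using exp_ge_add_one_self[of "1 / (8 * \<gamma>) * N"] by linarith
    finally have "N \<le> 8 * \<gamma> * exp (1 / (8 * \<gamma>) * N)" using \<gamma> by simp
    then have N: "C * (\<gamma> + N) \<le> C * (\<gamma> + 8 * \<gamma> * exp (1 / (8 * \<gamma>) * N))"
      using C by (intro mult_left_mono) auto
    have "prop_dens g \<gamma> x y * (1 - accept_prob U g \<gamma> x y) \<le> gauss (2 * \<gamma>) p y * (C * (\<gamma> + 8 * \<gamma> * exp (1 / (8 * \<gamma>) * N)))"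
      unfolding prop_dens_eq_gauss p_def[symmetric]
      using rej[of y] N unfolding y N_def by (intro mult_left_mono) auto
    also have "\<dots> = C * \<gamma> * gauss (2 * \<gamma>) p y + 8 * C * \<gamma> * ?e y"
      by (simp add: N_def algebra_simps)
    finally show "ennreal (prop_dens g \<gamma> x y * (1 - accept_prob U g \<gamma> x y))
       \<le> ennreal (C * \<gamma>) * ennreal (gauss (2 * \<gamma>) p y) + ennreal (8 * C * \<gamma>) * ennreal (?e y)"
      using C \<gamma> by (simp add: ennreal_leI flip: ennreal_mult ennreal_plus)
  qed
  also have "\<dots> = ennreal (C * \<gamma>) * 1 + ennreal (8 * C * \<gamma>) * ennreal (2 powr (real DIM('a) / 2))"
  proof -
    have "(\<integral>\<^sup>+y. ennreal (?e y) \<partial>lborel) = ennreal ((1 / 2) powr (- real DIM('a) / 2))"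
      using nn_integral_gauss_exp[of "2 * \<gamma>" "1 / (8 * \<gamma>)" p 0] \<gamma> by simp
    also have "(1 / 2 :: real) powr (- real DIM('a) / 2) = 2 powr (real DIM('a) / 2)"
      by (simp add: powr_divide powr_minus_divide)
    finally show ?thesis
      using nn_integral_gauss[of "2 * \<gamma>" p] \<gamma> by (subst nn_integral_add) (auto simp: nn_integral_cmult)
  qed
  also have "\<dots> = ennreal (C * (1 + 8 * 2 powr (real DIM('a) / 2)) * \<gamma>)"
    using C \<gamma> by (simp add: algebra_simps flip: ennreal_mult ennreal_plus)
  finally show ?thesis .
qed

lemma mala_drift_le:
  assumes \<eta>: "0 < \<eta>" and \<gamma>: "0 < \<gamma>" "4 * \<eta> * \<gamma> \<le> 1" and C: "0 \<le> C"
    and rej: "\<And>y. 1 - accept_prob U g \<gamma> x y \<le> C * (\<gamma> + (norm (y - x + \<gamma> *\<^sub>R g x))\<^sup>2)"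
  shows "(\<integral>\<^sup>+y. ennreal (Wfun \<eta> y) \<partial>mala_kernel U g \<gamma> x)
    \<le> ennreal (exp (2 * \<eta> * (real DIM('a) + \<eta>) * \<gamma>) * Wfun \<eta> (x - \<gamma> *\<^sub>R g x)
       + C * (1 + 8 * 2 powr (real DIM('a) / 2)) * \<gamma> * Wfun \<eta> x)"
proof -
  have "(\<integral>\<^sup>+y. ennreal (Wfun \<eta> y) \<partial>mala_kernel U g \<gamma> x)
    \<le> (\<integral>\<^sup>+y. ennreal (prop_dens g \<gamma> x y * Wfun \<eta> y)
        + ennreal (Wfun \<eta> x) * ennreal (prop_dens g \<gamma> x y * (1 - accept_prob U g \<gamma> x y)) \<partial>lborel)"
  proof (subst nn_integral_mala_kernel, simp, rule nn_integral_mono)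
    fix y
    have "prop_dens g \<gamma> x y * (Wfun \<eta> y * accept_prob U g \<gamma> x y) \<le> prop_dens g \<gamma> x y * (Wfun \<eta> y * 1)"
      using accept_prob_bounds less_imp_le[OF Wfun_pos] by (intro mult_left_mono) auto
    then have "ennreal (prop_dens g \<gamma> x y * (Wfun \<eta> y * accept_prob U g \<gamma> x y)) \<le> ennreal (prop_dens g \<gamma> x y * Wfun \<eta> y)"
      by (simp add: ennreal_leI)
    moreover have "ennreal (prop_dens g \<gamma> x y) * (ennreal (Wfun \<eta> y) * ennreal (accept_prob U g \<gamma> x y)
        + ennreal (Wfun \<eta> x) * ennreal (1 - accept_prob U g \<gamma> x y))
      = ennreal (prop_dens g \<gamma> x y * (Wfun \<eta> y * accept_prob U g \<gamma> x y))
        + ennreal (Wfun \<eta> x) * ennreal (prop_dens g \<gamma> x y * (1 - accept_prob U g \<gamma> x y))"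
      using less_imp_le[OF Wfun_pos[of \<eta> y]] by (simp add: ennreal_mult' distrib_left mult.left_commute)
    ultimately show "ennreal (prop_dens g \<gamma> x y) * (ennreal (Wfun \<eta> y) * ennreal (accept_prob U g \<gamma> x y)
        + ennreal (Wfun \<eta> x) * ennreal (1 - accept_prob U g \<gamma> x y))
      \<le> ennreal (prop_dens g \<gamma> x y * Wfun \<eta> y) + ennreal (Wfun \<eta> x) * ennreal (prop_dens g \<gamma> x y * (1 - accept_prob U g \<gamma> x y))"
      by (simp add: add_right_mono)
  qed
  also have "\<dots> = (\<integral>\<^sup>+y. ennreal (prop_dens g \<gamma> x y * Wfun \<eta> y) \<partial>lborel)
      + ennreal (Wfun \<eta> x) * (\<integral>\<^sup>+y. ennreal (prop_dens g \<gamma> x y * (1 - accept_prob U g \<gamma> x y)) \<partial>lborel)"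
    by (subst nn_integral_add) (auto simp: nn_integral_cmult)
  also have "\<dots> \<le> ennreal (exp (2 * \<eta> * (real DIM('a) + \<eta>) * \<gamma>) * Wfun \<eta> (x - \<gamma> *\<^sub>R g x))
      + ennreal (Wfun \<eta> x) * ennreal (C * (1 + 8 * 2 powr (real DIM('a) / 2)) * \<gamma>)"
    by (intro add_mono mult_left_mono proposal_drift[OF \<eta> \<gamma>] rejection_integral[OF \<gamma>(1) C rej]) auto
  also have "\<dots> = ennreal (exp (2 * \<eta> * (real DIM('a) + \<eta>) * \<gamma>) * Wfun \<eta> (x - \<gamma> *\<^sub>R g x)
       + C * (1 + 8 * 2 powr (real DIM('a) / 2)) * \<gamma> * Wfun \<eta> x)"
  proof -
    have r: "ennreal A + ennreal w * ennreal D = ennreal (A + D * w)" if "0 \<le> A" "0 \<le> w" "0 \<le> D" for A w D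
      using that by (simp add: mult.commute flip: ennreal_mult ennreal_plus)
    show ?thesis
      using C \<gamma> Wfun_pos[of \<eta> x] Wfun_pos[of \<eta> "x - \<gamma> *\<^sub>R g x"] by (intro r) auto
  qed
  finally show ?thesis .
qed

end

context mala_potential
begin

lemma mala_drift:
  assumes \<eta>: "0 < \<eta>"
  obtains b \<Gamma> where "0 \<le> b" "0 < \<Gamma>"
    "\<And>x \<gamma>. 0 < \<gamma> \<Longrightarrow> \<gamma> \<le> \<Gamma> \<Longrightarrow>
      (\<integral>\<^sup>+y. ennreal (Wfun \<eta> y) \<partial>mala_kernel U g \<gamma> x) \<le> ennreal ((1 - \<gamma>) * Wfun \<eta> x + b * \<gamma>)"
proof -
  obtain C \<Gamma>0 where C: "0 \<le> C" "0 < \<Gamma>0" and rej: "\<And>x y \<gamma>. 0 < \<gamma> \<Longrightarrow> \<gamma> \<le> \<Gamma>0 \<Longrightarrow>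
      1 - accept_prob U g \<gamma> x y \<le> C * (\<gamma> + (norm (y - x + \<gamma> *\<^sub>R g x))\<^sup>2)"
    using rejection_bound by blast
  define C2 where "C2 = 2 * \<eta> * (real DIM('a) + \<eta>)"
  define C3 where "C3 = C * (1 + 8 * 2 powr (real DIM('a) / 2))"
  \<comment> \<open>\<open>exp (- u \<gamma>) \<le> 1 - u \<gamma> / 2 = 1 - \<gamma> - C3
    \<gamma>\<close>: one part is the drift, the other pays for rejections. \<open>A\<close> is then
    chosen so that the gradient step also beats the growth rate \<open>C2\<close> of the proposal
    noise.\<close>
  define u where "u = 2 * (C3 + 1)"
  define A where "A = (C2 + u) / \<eta>"
  have C2: "0 \<le> C2" using \<eta> by (simp add: C2_def)
  have C3: "0 \<le> C3" using C by (simp add: C3_def)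
  have u: "0 < u" using C3 by (simp add: u_def)
  obtain R where R: "1 \<le> R" "\<And>x \<gamma>. R \<le> norm x \<Longrightarrow> 0 < \<gamma> \<Longrightarrow> 8 * (L + 1) * \<gamma> \<le> 1 \<Longrightarrow>
      sqrt (1 + (norm (x - \<gamma> *\<^sub>R g x))\<^sup>2) \<le> sqrt (1 + (norm x)\<^sup>2) - A * \<gamma>"
    using drift_step_contracts[of A] by blast
  \<comment> \<open>Inside the ball of radius \<open>R\<close> nothing contracts; \<open>e\<close>
    bounds the exponential growth rate there, and \<open>b\<close> absorbs the resulting O(\<gamma>)
    excess.\<close>
  define e where "e = C2 + \<eta> * (L * R)"
  have e: "0 \<le> e" using C2 \<eta> L_nonneg R(1) by (simp add: e_def)
  define b where "b = (e * exp e + C3 + 1) * exp (\<eta> * sqrt (1 + R\<^sup>2))"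
  have b: "0 \<le> b" using e C3 by (simp add: b_def)
  define \<Gamma> where "\<Gamma> = Min {\<Gamma>0, 1 / (8 * (L + 1)), 1 / (4 * \<eta>), 1 / u, 1}"
  have \<Gamma>: "0 < \<Gamma>" using C \<eta> u L_nonneg by (simp add: \<Gamma>_def)
  show ?thesis
  proof (rule that[OF b \<Gamma>])
    fix x :: 'a and \<gamma> :: real
    assume \<gamma>0: "0 < \<gamma>" and "\<gamma> \<le> \<Gamma>"
    then have "\<gamma> \<le> \<Gamma>0" "\<gamma> \<le> 1 / (8 * (L + 1))" "\<gamma> \<le> 1 / (4 * \<eta>)" "\<gamma> \<le> 1 / u" and \<gamma>1: "\<gamma> \<le> 1"
      by (auto simp: \<Gamma>_def)
    then have \<gamma>: "\<gamma> \<le> \<Gamma>0" "8 * (L + 1) * \<gamma> \<le> 1" "4 * \<eta> * \<gamma> \<le> 1" "u * \<gamma> \<le> 1"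
      using L_nonneg \<eta> u by (auto simp: field_simps)
    have W0: "0 < Wfun \<eta> x" by (rule Wfun_pos)
    have le: "(\<integral>\<^sup>+y. ennreal (Wfun \<eta> y) \<partial>mala_kernel U g \<gamma> x)
        \<le> ennreal (exp (C2 * \<gamma>) * Wfun \<eta> (x - \<gamma> *\<^sub>R g x) + C3 * \<gamma> * Wfun \<eta> x)"
      using mala_drift_le[OF \<eta> \<gamma>0 \<gamma>(3) C(1) rej[OF \<gamma>0 \<gamma>(1)]] by (simp add: C2_def C3_def)
    have "exp (C2 * \<gamma>) * Wfun \<eta> (x - \<gamma> *\<^sub>R g x) + C3 * \<gamma> * Wfun \<eta> x \<le> (1 - \<gamma>) * Wfun \<eta> x + b * \<gamma>"
    proof (cases "R \<le> norm x")
      case True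
      have "\<eta> * sqrt (1 + (norm (x - \<gamma> *\<^sub>R g x))\<^sup>2) \<le> \<eta> * (sqrt (1 + (norm x)\<^sup>2) - A * \<gamma>)"
        using R(2)[OF True \<gamma>0 \<gamma>(2)] \<eta> by (intro mult_left_mono) auto
      also have "\<dots> = \<eta> * sqrt (1 + (norm x)\<^sup>2) - (C2 + u) * \<gamma>"
      proof -
        have "\<eta> * A = C2 + u" using \<eta> by (simp add: A_def)
        then show ?thesis by (simp add: right_diff_distrib mult.assoc[symmetric])
      qed
      finally have "C2 * \<gamma> + \<eta> * sqrt (1 + (norm (x - \<gamma> *\<^sub>R g x))\<^sup>2) \<le> - (u * \<gamma>) + \<eta> * sqrt (1 + (norm x)\<^sup>2)"
        by (simp add: algebra_simps)
      then have "exp (C2 * \<gamma>) * Wfun \<eta> (x - \<gamma> *\<^sub>R g x) \<le> exp (- (u * \<gamma>)) * Wfun \<eta> x"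
        unfolding Wfun_def exp_add[symmetric] by simp
      also have "\<dots> \<le> (1 - u * \<gamma> / 2) * Wfun \<eta> x"
        using W0 u \<gamma>0 \<gamma>(4) by (intro mult_right_mono exp_neg_le) auto
      also have "\<dots> = (1 - \<gamma>) * Wfun \<eta> x - C3 * \<gamma> * Wfun \<eta> x" by (simp add: u_def algebra_simps)
      finally show ?thesis using mult_nonneg_nonneg[OF b less_imp_le[OF \<gamma>0]] by linarith
    next
      case False
      have "norm (x - \<gamma> *\<^sub>R g x - x) \<le> \<gamma> * (L * R)"
      proof -
        have "norm (g x) \<le> L * R"
          using norm_grad_le[of x] False L_nonneg by (meson linear mult_left_mono order_trans)
        then show ?thesis using \<gamma>0 by simp
      qed
      then have "sqrt (1 + (norm (x - \<gamma> *\<^sub>R g x))\<^sup>2) \<le> sqrt (1 + (norm x)\<^sup>2) + \<gamma> * (L * R)"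
        using sqrt_one_plus_square_lipschitz[of "x - \<gamma> *\<^sub>R g x" x] by linarith
      then have "\<eta> * sqrt (1 + (norm (x - \<gamma> *\<^sub>R g x))\<^sup>2) \<le> \<eta> * (sqrt (1 + (norm x)\<^sup>2) + \<gamma> * (L * R))"
        using \<eta> by (intro mult_left_mono) auto
      then have "C2 * \<gamma> + \<eta> * sqrt (1 + (norm (x - \<gamma> *\<^sub>R g x))\<^sup>2) \<le> e * \<gamma> + \<eta> * sqrt (1 + (norm x)\<^sup>2)"
        by (simp add: e_def algebra_simps)
      then have "exp (C2 * \<gamma>) * Wfun \<eta> (x - \<gamma> *\<^sub>R g x) \<le> exp (e * \<gamma>) * Wfun \<eta> x"
        unfolding Wfun_def exp_add[symmetric] by simp
      also have "\<dots> \<le> (1 + e * exp e * \<gamma>) * Wfun \<eta> x"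
      proof (intro mult_right_mono)
        have "e * \<gamma> \<le> e * 1" using e \<gamma>1 by (intro mult_left_mono) auto
        then have "(e * \<gamma>) * exp (e * \<gamma>) \<le> (e * \<gamma>) * exp e" using e \<gamma>0 by (intro mult_left_mono) auto
        moreover have "exp (e * \<gamma>) \<le> 1 + (e * \<gamma>) * exp (e * \<gamma>)"
          using e \<gamma>0 by (intro exp_le_one_plus) auto
        ultimately have "exp (e * \<gamma>) \<le> 1 + (e * \<gamma>) * exp e" by linarith
        then show "exp (e * \<gamma>) \<le> 1 + e * exp e * \<gamma>" by (simp only: mult_ac)
      qed (use W0 in auto)
      finally have "exp (C2 * \<gamma>) * Wfun \<eta> (x - \<gamma> *\<^sub>R g x) + C3 * \<gamma> * Wfun \<eta> x
          \<le> (1 - \<gamma>) * Wfun \<eta> x + ((e * exp e + C3 + 1) * Wfun \<eta> x) * \<gamma>" by (simp add: algebra_simps)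
      also have "(e * exp e + C3 + 1) * Wfun \<eta> x \<le> b"
        unfolding b_def Wfun_def
      proof (intro mult_left_mono)
        have "(norm x)\<^sup>2 \<le> R\<^sup>2" using False by (intro power_mono) auto
        then show "exp (\<eta> * sqrt (1 + (norm x)\<^sup>2)) \<le> exp (\<eta> * sqrt (1 + R\<^sup>2))" using \<eta> by simp
      qed (use e C3 in auto)
      finally show ?thesis using \<gamma>0 by (simp add: mult_right_mono)
    qed
    then show "(\<integral>\<^sup>+y. ennreal (Wfun \<eta> y) \<partial>mala_kernel U g \<gamma> x) \<le> ennreal ((1 - \<gamma>) * Wfun \<eta> x + b * \<gamma>)"
      using le by (meson ennreal_leI order_trans)
  qed
qed

section \<open>Normalization, exponential moments and invariance of the target\<close>

lemma nn_integral_Wfun_target_finite: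
  assumes \<eta>: "0 \<le> \<eta>"
  shows "(\<integral>\<^sup>+x. ennreal (exp (- U x)) * ennreal (Wfun \<eta> x) \<partial>lborel) < \<infinity>"
proof -
  \<comment> \<open>Slope \<open>\<eta> + 1\<close> leaves a factor exp(-|x|) after the growth of
    \<open>Wfun \<eta>\<close> is compensated.\<close>
  obtain B where B: "\<And>x. (\<eta> + 1) * norm x - B \<le> U x"
    using potential_growth[of "\<eta> + 1"] \<eta> by auto
  have "(\<integral>\<^sup>+x. ennreal (exp (- U x)) * ennreal (Wfun \<eta> x) \<partial>lborel)
     \<le> (\<integral>\<^sup>+x. ennreal (exp (B + \<eta>)) * ennreal (exp (- 1 * norm (x :: 'a))) \<partial>lborel)"
  proof (rule nn_integral_mono)
    fix x :: 'a
    have "sqrt (1 + (norm x)\<^sup>2) \<le> 1 + norm x"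
      using sqrt_one_plus_square_lipschitz[of x 0] by simp
    then have "\<eta> * sqrt (1 + (norm x)\<^sup>2) \<le> \<eta> * (1 + norm x)" using \<eta> by (rule mult_left_mono)
    then have "- U x + \<eta> * sqrt (1 + (norm x)\<^sup>2) \<le> B + \<eta> + - 1 * norm x"
      using B[of x] by (simp add: algebra_simps)
    then show "ennreal (exp (- U x)) * ennreal (Wfun \<eta> x) \<le> ennreal (exp (B + \<eta>)) * ennreal (exp (- 1 * norm x))"
      unfolding Wfun_def ennreal_mult[OF exp_ge_zero exp_ge_zero, symmetric] exp_add[symmetric]
      by (intro ennreal_leI) simp
  qed
  also have "\<dots> < \<infinity>"
    using nn_integral_exp_neg_norm_finite[where 'a='a, of 1]
    by (subst nn_integral_cmult) (auto simp: ennreal_mult_less_top)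
  finally show ?thesis .
qed

lemma target_normalization:
  "integrable lborel (\<lambda>x. exp (- U x))" "0 < (\<integral>x. exp (- U x) \<partial>lborel)"
  "(\<integral>\<^sup>+x. ennreal (exp (- U x)) \<partial>lborel) = ennreal (\<integral>x. exp (- U x) \<partial>lborel)"
proof -
  \<comment> \<open>\<open>Wfun 0\<close> is the constant 1, so finiteness of the normalization is
    the case \<eta> = 0.\<close>
  have "(\<integral>\<^sup>+x. ennreal (exp (- U x)) * ennreal (Wfun 0 x) \<partial>lborel) < \<infinity>"
    by (rule nn_integral_Wfun_target_finite) simp
  then have fin: "(\<integral>\<^sup>+x. ennreal (exp (- U x)) \<partial>lborel) < \<infinity>" by (simp add: Wfun_def)
  then show i: "integrable lborel (\<lambda>x. exp (- U x))" by (intro integrableI_nonneg) auto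
  then show eq: "(\<integral>\<^sup>+x. ennreal (exp (- U x)) \<partial>lborel) = ennreal (\<integral>x. exp (- U x) \<partial>lborel)"
    by (rule nn_integral_eq_integral) simp
  have "(\<integral>\<^sup>+x. ennreal (exp (- U x)) \<partial>lborel) \<noteq> 0"
  proof
    assume "(\<integral>\<^sup>+x. ennreal (exp (- U x)) \<partial>lborel) = 0"
    then have "AE x in lborel :: 'a measure. False"
      by (subst (asm) nn_integral_0_iff_AE) auto
    then have "emeasure lborel (UNIV :: 'a set) = 0"
      by (subst (asm) AE_iff_measurable[of UNIV]) auto
    then show False by simp
  qed
  then show "0 < (\<integral>x. exp (- U x) \<partial>lborel)" unfolding eq by (simp add: ennreal_eq_0_iff)
qed

lemma sets_pi_meas [simp]: "sets (pi_meas U) = sets borel"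
  by (simp add: pi_meas_def)

lemma nn_integral_pi_meas:
  assumes [measurable]: "f \<in> borel_measurable borel"
  shows "(\<integral>\<^sup>+x. f x \<partial>pi_meas U)
    = ennreal (1 / (\<integral>x. exp (- U x) \<partial>lborel)) * (\<integral>\<^sup>+x. ennreal (exp (- U x)) * f x \<partial>lborel)"
proof -
  let ?Z = "\<integral>x. exp (- U x) \<partial>lborel"
  have "ennreal (exp (- U x) / ?Z) = ennreal (1 / ?Z) * ennreal (exp (- U x))" for x
    using target_normalization(2) by (subst ennreal_mult[symmetric]) auto
  then show ?thesis
    unfolding pi_meas_def by (subst nn_integral_density) (auto simp: mult.assoc nn_integral_cmult)
qed

lemma prob_space_pi_meas: "prob_space (pi_meas U)"
proof
  have sp: "space (pi_meas U) = UNIV" using sets_eq_imp_space_eq[OF sets_pi_meas] by simp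
  have "emeasure (pi_meas U) UNIV = (\<integral>\<^sup>+x. 1 \<partial>pi_meas U)" by (simp add: sp)
  also have "\<dots> = 1"
    using target_normalization(2) by (subst nn_integral_pi_meas) (auto simp: target_normalization(3) simp flip: ennreal_mult)
  finally show "emeasure (pi_meas U) (space (pi_meas U)) = 1" by (simp add: sp)
qed

lemma nn_integral_Wfun_pi_meas: "0 \<le> \<eta> \<Longrightarrow> (\<integral>\<^sup>+x. ennreal (Wfun \<eta> x) \<partial>pi_meas U) < \<infinity>"
  using nn_integral_Wfun_target_finite by (simp add: nn_integral_pi_meas ennreal_mult_less_top)

lemma pi_meas_invariant:
  assumes \<gamma>: "0 < \<gamma>"
  shows "pi_meas U \<bind> mala_kernel U g \<gamma> = pi_meas U"
proof (rule measure_eqI)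
  have sp: "space (pi_meas U) = UNIV" using sets_eq_imp_space_eq[OF sets_pi_meas] by simp
  show sb: "sets (pi_meas U \<bind> mala_kernel U g \<gamma>) = sets (pi_meas U)"
    using sp by (subst sets_bind[where N=borel]) auto
  fix A assume "A \<in> sets (pi_meas U \<bind> mala_kernel U g \<gamma>)"
  then have A [measurable]: "A \<in> sets borel" using sb by simp
  have km: "(\<lambda>x. \<integral>\<^sup>+y. indicator A y \<partial>mala_kernel U g \<gamma> x) \<in> borel_measurable borel"
    by (rule nn_integral_kernel_measurable[OF measurable_mala_kernel[OF \<gamma>]]) simp
  have "(\<integral>\<^sup>+y. indicator A y \<partial>(pi_meas U \<bind> mala_kernel U g \<gamma>))
      = (\<integral>\<^sup>+x. \<integral>\<^sup>+y. indicator A y \<partial>mala_kernel U g \<gamma> x \<partial>pi_meas U)"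
    by (rule nn_integral_bind_kernel[OF sets_pi_meas measurable_mala_kernel[OF \<gamma>]]) simp
  also have "\<dots> = (\<integral>\<^sup>+x. indicator A x \<partial>pi_meas U)"
    unfolding nn_integral_pi_meas[OF km] using nn_integral_mala_invariant[OF \<gamma>, of "indicator A"]
    by (simp only: borel_measurable_indicator A) (simp add: nn_integral_pi_meas del: nn_integral_indicator)
  finally show "emeasure (pi_meas U \<bind> mala_kernel U g \<gamma>) A = emeasure (pi_meas U) A"
    using A sb by simp
qed

end

section \<open>Geometric ergodicity\<close>

context mala_minorization
begin

text \<open>For \<open>\<gamma> k\<close> in [1, 2] each factor is bounded below independently of
  \<gamma>: \<open>q ^ k\<close> by \<open>\<theta>_bounds\<close>, the ratio of weights by \<kappa>
  \<le> c and the bound on \<open>U\<close>, and the Gaussian because \<open>var k\<close> lies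
  between exp(-8 c) and 4.\<close>

lemma minorization_density:
  assumes k: "1 \<le> \<gamma> * real k" "\<gamma> * real k \<le> 2"
    and B: "\<And>z. norm z \<le> max \<rho> 1 \<Longrightarrow> \<bar>U z\<bar> \<le> B"
    and \<rho>: "0 \<le> \<rho>" and x: "norm x \<le> \<rho>" and y: "norm y \<le> 1"
  shows "exp (- 4 * c * real DIM('a)) * exp (- B - c * \<rho>\<^sup>2 / 2) *
      ((8 * pi) powr (- real DIM('a) / 2) * exp (- (1 + \<rho>)\<^sup>2 * exp (8 * c) / 2))
    \<le> q ^ k * (weight x / weight y) * gauss (var k) (a ^ k *\<^sub>R x) y"
proof -
  have k0: "0 < k" using k by (cases k) auto
  have v0: "0 < var k" using var_pos[of "k - 1"] k0 by simp
  have "exp (- 4 * c * real DIM('a)) \<le> q ^ k"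
  proof -
    have "c * (\<gamma> * real k) \<le> c * 2" using k c_pos by (intro mult_left_mono) auto
    then have "c * (\<gamma> * real k) * real DIM('a) \<le> c * 2 * real DIM('a)" by (rule mult_right_mono) simp
    then have "exp (- 4 * c * real DIM('a)) \<le> exp (- (2 * (c * (\<gamma> * real k) * real DIM('a))))"
      by (simp only: exp_le_cancel_iff)
    also have "\<dots> = (exp (- 4 * (c * \<gamma>)) powr (real DIM('a) / 2)) ^ k"
      by (simp add: powr_def exp_of_nat_mult[symmetric] mult_ac)
    also have "\<dots> \<le> q ^ k"
      unfolding q_def using \<theta>_bounds by (intro power_mono powr_mono2) auto
    finally show ?thesis .
  qed
  moreover have "exp (- B - c * \<rho>\<^sup>2 / 2) \<le> weight x / weight y"
  proof -
    have "\<bar>U x\<bar> \<le> B" "\<bar>U y\<bar> \<le> B" using B x y by auto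
    moreover have "\<kappa> * (norm x)\<^sup>2 \<le> c * \<rho>\<^sup>2"
      using \<kappa>_bounds x c_pos by (intro mult_mono power_mono) auto
    moreover have "0 \<le> \<kappa> * (norm y)\<^sup>2" using \<kappa>_bounds by simp
    ultimately have "- B - c * \<rho>\<^sup>2 / 2 \<le> (U x / 2 - \<kappa> * (norm x)\<^sup>2 / 2) - (U y / 2 - \<kappa> * (norm y)\<^sup>2 / 2)"
      by (simp only: abs_le_iff) linarith
    then show ?thesis unfolding weight_def exp_diff[symmetric] by simp
  qed
  moreover have "(8 * pi) powr (- real DIM('a) / 2) * exp (- (1 + \<rho>)\<^sup>2 * exp (8 * c) / 2) \<le> gauss (var k) (a ^ k *\<^sub>R x) y"
    unfolding gauss_def
  proof (intro mult_mono)
    have "var k \<le> real k * (2 * \<gamma>)"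
      using var_le[of k] s_bounds mult_left_mono[of s "2 * \<gamma>" "real k"] by linarith
    also have "\<dots> \<le> 4" using k by (simp add: mult.commute)
    finally have "2 * pi * var k \<le> 8 * pi" by simp
    then show "(8 * pi) powr (- real DIM('a) / 2) \<le> (2 * pi * var k) powr (- real DIM('a) / 2)"
      using v0 by (intro powr_mono2') auto
    have ve: "exp (- (8 * c)) \<le> var k"
    proof -
      have "c * (\<gamma> * real k) \<le> c * 2" using k c_pos by (intro mult_left_mono) auto
      then have "exp (- (8 * c)) \<le> exp (- 4 * (c * (\<gamma> * real k)))"
        unfolding exp_le_cancel_iff by linarith
      also have "\<dots> = (exp (- 2 * (c * \<gamma>)) * exp (- 2 * (c * \<gamma>))) ^ k"
        by (simp add: exp_of_nat_mult[symmetric] exp_add[symmetric] mult_ac)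
      also have "\<dots> \<le> (a * a) ^ k"
        unfolding a_def using one_minus_ge_exp[of "c * \<gamma>"] c\<gamma> by (intro power_mono mult_mono) auto
      also have "\<dots> = 1 * (a\<^sup>2) ^ k" by (simp add: power2_eq_square)
      also have "\<dots> \<le> (real k * s) * (a\<^sup>2) ^ k"
        using k(1) mult_left_mono[OF s_bounds(1), of "real k"] by (intro mult_right_mono) (auto simp: mult.commute)
      also have "\<dots> \<le> var k" by (rule var_ge)
      finally show ?thesis .
    qed
    have "norm (a ^ k *\<^sub>R x) \<le> \<rho>"
      using mult_mono[of "a ^ k" 1 "norm x" \<rho>] power_le_one[of a k] a_bounds x \<rho> by simp
    then have "norm (y - a ^ k *\<^sub>R x) \<le> 1 + \<rho>"
      using norm_triangle_ineq4[of y "a ^ k *\<^sub>R x"] y by linarith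
    then have "(norm (y - a ^ k *\<^sub>R x))\<^sup>2 / (2 * var k) \<le> (1 + \<rho>)\<^sup>2 / (2 * exp (- (8 * c)))"
      using ve by (intro frac_le power_mono) auto
    also have "\<dots> = (1 + \<rho>)\<^sup>2 * exp (8 * c) / 2" by (simp add: exp_minus field_simps)
    finally show "exp (- (1 + \<rho>)\<^sup>2 * exp (8 * c) / 2) \<le> exp (- (norm (y - a ^ k *\<^sub>R x))\<^sup>2 / (2 * var k))" by simp
  qed auto
  ultimately show ?thesis
    using q_pos weight_pos by (intro mult_mono) (auto intro!: mult_nonneg_nonneg less_imp_le[OF weight_pos] less_imp_le[OF divide_pos_pos])
qed

end

lemma prob_space_uniform_unit_ball:
  "prob_space (uniform_measure lborel (cball (0 :: 'a::euclidean_space) 1))"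
proof (rule prob_space_uniform_measure)
  have "unit_ball_vol (real DIM('a)) \<noteq> 0"
    by (rule less_imp_neq[symmetric]) simp
  then show "emeasure lborel (cball (0 :: 'a) 1) \<noteq> 0" by (simp add: emeasure_cball)
qed (simp add: emeasure_cball)

context smooth_potential
begin

text \<open>The order of quantifiers matters: \<epsilon> is fixed before \<gamma> and
  \<open>k\<close>, so one constant serves all step sizes.\<close>

lemma mala_minorize:
  assumes \<rho>: "0 \<le> \<rho>"
  obtains \<epsilon> where "0 < \<epsilon>"
    "\<And>x \<gamma> k f. norm x \<le> \<rho> \<Longrightarrow> 0 < \<gamma> \<Longrightarrow> 2 * (L + 1) * \<gamma> \<le> 1 / 8 \<Longrightarrow> 1 \<le> \<gamma> * real k \<Longrightarrow> \<gamma> * real k \<le> 2 \<Longrightarrow>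
      f \<in> borel_measurable borel \<Longrightarrow>
      ennreal \<epsilon> * (\<integral>\<^sup>+y. f y \<partial>uniform_measure lborel (cball 0 1))
        \<le> (\<integral>\<^sup>+y. f y \<partial>kiter borel (mala_kernel U g \<gamma>) k x)"
proof -
  have "bounded (U ` cball 0 (max \<rho> 1))"
    by (intro compact_imp_bounded compact_continuous_image continuous_U compact_cball)
  then obtain B where "\<And>u. u \<in> U ` cball 0 (max \<rho> 1) \<Longrightarrow> norm u \<le> B"
    unfolding bounded_iff by blast
  then have B: "\<bar>U z\<bar> \<le> B" if "norm z \<le> max \<rho> 1" for z using that by simp
  \<comment> \<open>The value of \<open>c\<close> in \<open>mala_minorization\<close>; it does not
    involve \<gamma> and can be named before that locale is interpreted for a particular
    \<gamma>.\<close>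
  define c' where "c' = 2 * (L + 1)"
  define e where "e = exp (- 4 * c' * real DIM('a)) * exp (- B - c' * \<rho>\<^sup>2 / 2) *
      ((8 * pi) powr (- real DIM('a) / 2) * exp (- (1 + \<rho>)\<^sup>2 * exp (8 * c') / 2))"
  define \<beta> where "\<beta> = unit_ball_vol (real DIM('a))"
  have e: "0 < e" by (simp add: e_def)
  have \<beta>': "emeasure lborel (cball (0 :: 'a) 1) = ennreal \<beta>"
    by (simp add: emeasure_cball \<beta>_def)
  have \<beta>: "0 < \<beta>" by (simp add: \<beta>_def)
  show ?thesis
  proof (rule that[of "e * \<beta>"])
    fix x :: 'a and \<gamma> :: real and k :: nat and f :: "'a \<Rightarrow> ennreal"
    assume x: "norm x \<le> \<rho>" and \<gamma>: "0 < \<gamma>" "2 * (L + 1) * \<gamma> \<le> 1 / 8"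
      and k: "1 \<le> \<gamma> * real k" "\<gamma> * real k \<le> 2" and f [measurable]: "f \<in> borel_measurable borel"
    interpret mala_minorization U g H L \<gamma> by unfold_locales (use \<gamma> in auto)
    have k0: "0 < k" using k by (cases k) auto
    then obtain k' where k': "k = Suc k'" by (cases k) auto
    have dens: "e \<le> q ^ k * (weight x / weight y) * gauss (var k) (a ^ k *\<^sub>R x) y" if "norm y \<le> 1" for y
    proof -
      have c': "c' = c" by (simp add: c'_def c_def)
      show ?thesis unfolding e_def c' by (rule minorization_density[OF k B \<rho> x that])
    qed
    have "ennreal (e * \<beta>) * (\<integral>\<^sup>+y. f y \<partial>uniform_measure lborel (cball 0 1))
      = ennreal e * (\<integral>\<^sup>+y. f y * indicator (cball 0 1) y \<partial>lborel)"
    proof -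
      have "(\<integral>\<^sup>+y. f y \<partial>uniform_measure lborel (cball 0 1))
          = (\<integral>\<^sup>+y. f y * indicator (cball 0 1) y \<partial>lborel) / ennreal \<beta>"
        unfolding \<beta>'[symmetric] by (rule nn_integral_uniform_measure) auto
      moreover have "ennreal \<beta> * (I / ennreal \<beta>) = I" for I
        using \<beta> by (simp add: ennreal_times_divide mult.commute[of "ennreal \<beta>"] mult_divide_eq_ennreal)
      ultimately show ?thesis using e by (simp add: ennreal_mult' mult.assoc)
    qed
    also have "\<dots> = (\<integral>\<^sup>+y. ennreal e * (f y * indicator (cball 0 1) y) \<partial>lborel)"
      by (rule nn_integral_cmult[symmetric])
        (simp add: borel_measurable_times_ennreal borel_measurable_indicator f)
    also have "\<dots> \<le> (\<integral>\<^sup>+y. ennreal (q ^ k * weight x) * (f y * ennreal (1 / weight y) * ennreal (gauss (var k) (a ^ k *\<^sub>R x) y)) \<partial>lborel)"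
    proof (rule nn_integral_mono)
      fix y
      have eq: "ennreal (q ^ k * weight x) * (f y * ennreal (1 / weight y) * ennreal (gauss (var k) (a ^ k *\<^sub>R x) y))
        = ennreal (q ^ k * (weight x / weight y) * gauss (var k) (a ^ k *\<^sub>R x) y) * f y"
      proof -
        have r: "ennreal (A * B * G) = ennreal A * ennreal B * ennreal G" if "0 \<le> A" "0 \<le> B" for A B G
          using that by (simp add: ennreal_mult')
        have "q ^ k * (weight x / weight y) * gauss (var k) (a ^ k *\<^sub>R x) y
            = (q ^ k * weight x) * (1 / weight y) * gauss (var k) (a ^ k *\<^sub>R x) y" by simp
        also have "ennreal \<dots> = ennreal (q ^ k * weight x) * ennreal (1 / weight y) * ennreal (gauss (var k) (a ^ k *\<^sub>R x) y)"
          using q_pos weight_pos[of x] weight_pos[of y] by (intro r) auto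
        finally show ?thesis by (simp only: mult_ac)
      qed
      show "ennreal e * (f y * indicator (cball 0 1) y)
        \<le> ennreal (q ^ k * weight x) * (f y * ennreal (1 / weight y) * ennreal (gauss (var k) (a ^ k *\<^sub>R x) y))"
        unfolding eq using ennreal_leI[OF dens[of y]]
        by (cases "norm y \<le> 1") (auto intro: mult_right_mono)
    qed
    also have "\<dots> = ennreal (q ^ k * weight x) * (\<integral>\<^sup>+y. f y * ennreal (1 / weight y) * ennreal (gauss (var k) (a ^ k *\<^sub>R x) y) \<partial>lborel)"
      by (rule nn_integral_cmult) simp
    also have "\<dots> \<le> (\<integral>\<^sup>+y. f y \<partial>kiter borel (mala_kernel U g \<gamma>) k x)"
      unfolding k' by (rule mala_kiter_ge[OF f])
    finally show "ennreal (e * \<beta>) * (\<integral>\<^sup>+y. f y \<partial>uniform_measure lborel (cball 0 1))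
        \<le> (\<integral>\<^sup>+y. f y \<partial>kiter borel (mala_kernel U g \<gamma>) k x)" .
  qed (use e \<beta> in simp)
qed

end

context mala_potential
begin

theorem mala_geometric_ergodicity:
  assumes \<eta>: "0 < \<eta>"
  obtains \<Gamma> C \<rho> where "0 < \<Gamma>" "0 \<le> C" "0 < \<rho>" "\<rho> < 1"
    "\<And>x \<gamma> k. 0 < \<gamma> \<Longrightarrow> \<gamma> \<le> \<Gamma> \<Longrightarrow> integrable (mala_iter U g \<gamma> k x) (Wfun \<eta>)"
    "\<And>x \<gamma> k. 0 < \<gamma> \<Longrightarrow> \<gamma> \<le> \<Gamma> \<Longrightarrow> vnorm (Wfun \<eta>) (mala_iter U g \<gamma> k x) (pi_meas U)
      \<le> C * \<rho> powr (\<gamma> * real k) * (Wfun \<eta> x + (\<integral>z. Wfun \<eta> z \<partial>pi_meas U))"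
proof -
  obtain b \<Gamma>0 where b: "0 \<le> b" and \<Gamma>0: "0 < \<Gamma>0"
    and drift: "\<And>x \<gamma>. 0 < \<gamma> \<Longrightarrow> \<gamma> \<le> \<Gamma>0 \<Longrightarrow>
      (\<integral>\<^sup>+y. ennreal (Wfun \<eta> y) \<partial>mala_kernel U g \<gamma> x) \<le> ennreal ((1 - \<gamma>) * Wfun \<eta> x + b * \<gamma>)"
    using mala_drift[OF \<eta>] by blast
  define \<zeta> :: real where "\<zeta> = exp (- 1)"
  have \<zeta>: "0 < \<zeta>" "\<zeta> < 1" by (simp_all add: \<zeta>_def)
  \<comment> \<open>For \<open>S \<ge> r\<close> the constant \<open>2 * t * b\<close> is at most
    half of the drift gain \<open>t * (1 - \<zeta>) * S\<close>, which replaces \<zeta> by the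
    midpoint \<open>z\<close> of \<zeta> and 1.\<close>
  define r where "r = 4 * b / (1 - \<zeta>) + 1"
  have r1: "1 \<le> r" using b \<zeta> by (simp add: r_def)
  obtain \<epsilon> where \<epsilon>: "0 < \<epsilon>"
    and minor: "\<And>x \<gamma> k f. norm x \<le> ln r / \<eta> \<Longrightarrow> 0 < \<gamma> \<Longrightarrow> 2 * (L + 1) * \<gamma> \<le> 1 / 8 \<Longrightarrow> 1 \<le> \<gamma> * real k \<Longrightarrow> \<gamma> * real k \<le> 2 \<Longrightarrow>
      f \<in> borel_measurable borel \<Longrightarrow>
      ennreal \<epsilon> * (\<integral>\<^sup>+y. f y \<partial>uniform_measure lborel (cball 0 1))
        \<le> (\<integral>\<^sup>+y. f y \<partial>kiter borel (mala_kernel U g \<gamma>) k x)"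
    using mala_minorize[of "ln r / \<eta>"] r1 \<eta> by (metis divide_nonneg_pos ln_ge_zero)
  define t where "t = \<epsilon> / (2 * (b + 1))"
  have t: "0 < t" "2 * t * b \<le> \<epsilon>"
    using \<epsilon> b by (auto simp: t_def field_simps)
  define z where "z = (1 + \<zeta>) / 2"
  have z: "\<zeta> < z" "z < 1" using \<zeta> by (auto simp: z_def)
  \<comment> \<open>\<open>(2 + t z S) / (2 + t S)\<close> decreases in \<open>S\<close> because
    \<open>z < 1\<close>, so on \<open>S \<ge> r\<close> its largest value is the one at
    \<open>r\<close>; the other entry is the rate in the minorization case.\<close>
  define a where "a = max (1 - \<epsilon> / 2) ((2 + t * z * r) / (2 + t * r))"
  have den: "0 < 2 + t * r" using t r1 by (simp add: add_pos_nonneg)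
  have za: "z \<le> (2 + t * z * r) / (2 + t * r)" using den z by (simp add: pos_le_divide_eq algebra_simps)
  have a1: "a < 1"
  proof -
    have "t * r * z < t * r * 1" using t r1 z by (intro mult_strict_left_mono) auto
    then have "(2 + t * z * r) / (2 + t * r) < 1" using den by (simp add: pos_divide_less_eq mult_ac)
    then show ?thesis using \<epsilon> by (simp add: a_def)
  qed
  have a2: "1 - \<epsilon> / 2 \<le> a" "\<zeta> \<le> a" "z \<le> a" using za z by (auto simp: a_def)
  have a0: "0 < a" using a2 \<zeta> by simp
  have a3: "2 + t * \<zeta> * S + 2 * t * b \<le> a * (2 + t * S)" if S: "r \<le> S" for S
  proof -
    have "4 * b \<le> (1 - \<zeta>) * S"
    proof -
      have "4 * b = (1 - \<zeta>) * (4 * b / (1 - \<zeta>))" using \<zeta> by simp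
      also have "\<dots> \<le> (1 - \<zeta>) * S" using S \<zeta> by (intro mult_left_mono) (auto simp: r_def)
      finally show ?thesis .
    qed
    then have "t * (4 * b) \<le> t * ((1 - \<zeta>) * S)" using t by (intro mult_left_mono) auto
    then have 1: "2 + t * \<zeta> * S + 2 * t * b \<le> 2 + t * z * S" by (simp add: z_def algebra_simps)
    have "2 + t * z * r \<le> a * (2 + t * r)"
    proof -
      have "(2 + t * z * r) / (2 + t * r) \<le> a" by (simp add: a_def)
      then show ?thesis using den by (simp add: pos_divide_le_eq)
    qed
    moreover have "t * z * (S - r) \<le> a * (t * (S - r))"
      using a2(3) t S mult_right_mono[of z a "t * (S - r)"] by (simp add: mult_ac)
    ultimately have "2 + t * z * S \<le> a * (2 + t * S)" by (simp add: algebra_simps)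
    with 1 show ?thesis by simp
  qed
  define \<Gamma> where "\<Gamma> = Min {\<Gamma>0, 1 / (16 * (L + 1)), 1}"
  have \<Gamma>: "0 < \<Gamma>" using \<Gamma>0 L_nonneg by (simp add: \<Gamma>_def)
  have \<Gamma>_le: "\<gamma> \<le> \<Gamma>0" "2 * (L + 1) * \<gamma> \<le> 1 / 8" "\<gamma> \<le> 1" if "\<gamma> \<le> \<Gamma>" for \<gamma>
  proof -
    have "\<gamma> \<le> 1 / (16 * (L + 1))" using that by (simp add: \<Gamma>_def)
    then show "2 * (L + 1) * \<gamma> \<le> 1 / 8" using L_nonneg by (simp add: field_simps)
  qed (use that in \<open>auto simp: \<Gamma>_def\<close>)
  have W0: "0 \<le> Wfun \<eta> x" for x :: 'a by (rule less_imp_le[OF Wfun_pos])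
  have W1: "1 \<le> Wfun \<eta> x" for x :: 'a using \<eta> by (intro Wfun_ge_1) simp
  have Wm: "Wfun \<eta> \<in> borel_measurable borel" by (rule measurable_Wfun)
  \<comment> \<open>Sublevel sets of \<open>W\<close> are bounded, which links the level
    \<open>r\<close> in Harris' theorem to the ball on which the minorization holds.\<close>
  have Wr: "norm x \<le> ln r / \<eta>" if "Wfun \<eta> x \<le> r" for x :: 'a
  proof -
    have "\<eta> * norm x \<le> \<eta> * sqrt (1 + (norm x)\<^sup>2)"
      using \<eta> by (intro mult_left_mono real_le_rsqrt) auto
    also have "\<dots> \<le> ln r" using that r1 by (simp add: Wfun_def ln_ge_iff)
    finally show ?thesis using \<eta> by (simp add: pos_le_divide_eq mult.commute)
  qed
  define C where "C = (1 + b) * (2 / t + 1) / a"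
  have C: "0 \<le> C" using b t a0 by (simp add: C_def)
  have conv: "\<bar>(\<integral>y. f y \<partial>mala_iter U g \<gamma> k x) - (\<integral>y. f y \<partial>pi_meas U)\<bar>
      \<le> C * sqrt a powr (\<gamma> * real k) * (Wfun \<eta> x + (\<integral>z. Wfun \<eta> z \<partial>pi_meas U))"
    if \<gamma>: "0 < \<gamma>" "\<gamma> \<le> \<Gamma>" and f: "f \<in> borel_measurable borel" "\<And>x. \<bar>f x\<bar> \<le> Wfun \<eta> x" for f k x \<gamma>
  proof -
    \<comment> \<open>Rounding 1 / \<gamma> up adds at most \<gamma> \<le> 1 to
      \<open>\<gamma> * k0\<close>, which keeps it in [1, 2].\<close>
    define k0 where "k0 = nat \<lceil>1 / \<gamma>\<rceil>"
    have "1 / \<gamma> \<le> real k0" "real k0 \<le> 1 / \<gamma> + 1" using \<gamma> by (simp_all add: k0_def)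
    then have k0: "1 \<le> \<gamma> * real k0" "\<gamma> * real k0 \<le> 2"
      using \<gamma>(1) \<Gamma>_le(3)[OF \<gamma>(2)] mult_left_mono[of "real k0" "1 / \<gamma> + 1" \<gamma>] by (auto simp: field_simps)
    show ?thesis
      unfolding mala_iter_eq_kiter C_def
      by (rule harris_convergence[where M=borel and K="mala_kernel U g \<gamma>" and V="Wfun \<eta>" and \<delta>=\<gamma> and ?k0.0=k0
            and \<nu>="uniform_measure lborel (cball 0 1)" and r=r and P="pi_meas U" and \<epsilon>=\<epsilon>,
            OF measurable_mala_kernel[OF \<gamma>(1)] Wm W1 \<gamma>(1) \<Gamma>_le(3)[OF \<gamma>(2)] b drift[OF \<gamma>(1) \<Gamma>_le(1)[OF \<gamma>(2)]]
              k0 prob_space_uniform_unit_ball _ \<epsilon>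
              minor[OF Wr \<gamma>(1) \<Gamma>_le(2)[OF \<gamma>(2)] k0] t a0 a1 a2(1) a2(2)[unfolded \<zeta>_def] a3[unfolded \<zeta>_def]
              prob_space_pi_meas sets_pi_meas pi_meas_invariant[OF \<gamma>(1)] nn_integral_Wfun_pi_meas f])
        (use \<eta> in auto)
  qed
  show ?thesis
  proof (rule that[of \<Gamma> C "sqrt a"])
    fix x :: 'a and \<gamma> :: real and k :: nat
    assume \<gamma>: "0 < \<gamma>" "\<gamma> \<le> \<Gamma>"
    note mk = measurable_mala_kernel[OF \<gamma>(1)]
    have sk: "sets (kiter borel (mala_kernel U g \<gamma>) k x) = sets borel"
      using kernel_prob_space(2)[OF measurable_kiter[OF mk]] by simp
    have "(\<integral>\<^sup>+y. ennreal (Wfun \<eta> y) \<partial>kiter borel (mala_kernel U g \<gamma>) k x) \<le> ennreal ((1 - \<gamma>) ^ k * Wfun \<eta> x + b)"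
      by (rule nn_integral_kiter_drift[OF mk Wm W0 \<gamma>(1) \<Gamma>_le(3)[OF \<gamma>(2)] b drift[OF \<gamma>(1) \<Gamma>_le(1)[OF \<gamma>(2)]]]) simp
    moreover have "0 \<le> (1 - \<gamma>) ^ k * Wfun \<eta> x + b" using \<Gamma>_le(3)[OF \<gamma>(2)] W0 b by simp
    ultimately show "integrable (mala_iter U g \<gamma> k x) (Wfun \<eta>)"
      unfolding mala_iter_eq_kiter using sk W0
      by (intro integral_le_of_nn_integral_le(1)) (auto cong: measurable_cong_sets)
    show "vnorm (Wfun \<eta>) (mala_iter U g \<gamma> k x) (pi_meas U)
      \<le> C * sqrt a powr (\<gamma> * real k) * (Wfun \<eta> x + (\<integral>z. Wfun \<eta> z \<partial>pi_meas U))"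
      unfolding vnorm_def
    proof (rule cSUP_least)
      have "(\<lambda>_. 0) \<in> {f. f \<in> borel_measurable borel \<and> (\<forall>x::'a. \<bar>f x\<bar> \<le> Wfun \<eta> x)}" using W0 by simp
      then show "{f. f \<in> borel_measurable borel \<and> (\<forall>x::'a. \<bar>f x\<bar> \<le> Wfun \<eta> x)} \<noteq> {}" by blast
    qed (use conv[OF \<gamma>] in auto)
  qed (use \<Gamma> C a0 a1 in auto)
qed

end

theorem theorem5:
  fixes U :: "'a::euclidean_space \<Rightarrow> real"
    and g :: "'a \<Rightarrow> 'a"
    and H :: "'a \<Rightarrow> ('a \<Rightarrow>\<^sub>L 'a)"
    and T :: "'a \<Rightarrow> ('a \<Rightarrow>\<^sub>L ('a \<Rightarrow>\<^sub>L 'a))"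
    and \<beta> L M m\<^sub>\<beta> L\<^sub>\<beta> K\<^sub>\<beta> :: real
  assumes beta: "0 \<le> \<beta>" "\<beta> < 1"
    and grad: "\<And>x. (U has_derivative (\<lambda>h. g x \<bullet> h)) (at x)"
    and hess: "\<And>x. (g has_derivative blinfun_apply (H x)) (at x)"
    and third: "\<And>x. (H has_derivative blinfun_apply (T x)) (at x)"
    and T_cont: "continuous_on UNIV T"
    and grad0: "g 0 = 0"
    and L: "L \<ge> 0" "\<And>x. norm (H x) \<le> L"
    and M: "M \<ge> 0" "\<And>x. norm (T x) \<le> M"
    and cond3: "m\<^sub>\<beta> > 0" "L\<^sub>\<beta> \<ge> 0" "K\<^sub>\<beta> \<ge> 0"
      "\<And>x y. norm x \<ge> K\<^sub>\<beta> \<Longrightarrow> norm y = 1 \<Longrightarrow>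
          L\<^sub>\<beta> / (1 + rpow (norm x) (3 * \<beta> / 4)) \<ge> blinfun_apply (H x) y \<bullet> y
        \<and> blinfun_apply (H x) y \<bullet> y \<ge> m\<^sub>\<beta> / (1 + rpow (norm x) \<beta>)"
  shows "\<exists>\<Gamma> > 0. \<exists>A > 0.
      integrable (pi_meas U) (Wfun (m\<^sub>\<beta> / 2^5))
    \<and> (\<integral>x. Wfun (m\<^sub>\<beta> / 2^5) x \<partial>pi_meas U) \<le> A
    \<and> (\<forall>\<gamma>b. 0 < \<gamma>b \<and> \<gamma>b \<le> \<Gamma> \<longrightarrow>
         (\<exists>C \<ge> 0. \<exists>\<rho>. 0 \<le> \<rho> \<and> \<rho> < 1 \<and>
           (\<forall>x \<gamma> (k::nat). 0 < \<gamma> \<and> \<gamma> \<le> \<gamma>b \<longrightarrow>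
              integrable (mala_iter U g \<gamma> k x) (Wfun (m\<^sub>\<beta> / 2^5))
            \<and> vnorm (Wfun (m\<^sub>\<beta> / 2^5)) (mala_iter U g \<gamma> k x) (pi_meas U)
                \<le> C * rpow \<rho> (\<gamma> * real k)
                  * (Wfun (m\<^sub>\<beta> / 2^5) x + (\<integral>z. Wfun (m\<^sub>\<beta> / 2^5) z \<partial>pi_meas U)))))"
proof -
  interpret mala_potential U g H L \<beta> m\<^sub>\<beta> L\<^sub>\<beta> K\<^sub>\<beta>
    by unfold_locales (use assms in auto)
  define \<eta> where "\<eta> = m\<^sub>\<beta> / 2^5"
  have \<eta>: "0 < \<eta>" using cond3 by (simp add: \<eta>_def)
  obtain \<Gamma> C \<rho> where *: "0 < \<Gamma>" "0 \<le> C" "0 < \<rho>" "\<rho> < 1"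
    "\<And>x \<gamma> k. 0 < \<gamma> \<Longrightarrow> \<gamma> \<le> \<Gamma> \<Longrightarrow> integrable (mala_iter U g \<gamma> k x) (Wfun \<eta>)"
    "\<And>x \<gamma> k. 0 < \<gamma> \<Longrightarrow> \<gamma> \<le> \<Gamma> \<Longrightarrow> vnorm (Wfun \<eta>) (mala_iter U g \<gamma> k x) (pi_meas U)
      \<le> C * \<rho> powr (\<gamma> * real k) * (Wfun \<eta> x + (\<integral>z. Wfun \<eta> z \<partial>pi_meas U))"
    using mala_geometric_ergodicity[OF \<eta>] by blast
  have W0: "0 \<le> Wfun \<eta> x" for x :: 'a by (rule less_imp_le[OF Wfun_pos])
  have int: "integrable (pi_meas U) (Wfun \<eta>)"
    using nn_integral_Wfun_pi_meas[of \<eta>] \<eta> W0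
    by (intro integrableI_nonneg) (auto cong: measurable_cong_sets)
  \<comment> \<open>Since \<rho> is positive, the convention of \<open>rpow\<close> at exponent 0,
    reached for \<open>k = 0\<close>, agrees with \<open>powr\<close>.\<close>
  have rp: "rpow \<rho> s = \<rho> powr s" for s using *(3) by (simp add: rpow_def)
  \<comment> \<open>The integral plus 1 serves as \<open>A\<close>, the 1 making positivity
    immediate. \<open>C\<close> and \<rho> obtained for \<Gamma> are valid for every smaller bound
    on the step size.\<close>
  have "0 \<le> (\<integral>x. Wfun \<eta> x \<partial>pi_meas U)" using W0 by simp
  then have "0 < (\<integral>x. Wfun \<eta> x \<partial>pi_meas U) + 1" by linarith
  then show ?thesis
    unfolding \<eta>_def[symmetric]
    using * int
    by (intro exI[of _ \<Gamma>] conjI exI[of _ "(\<integral>x. Wfun \<eta> x \<partial>pi_meas U) + 1"] allI impI exI[of _ C] exI[of _ \<rho>])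
      (auto simp: rp)
qed

end
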